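(* Let $\rho>0$ and let $a,b:[0,\infty)\to[0,\infty)$ and $\mathfrak n$ satisfy: (i) $a,b\in\mathcal C^0([0,\infty))\cap\mathcal C^1(0,\infty)$; (ii) $a'$ and $b'$ are bounded on $(1,\infty)$; (iii) $a(x)>0$ for all $x>0$ and $1/a\in L^1(0,1)$; (iv) $\Phi:=b/a$ on $(0,\infty)$ has a limit $\Phi_0\in[0,\infty]$ at $0^+$, $\Phi_0<\rho$, and $\Phi'\in L^1(0,1)$; (v) $\mathfrak n$ is a nonnegative continuous function on $[\Phi_0,\infty)$. Let $f^{\rm in}\geq 0$ with $f^{\rm in}\in L^1((0,\infty),(1+x)\,dx)$ and $u^{\rm in}:=\rho-\int_0^\infty xf^{\rm in}(x)\,dx>\Phi_0$. Then there exist $T\in(0,+\infty]$ and a function $f\in\mathcal C([0,T);w-L^1((0,\infty),(1+x)\,dx))$ such that: (1) $f$ is a solution to the Lifshitz--Slyozov equation on $[0,T)$ with mass $\rho$, kinetic rates $\{a,b,\mathfrak n\}$ and initial value $f^{\rm in}$; (2) $f(0,x)=f^{\rm in}(x)$ for a.e. $x>0$, and for all $t\in(0,T)$, $\lim_{x\to0^+}(a(x)u(t)-b(x))f(t,x)=\mathfrak n(u(t))$, where $u(t)=\rho-\int_0^\infty xf(t,x)\,dx$; (3) either $T=\infty$, or $T<\infty$ and $\lim_{t\to T}u(t)=\Phi_0$.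
   Context: For $T\in(0,\infty]$, a function $f$ is a solution to the Lifshitz--Slyozov equation on $[0,T)$ with mass $\rho$, kinetic rates $\{a,b,\mathfrak n\}$ and initial value $f^{\rm in}$ if: (1) $f\in\mathcal C([0,T),w-L^1((0,\infty),x\,dx))$ (continuity into $L^1$ endowed with its weak topology), $f\ge0$, and for each $T^*<T$, $f\in L^\infty((0,T^* ),L^1((0,\infty),dx))$; (2) for all $t\in[0,T)$, $u(t):=\rho-\int_0^\infty xf(t,x)\,dx>\Phi_0$; (3) for all $\varphi\in\mathcal C^1_c([0,T)\times[0,\infty))$, $\int_0^T\int_0^\infty(\partial_t\varphi+(a(x)u(t)-b(x))\partial_x\varphi)f\,dx\,dt+\int_0^T\varphi(t,0)\mathfrak n(u(t))\,dt+\int_0^\infty\varphi(0,x)f^{\rm in}(x)\,dx=0$. *)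

theory Defs
  imports "HOL-Analysis.Analysis"
begin

definition tint :: "ereal \<Rightarrow> real set" where
  "tint T = {t. 0 \<le> t \<and> ereal t < T}"

text \<open>Weak continuity: f in C([0,T); w-L^1((0,infinity), w(x) dx)).
  The dual of L^1(w dx) is L^infinity, so weak continuity means continuity of
  t |-> int psi(x) f(t,x) w(x) dx for every bounded measurable psi.\<close>
definition wL1_cont :: "(real \<Rightarrow> real) \<Rightarrow> ereal \<Rightarrow> (real \<Rightarrow> real \<Rightarrow> real) \<Rightarrow> bool" where
  "wL1_cont w T f \<longleftrightarrow>
     (\<forall>t\<in>tint T. set_integrable lborel {0<..} (\<lambda>x. w x * f t x)) \<and>
     (\<forall>\<psi>::real \<Rightarrow> real. \<psi> \<in> borel_measurable lborel \<and> bounded (range \<psi>) \<longrightarrow>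
        continuous_on (tint T) (\<lambda>t. LINT x:{0<..}|lborel. \<psi> x * (w x * f t x)))"

definition LS_u :: "real \<Rightarrow> (real \<Rightarrow> real \<Rightarrow> real) \<Rightarrow> real \<Rightarrow> real" where
  "LS_u \<rho> f t = \<rho> - (LINT x:{0<..}|lborel. x * f t x)"

text \<open>Test functions C^1_c([0,T) x [0,infinity)): restrictions of C^1 functions on R^2
  (partial derivatives phit, phix exist everywhere and are continuous) whose support in the
  closed quadrant lies in [0,T'] x [0,R] with T' < T.\<close>
definition test_fun :: "ereal \<Rightarrow> (real \<Rightarrow> real \<Rightarrow> real) \<Rightarrow> (real \<Rightarrow> real \<Rightarrow> real)
      \<Rightarrow> (real \<Rightarrow> real \<Rightarrow> real) \<Rightarrow> bool" where
  "test_fun T \<phi> \<phi>t \<phi>x \<longleftrightarrow>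
     (\<forall>t x. ((\<lambda>s. \<phi> s x) has_real_derivative \<phi>t t x) (at t) \<and>
            ((\<lambda>y. \<phi> t y) has_real_derivative \<phi>x t x) (at x)) \<and>
     continuous_on UNIV (\<lambda>z. \<phi>t (fst z) (snd z)) \<and>
     continuous_on UNIV (\<lambda>z. \<phi>x (fst z) (snd z)) \<and>
     (\<exists>T' R. ereal T' < T \<and>
        (\<forall>t x. 0 \<le> t \<longrightarrow> 0 \<le> x \<longrightarrow> (T' < t \<or> R < x) \<longrightarrow> \<phi> t x = 0))"

definition LS_solution :: "ereal \<Rightarrow> real \<Rightarrow> (real \<Rightarrow> real) \<Rightarrow> (real \<Rightarrow> real) \<Rightarrow> (real \<Rightarrow> real)
      \<Rightarrow> ereal \<Rightarrow> (real \<Rightarrow> real) \<Rightarrow> (real \<Rightarrow> real \<Rightarrow> real) \<Rightarrow> bool" where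
  "LS_solution T \<rho> a b n \<Phi>0 fin f \<longleftrightarrow>
     \<comment> \<open>(1)\<close>
     wL1_cont (\<lambda>x. x) T f \<and>
     (\<forall>t\<in>tint T. \<forall>x>0. 0 \<le> f t x) \<and>
     (\<forall>T'. 0 < T' \<and> ereal T' < T \<longrightarrow>
        (\<exists>C. AE t in lborel. t \<in> {0<..<T'} \<longrightarrow>
               set_integrable lborel {0<..} (f t) \<and> (LINT x:{0<..}|lborel. \<bar>f t x\<bar>) \<le> C)) \<and>
     \<comment> \<open>(2)\<close>
     (\<forall>t\<in>tint T. ereal (LS_u \<rho> f t) > \<Phi>0) \<and>
     \<comment> \<open>(3) weak formulation, with all integrals required to exist\<close>
     (\<forall>\<phi> \<phi>t \<phi>x. test_fun T \<phi> \<phi>t \<phi>x \<longrightarrow>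
        (let S = {z::real\<times>real. fst z \<in> tint T \<and> 0 < snd z};
             G = (\<lambda>z. (\<phi>t (fst z) (snd z) + (a (snd z) * LS_u \<rho> f (fst z) - b (snd z)) * \<phi>x (fst z) (snd z))
                        * f (fst z) (snd z));
             H = (\<lambda>t. \<phi> t 0 * n (LS_u \<rho> f t))
         in set_integrable lborel S G \<and> set_integrable lborel (tint T) H \<and>
            set_integrable lborel {0<..} (\<lambda>x. \<phi> 0 x * fin x) \<and>
            (LINT z:S|lborel. G z) + (LINT t:tint T|lborel. H t)
              + (LINT x:{0<..}|lborel. \<phi> 0 x * fin x) = 0))"

end

(*
  With y = A(x), the integral of 1/a over [0, x], the growth law x' = a(x) u - b(x) becomes
  y' = u(t) - Psi(y), Psi = (b/a) o A^{-1}, which is extended to y <= 0 by Psi = Phi0.  On this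
  extended line the influx at x = 0 is an initial datum on the negative half line, and the solution
  is the image of one measure under one flow.  Psi is only of bounded variation at 0, but there all
  characteristics move with a speed bounded below; for two of them, y1 < y2, the mean over [y1, y2]
  of the variation of Psi is then a Lyapunov function which controls log (y2 - y1).  This yields
  uniqueness, differentiability in the initial position, and a derivative tending to 1 at the
  boundary, hence the boundary flux.  The concentration u solves u = Gam(u) with Gam causal and
  bounded in locally Lipschitz functions: solutions of the delayed equation, truncated just above
  Phi0, exist for all times and accumulate at some u, and T is the first time at which u meets Phi0.
*)
theory Submission
  imports Defs "HOL-Complex_Analysis.Great_Picard"
begin

section \<open>Compactness, delay equations and barriers\<close>

text \<open>The obstacle is x = 0: there \<open>a\<close> may vanish and the derivative of Psi is at
  best integrable, so the velocity field is not Lipschitz and Gronwall's inequality gives nothing.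
  What helps is transversality: admissible velocities exceed Phi0 by a fixed margin, so
  characteristics run through the singular layer with positive speed. Write p for the speed at y1,
  dV and dPsi for the differences between y2 and y1. The mean m of V over [y1, y2] has the
  derivative (p * dV - (V(y2) - m) * dPsi) / (y2 - y1). In a layer where V \<le> d and p \<ge> 3 * d
  this is at least 2 * d * |dPsi| / (y2 - y1), that is 2 * d times the logarithmic derivative of the
  gap in absolute value. The gap therefore changes at most by the factor exp (V(y2) / (2 * d)),
  however long the passage takes. Since \<open>n\<close> is only continuous, no Lipschitz dependence
  of Gam on the velocity is available, so u comes from compactness and not from a contraction.
  Integrals are taken over labels: there the weights contain neither \<open>a\<close> nor the speed,
  and one dominating function fits all velocities.\<close>

lemma locally_lipschitz_subsequence:
  fixes F :: "nat \<Rightarrow> real \<Rightarrow> real"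
  assumes bdd: "\<And>k t. 0 \<le> t \<Longrightarrow> \<bar>F k t\<bar> \<le> B t"
    and lip: "\<And>N. \<exists>L. \<forall>k. \<forall>s\<in>{0..N}. \<forall>t\<in>{0..N}. \<bar>F k s - F k t\<bar> \<le> L * \<bar>s - t\<bar>"
  obtains r g where "strict_mono (r::nat\<Rightarrow>nat)" "\<And>t. 0 \<le> t \<Longrightarrow> (\<lambda>k. F (r k) t) \<longlonglongrightarrow> g t"
proof -
  let ?S = "\<rat> \<inter> {0..} :: real set"
  \<comment> \<open>Arzela-Ascoli with pointwise limits: a diagonal subsequence over the nonnegative
    rationals, then equicontinuity. \<open>function_convergent_subsequence\<close> wants one bound
    for all points, hence the normalisation.\<close>
  let ?f = "\<lambda>n x. F n x / (1 + \<bar>B x\<bar>)"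
  have "countable ?S" by (simp add: countable_rat)
  moreover have "norm (?f n x) \<le> 1" if "x \<in> ?S" for n x
  proof -
    have "\<bar>F n x\<bar> \<le> 1 + \<bar>B x\<bar>" using bdd[of x n] that by auto
    moreover have "1 + \<bar>B x\<bar> > 0" by (smt (verit) abs_ge_zero)
    ultimately show ?thesis by (simp add: divide_le_eq)
  qed
  ultimately obtain r where r: "strict_mono (r::nat\<Rightarrow>nat)"
    and conv: "\<And>x. x \<in> ?S \<Longrightarrow> \<exists>l. (\<lambda>n. ?f (r n) x) \<longlonglongrightarrow> l"
    using function_convergent_subsequence[of ?S ?f 1] by metis
  have convF: "Cauchy (\<lambda>n. F (r n) x)" if "x \<in> ?S" for x
  proof -
    have "\<exists>l. (\<lambda>n. ?f (r n) x) \<longlonglongrightarrow> l" by (rule conv[OF that])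
    then obtain l where "(\<lambda>n. ?f (r n) x) \<longlonglongrightarrow> l" ..
    then have "(\<lambda>n. ?f (r n) x * (1 + \<bar>B x\<bar>)) \<longlonglongrightarrow> l * (1 + \<bar>B x\<bar>)"
      by (intro tendsto_intros)
    moreover have "?f (r n) x * (1 + \<bar>B x\<bar>) = F (r n) x" for n
    proof -
      have "1 + \<bar>B x\<bar> > 0" by (smt (verit) abs_ge_zero)
      then show ?thesis by simp
    qed
    ultimately show ?thesis by (simp add: LIMSEQ_imp_Cauchy)
  qed
  have "\<exists>l. (\<lambda>n. F (r n) t) \<longlonglongrightarrow> l" if "0 \<le> t" for t
  proof -
    obtain L where L: "\<And>k x y. x \<in> {0..t+1} \<Longrightarrow> y \<in> {0..t+1} \<Longrightarrow> \<bar>F k x - F k y\<bar> \<le> L * \<bar>x - y\<bar>"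
      using lip[of "t+1"] by blast
    have "Cauchy (\<lambda>n. F (r n) t)"
    proof (rule metric_CauchyI)
      fix e :: real assume "0 < e"
      \<comment> \<open>Positive, so that it can be divided by; the cap 1 on the distance from
        \<open>t\<close> to \<open>q\<close> keeps both in \<open>{0..t+1}\<close>, where
        \<open>L\<close> is valid.\<close>
      let ?L = "\<bar>L\<bar> + 1"
      have "t < t + min 1 (e / (3 * ?L))" using \<open>0 < e\<close> by simp
      then obtain q where q: "q \<in> \<rat>" "t < q" "q < t + min 1 (e / (3 * ?L))"
        using Rats_dense_in_real by blast
      then have "q \<in> ?S" using that by auto
      from metric_CauchyD[OF convF[OF this], of "e/3"] \<open>0 < e\<close>
      obtain M where M: "\<And>m n. m \<ge> M \<Longrightarrow> n \<ge> M \<Longrightarrow> dist (F (r m) q) (F (r n) q) < e/3" by auto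
      have near: "\<bar>F (r m) t - F (r m) q\<bar> \<le> e/3" for m
      proof -
        have "\<bar>F (r m) t - F (r m) q\<bar> \<le> L * \<bar>t - q\<bar>"
          using q that by (intro L) auto
        also have "\<dots> \<le> ?L * (e / (3 * ?L))"
          using q by (intro mult_mono) auto
        also have "\<dots> = e/3" by (simp add: field_simps)
        finally show ?thesis .
      qed
      show "\<exists>M. \<forall>m\<ge>M. \<forall>n\<ge>M. dist (F (r m) t) (F (r n) t) < e"
      proof (intro exI[of _ M] allI impI)
        fix m n assume "M \<le> m" "M \<le> n"
        then show "dist (F (r m) t) (F (r n) t) < e"
          using near[of m] near[of n] M[of m n] unfolding dist_real_def by linarith
      qed
    qed
    then show ?thesis by (simp add: Cauchy_convergent_iff convergent_def)
  qed
  then have "\<forall>t. \<exists>l. 0 \<le> t \<longrightarrow> (\<lambda>n. F (r n) t) \<longlonglongrightarrow> l" by blast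
  then obtain g where "\<forall>t. 0 \<le> t \<longrightarrow> (\<lambda>n. F (r n) t) \<longlonglongrightarrow> g t" by metis
  with r that show thesis by blast
qed

text \<open>The method of steps. Since \<open>\<Delta> g t\<close> sees \<open>g\<close> only up to
  \<open>t - h\<close>, the n-th iterate is final for \<open>t < n * h\<close> and the iterates can
  be glued. \<open>P\<close> is the class on which \<open>\<Delta>\<close> is causal;
  \<open>Ploc\<close> carries it over to the glued function, which is itself no iterate.\<close>

lemma delay_fixpoint:
  fixes \<Delta> :: "(real \<Rightarrow> real) \<Rightarrow> real \<Rightarrow> real" and h c :: real
  assumes h: "0 < h"
    and causal: "\<And>g g' t. P g \<Longrightarrow> P g' \<Longrightarrow> (\<And>r. r \<le> t - h \<Longrightarrow> g r = g' r) \<Longrightarrow> \<Delta> g t = \<Delta> g' t"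
    and P0: "P (\<lambda>_. c)"
    and Pstep: "\<And>g. P g \<Longrightarrow> P (\<lambda>t. if t < 0 then c else \<Delta> g t)"
    and Ploc: "\<And>g. (\<And>N. \<exists>g'. P g' \<and> (\<forall>t\<le>N. g t = g' t)) \<Longrightarrow> P g"
  obtains g where "P g" "\<And>t. t < 0 \<Longrightarrow> g t = c" "\<And>t. 0 \<le> t \<Longrightarrow> g t = \<Delta> g t"
proof -
  define G where "G = rec_nat (\<lambda>_. c) (\<lambda>_ g t. if t < 0 then c else \<Delta> g t)"
  have G0: "G 0 = (\<lambda>_. c)" and GS: "\<And>n. G (Suc n) = (\<lambda>t. if t < 0 then c else \<Delta> (G n) t)"
    unfolding G_def by simp_all
  have PG: "P (G n)" for n by (induction n) (simp_all add: G0 GS P0 Pstep)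
  have G_step: "G (Suc n) t = G n t" if "t < real n * h" for n t
    using that
  proof (induction n arbitrary: t)
    case 0 then show ?case by (simp add: G0 GS)
  next
    case (Suc n)
    have "\<Delta> (G (Suc n)) t = \<Delta> (G n) t"
      using Suc by (intro causal PG Suc.IH) (auto simp: algebra_simps)
    then show ?case by (simp add: GS[of "Suc n"] GS[of n])
  qed
  have stable: "G m t = G n t" if "t < real n * h" "n \<le> m" for m n t
    using that(2)
  proof (induction m rule: dec_induct)
    case base then show ?case by simp
  next
    case (step m)
    have "t < real m * h"
      using that(1) step(1) h by (smt (verit) mult_right_mono of_nat_mono)
    then have "G (Suc m) t = G m t" by (rule G_step)
    with step.IH show ?case by simp
  qed
  define N where "N t = nat \<lceil>\<bar>t\<bar> / h\<rceil> + 1" for t :: real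
  have N: "t < real (N t) * h" for t
  proof -
    have "\<bar>t\<bar> / h < real (N t)" unfolding N_def by linarith
    then show ?thesis using h by (simp add: pos_divide_less_eq)
  qed
  define g where "g t = G (N t) t" for t
  have g_eq: "g t = G n t" if "t < real n * h" for t n
    unfolding g_def using stable[OF N, of t "max n (N t)"] stable[OF that, of "max n (N t)"] by simp
  have "P g"
  proof (rule Ploc)
    fix M
    have "g t = G (N M) t" if "t \<le> M" for t
      using g_eq[of t "N M"] N[of M] that by simp
    then show "\<exists>g'. P g' \<and> (\<forall>t\<le>M. g t = g' t)" using PG by blast
  qed
  show thesis
  proof (rule that[OF \<open>P g\<close>])
    show "g t = c" if "t < 0" for t
      using g_eq[of t 0] that by (simp add: G0)
    show "g t = \<Delta> g t" if "0 \<le> t" for t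
    proof -
      have "g t = G (Suc (N t)) t" using N[of t] h by (intro g_eq) (simp add: algebra_simps)
      also have "\<dots> = \<Delta> (G (N t)) t" using that by (simp add: GS)
      also have "\<dots> = \<Delta> g t"
        using N[of t] h by (intro causal PG \<open>P g\<close> g_eq[symmetric]) auto
      finally show ?thesis .
    qed
  qed
qed

text \<open>A barrier needs a sign only strictly below the level: after the last time
  \<open>q\<close> with \<open>c \<le> y q\<close> the function is nondecreasing, so it cannot end
  below \<open>y q\<close>.\<close>

lemma stay_above:
  fixes y :: "real \<Rightarrow> real"
  assumes "s \<le> t" "continuous_on {s..t} y" "c \<le> y s"
    and der: "\<And>r. s < r \<Longrightarrow> r < t \<Longrightarrow> y r < c \<Longrightarrow> \<exists>d\<ge>0. (y has_real_derivative d) (at r)"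
  shows "c \<le> y t"
proof (rule ccontr)
  assume "\<not> c \<le> y t"
  define S where "S = {r\<in>{s..t}. c \<le> y r}"
  have "closed S"
    unfolding S_def using assms(2) by (intro continuous_on_closed_Collect_le) auto
  moreover have "s \<in> S" "S \<subseteq> {s..t}" using assms by (auto simp: S_def)
  ultimately have "Sup S \<in> S"
    by (intro closed_contains_Sup) (auto intro: bdd_above_mono)
  define q where "q = Sup S"
  have q: "s \<le> q" "q \<le> t" "c \<le> y q" using \<open>Sup S \<in> S\<close> by (auto simp: S_def q_def)
  have after: "y r < c" if "q < r" "r \<le> t" for r
  proof (rule ccontr)
    assume "\<not> y r < c"
    then have "r \<in> S" using that q by (auto simp: S_def)
    then have "r \<le> q" unfolding q_def using \<open>S \<subseteq> {s..t}\<close>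
      by (intro cSup_upper) (auto intro: bdd_above_mono)
    with that show False by simp
  qed
  have "y q \<le> y t"
  proof (rule DERIV_nonneg_imp_increasing_open[OF q(2)])
    show "continuous_on {q..t} y" using assms(2) q by (auto intro: continuous_on_subset)
    show "\<exists>d. (y has_real_derivative d) (at x) \<and> 0 \<le> d" if "q < x" "x < t" for x
      using der[of x] after[of x] that q by force
  qed
  with q \<open>\<not> c \<le> y t\<close> show False by simp
qed

text \<open>Completeness along a filter, without a candidate for the limit. It is applied to
  logarithmic difference quotients that are located only up to an error \<open>e\<close>, around a
  centre depending on \<open>e\<close>.\<close>

lemma approx_limit_exists:
  fixes g :: "'a \<Rightarrow> real"
  assumes nb: "F \<noteq> bot"
    and approx: "\<And>e. 0 < e \<Longrightarrow> \<exists>l. eventually (\<lambda>z. \<bar>g z - l\<bar> \<le> e) F"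
  obtains l where "(g \<longlongrightarrow> l) F"
proof -
  have "\<exists>l. eventually (\<lambda>z. \<bar>g z - l\<bar> \<le> 1 / (real k + 1)) F" for k :: nat
    using approx[of "1 / (real k + 1)"] by simp
  then obtain l where l: "\<And>k. eventually (\<lambda>z. \<bar>g z - l k\<bar> \<le> 1 / (real k + 1)) F" by metis
  have ll: "\<bar>l j - l k\<bar> \<le> 1 / (real j + 1) + 1 / (real k + 1)" for j k
  proof -
    have "eventually (\<lambda>z. \<bar>l j - l k\<bar> \<le> 1 / (real j + 1) + 1 / (real k + 1)) F"
      using l[of j] l[of k] by eventually_elim linarith
    then show ?thesis using nb by (simp add: eventually_const)
  qed
  have "Cauchy l"
  proof (rule metric_CauchyI)
    fix e :: real assume "0 < e"
    obtain M :: nat where M: "2 / e < real M" using reals_Archimedean2 by blast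
    have small: "1 / (real k + 1) < e / 2" if "M \<le> k" for k
    proof -
      have "2 / e < real k + 1" using M that by linarith
      then show ?thesis using \<open>0 < e\<close> by (simp add: field_simps)
    qed
    show "\<exists>M. \<forall>m\<ge>M. \<forall>n\<ge>M. dist (l m) (l n) < e"
    proof (intro exI[of _ M] allI impI)
      fix m n assume "M \<le> m" "M \<le> n"
      then show "dist (l m) (l n) < e"
        using ll[of m n] small[of m] small[of n] by (simp add: dist_real_def)
    qed
  qed
  then obtain L where L: "l \<longlonglongrightarrow> L" using Cauchy_convergent_iff convergent_def by blast
  have "(g \<longlongrightarrow> L) F"
  proof (rule tendstoI)
    fix e :: real assume "0 < e"
    have "(\<lambda>k. 1 / (real k + 1)) \<longlonglongrightarrow> 0" using lim_1_over_real_power LIMSEQ_inverse_real_of_nat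
      by (simp add: inverse_eq_divide add.commute)
    from order_tendstoD(2)[OF this, of "e/2"] tendstoD[OF L, of "e/2"] \<open>0 < e\<close>
    have "\<forall>\<^sub>F k in sequentially. 1 / (real k + 1) < e/2 \<and> dist (l k) L < e/2"
      by (intro eventually_conj) auto
    then obtain k where k: "1 / (real k + 1) < e/2" "dist (l k) L < e/2"
      using eventually_happens by fastforce
    show "eventually (\<lambda>z. dist (g z) L < e) F"
      using l[of k]
    proof eventually_elim
      case (elim z)
      then show ?case using k unfolding dist_real_def by linarith
    qed
  qed
  with that show thesis .
qed

section \<open>Characteristics\<close>

text \<open>\<open>V\<close> is the total variation of \<open>\<Psi>\<close> counted from 0. Nothing
  bounds \<open>\<Psi>'\<close> near 0; the continuity of \<open>V\<close> there expresses that
  \<open>\<Psi>'\<close> is integrable, and this is the only regularity at 0.\<close>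

locale drift =
  fixes \<Psi> \<Psi>' V :: "real \<Rightarrow> real" and p0 rho :: real
  assumes Psi_cont: "continuous_on UNIV \<Psi>"
    and Psi_le0: "y \<le> 0 \<Longrightarrow> \<Psi> y = p0"
    and Psi_nonneg: "0 \<le> \<Psi> y"
    and Psi_deriv: "0 < y \<Longrightarrow> (\<Psi> has_real_derivative \<Psi>' y) (at y)"
    and Psi'_cont: "continuous_on {0<..} \<Psi>'"
    and V_cont: "continuous_on UNIV V"
    and V_le0: "y \<le> 0 \<Longrightarrow> V y = 0"
    and V_deriv: "0 < y \<Longrightarrow> (V has_real_derivative \<bar>\<Psi>' y\<bar>) (at y)"
begin

text \<open>The uniform margin \<open>d\<close> makes every characteristic left of 0 move to the
  right with speed at least \<open>d\<close>. Velocities are functions on the whole line, although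
  only times \<ge> 0 matter, so that delayed arguments need no side condition.\<close>

definition adm :: "(real \<Rightarrow> real) \<Rightarrow> bool" where
  "adm v \<longleftrightarrow> continuous_on UNIV v \<and> (\<exists>d>0. \<forall>t. p0 + d \<le> v t) \<and> (\<forall>t. v t \<le> rho)"

definition sol :: "(real \<Rightarrow> real) \<Rightarrow> real \<Rightarrow> real \<Rightarrow> (real \<Rightarrow> real) \<Rightarrow> bool" where
  "sol v z T y \<longleftrightarrow> y 0 = z \<and> continuous_on {0..T} y \<and>
     (\<forall>t. 0 < t \<and> t < T \<longrightarrow> (y has_real_derivative v t - \<Psi> (y t)) (at t))"

text \<open>A velocity \<open>v \<ge> p0 + 4 * d\<close> keeps \<open>v - \<Psi> \<ge> 3 * d\<close> on the strip \<open>y \<le> eta\<close>, because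
  \<open>\<Psi> \<le> p0 + V \<le> p0 + d\<close> there.\<close>
definition strip :: "(real \<Rightarrow> real) \<Rightarrow> real \<Rightarrow> real \<Rightarrow> bool" where
  "strip v d eta \<longleftrightarrow> 0 < d \<and> 0 < eta \<and> V eta \<le> d \<and> (\<forall>t. p0 + 4 * d \<le> v t \<and> v t \<le> rho)"

lemma p0_nonneg: "0 \<le> p0"
  using Psi_nonneg[of 0] by (simp add: Psi_le0)

lemma admD:
  assumes "adm v"
  shows "continuous_on A v" "p0 < v t" "v t \<le> rho" "p0 < rho"
proof -
  from assms obtain d where "d > 0" "\<And>t. p0 + d \<le> v t" by (auto simp: adm_def)
  then have *: "p0 < v t" for t using less_le_trans[of p0 "p0 + d" "v t"] by simp
  show "p0 < v t" by (rule *)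
  show "v t \<le> rho" "p0 < rho" using assms *[of 0] by (auto simp: adm_def intro: less_le_trans)
  show "continuous_on A v" using assms by (auto simp: adm_def intro: continuous_on_subset)
qed

text \<open>The substitute for a Lipschitz bound. \<open>V - \<Psi>\<close> and
  \<open>V + \<Psi>\<close> are both nondecreasing, because \<open>V' = |\<Psi>'|\<close> on the
  right of 0 and everything is constant on the left.\<close>

lemma Psi_V_diff:
  assumes "x \<le> y" shows "\<bar>\<Psi> y - \<Psi> x\<bar> \<le> V y - V x"
proof -
  have pos: "\<bar>\<Psi> y - \<Psi> x\<bar> \<le> V y - V x" if "0 \<le> x" "x \<le> y" for x y
  proof -
    have "V x - \<Psi> x \<le> V y - \<Psi> y"
    proof (rule DERIV_nonneg_imp_increasing_open[OF that(2)])
      show "\<exists>d. ((\<lambda>r. V r - \<Psi> r) has_real_derivative d) (at r) \<and> 0 \<le> d" if "x < r" "r < y" for r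
        using that \<open>0 \<le> x\<close>
        by (intro exI[of _ "\<bar>\<Psi>' r\<bar> - \<Psi>' r"]) (auto intro!: derivative_eq_intros V_deriv Psi_deriv)
      show "continuous_on {x..y} (\<lambda>r. V r - \<Psi> r)"
        by (intro continuous_intros continuous_on_subset[OF V_cont] continuous_on_subset[OF Psi_cont]) auto
    qed
    moreover have "V x + \<Psi> x \<le> V y + \<Psi> y"
    proof (rule DERIV_nonneg_imp_increasing_open[OF that(2)])
      show "\<exists>d. ((\<lambda>r. V r + \<Psi> r) has_real_derivative d) (at r) \<and> 0 \<le> d" if "x < r" "r < y" for r
        using that \<open>0 \<le> x\<close>
        by (intro exI[of _ "\<bar>\<Psi>' r\<bar> + \<Psi>' r"]) (auto intro!: derivative_eq_intros V_deriv Psi_deriv)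
      show "continuous_on {x..y} (\<lambda>r. V r + \<Psi> r)"
        by (intro continuous_intros continuous_on_subset[OF V_cont] continuous_on_subset[OF Psi_cont]) auto
    qed
    ultimately show ?thesis by linarith
  qed
  consider "0 \<le> x" | "y \<le> 0" | "x < 0" "0 < y" by linarith
  then show ?thesis
  proof cases
    case 3
    then show ?thesis using pos[of 0 y] Psi_le0[of 0] Psi_le0[of x] V_le0[of 0] V_le0[of x] by simp
  qed (use assms pos[of x y] Psi_le0[of x] Psi_le0[of y] V_le0[of x] V_le0[of y] in auto)
qed

lemma V_mono: "x \<le> y \<Longrightarrow> V x \<le> V y"
  using Psi_V_diff[of x y] by linarith

lemma V_nonneg: "0 \<le> V y"
  using V_mono[of 0 y] V_le0[of 0] V_le0[of y] by (cases "0 \<le> y") auto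

lemma Psi_upper: "\<Psi> y \<le> p0 + V y"
  using Psi_V_diff[of 0 y] Psi_le0[of 0] V_le0[of 0] V_nonneg[of y] Psi_le0[of y]
  by (cases "0 \<le> y") auto

lemma strip_exists:
  assumes "adm v" "0 < K"
  obtains d eta where "strip v d eta" "eta < K"
proof -
  from assms obtain d where d: "d > 0" "\<And>t. p0 + d \<le> v t" by (auto simp: adm_def)
  have "isCont V 0" using V_cont by (simp add: continuous_on_eq_continuous_at)
  then obtain k where k: "k > 0" "\<And>y. \<bar>y\<bar> < k \<Longrightarrow> \<bar>V y\<bar> < d/4"
    using d V_le0[of 0] unfolding continuous_at_eps_delta
    by (metis dist_real_def diff_zero zero_less_divide_iff zero_less_numeral order_refl)
  let ?e = "min k K / 2"
  \<comment> \<open>A quarter of the margin, since \<open>strip\<close> asks for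
    \<open>p0 + 4 * d \<le> v\<close>.\<close>
  have "strip v (d/4) ?e"
    unfolding strip_def using d k(2)[of ?e] k(1) assms admD(3)[OF assms(1)] by (auto simp: min_def)
  moreover have "?e < K" using assms k by (auto simp: min_def)
  ultimately show thesis by (rule that)
qed

lemma strip_drift: "strip v d eta \<Longrightarrow> y \<le> eta \<Longrightarrow> 3 * d \<le> v t - \<Psi> y"
proof -
  assume "strip v d eta" "y \<le> eta"
  then have "p0 + 4 * d \<le> v t" "V y \<le> d" using V_mono[of y eta] by (auto simp: strip_def)
  with Psi_upper[of y] show ?thesis by linarith
qed

lemma sol_upper:
  assumes "adm v" "sol v z T y" "0 \<le> s" "s \<le> t" "t \<le> T"
  shows "y t \<le> y s + rho * (t - s)"
proof -
  have "y t - rho * t \<le> y s - rho * s"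
  proof (rule DERIV_nonpos_imp_decreasing_open[OF assms(4)])
    show "\<exists>d. ((\<lambda>r. y r - rho * r) has_real_derivative d) (at x) \<and> d \<le> 0" if "s < x" "x < t" for x
      using that assms admD(3)[OF assms(1), of x] Psi_nonneg[of "y x"]
      by (intro exI[of _ "v x - \<Psi> (y x) - rho"])
         (auto simp: sol_def intro!: derivative_eq_intros)
    show "continuous_on {s..t} (\<lambda>r. y r - rho * r)"
      using assms by (intro continuous_intros) (auto simp: sol_def intro: continuous_on_subset)
  qed
  then show ?thesis by (simp add: algebra_simps)
qed

text \<open>Low levels are crossed only upwards: below 0 the drift is \<open>v - p0 > 0\<close>, and
  inside a strip it is at least \<open>3 * d\<close>.\<close>

lemma sol_stay_above:
  assumes "adm v" "sol v z T y" "0 \<le> s" "s \<le> t" "t \<le> T" "c \<le> y s"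
    and "c \<le> 0 \<or> (\<exists>d eta. strip v d eta \<and> c \<le> eta)"
  shows "c \<le> y t"
proof (rule stay_above[where s = s and y = y])
  show "s \<le> t" "c \<le> y s" by fact+
  show "continuous_on {s..t} y" using assms by (auto simp: sol_def intro: continuous_on_subset)
  fix r assume r: "s < r" "r < t" "y r < c"
  have "0 \<le> v r - \<Psi> (y r)"
    using assms(7)
  proof
    assume "c \<le> 0"
    then show ?thesis using Psi_le0[of "y r"] r admD(2)[OF assms(1), of r] by simp
  next
    assume "\<exists>d eta. strip v d eta \<and> c \<le> eta"
    then obtain d eta where "strip v d eta" "c \<le> eta" by blast
    then show ?thesis using strip_drift[of v d eta "y r" r] r by (auto simp: strip_def)
  qed
  moreover have "(y has_real_derivative v r - \<Psi> (y r)) (at r)"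
    using assms r by (auto simp: sol_def)
  ultimately show "\<exists>d\<ge>0. (y has_real_derivative d) (at r)" by blast
qed

lemma sol_lower:
  assumes "adm v" "sol v z T y" "0 \<le> t" "t \<le> T"
  shows "min z 0 \<le> y t"
  using sol_stay_above[OF assms(1,2) _ assms(3,4), of "min z 0"] assms(2) by (auto simp: sol_def)

lemma sol_strip_before:
  assumes "adm v" "sol v z T y" "strip v d eta" "0 \<le> s" "s \<le> t" "t \<le> T" "y t < c" "c \<le> eta"
  shows "y s < c"
  using sol_stay_above[OF assms(1,2,4,5,6), of c] assms by fastforce

lemma sol_strip_increase:
  assumes "adm v" "sol v z T y" "strip v d eta" "0 \<le> s" "s \<le> t" "t \<le> T" "y t < eta"
  shows "y s + 3 * d * (t - s) \<le> y t"
proof -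
  have "y s - 3 * d * s \<le> y t - 3 * d * t"
  proof (rule DERIV_nonneg_imp_increasing_open[OF assms(5)])
    fix x assume x: "s < x" "x < t"
    have "y x < eta" using sol_strip_before[OF assms(1-3) _ _ assms(6,7), of x] x assms by auto
    then show "\<exists>e. ((\<lambda>r. y r - 3 * d * r) has_real_derivative e) (at x) \<and> 0 \<le> e"
      using x assms strip_drift[OF assms(3), of "y x" x]
      by (intro exI[of _ "v x - \<Psi> (y x) - 3 * d"])
         (auto simp: sol_def intro!: derivative_eq_intros)
  next
    show "continuous_on {s..t} (\<lambda>r. y r - 3 * d * r)"
      using assms by (intro continuous_intros) (auto simp: sol_def intro: continuous_on_subset)
  qed
  then show ?thesis by (simp add: algebra_simps)
qed

lemma V_antiderivative:
  obtains K where "\<And>y. (K has_real_derivative V y) (at y)"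
proof -
  define K where "K y = integral {0..y} V" for y
  have "(K has_real_derivative V y) (at y)" for y
  proof -
    \<comment> \<open>The base point moves to the left of both 0 and \<open>y\<close>, so that
      \<open>y\<close> becomes interior; the additional piece contributes nothing because
      \<open>V\<close> vanishes there.\<close>
    have c: "continuous_on {min y 0 - 1..y + 1} V" by (rule continuous_on_subset[OF V_cont]) auto
    have "((\<lambda>u. integral {min y 0 - 1..u} V) has_real_derivative V y) (at y within {min y 0 - 1..y + 1})"
      by (rule integral_has_real_derivative[OF c]) auto
    moreover have "at y within {min y 0 - 1..y + 1} = at y"
      by (rule at_within_interior) (auto simp: min_def)
    ultimately have "((\<lambda>u. integral {min y 0 - 1..u} V) has_real_derivative V y) (at y)"
      by simp
    moreover have "\<forall>\<^sub>F u in nhds y. integral {min y 0 - 1..u} V = K u"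
    proof -
      have "integral {min y 0 - 1..u} V = K u" if "min y 0 - 1 < u" for u
      proof (cases "0 \<le> u")
        case True
        have "integral {min y 0 - 1..0} V + integral {0..u} V = integral {min y 0 - 1..u} V"
          using True by (intro Henstock_Kurzweil_Integration.integral_combine)
            (auto intro!: integrable_continuous_interval continuous_on_subset[OF V_cont])
        moreover have "integral {min y 0 - 1..0} V = integral {min y 0 - 1..0} (\<lambda>_. 0::real)"
          by (rule integral_cong) (simp add: V_le0)
        ultimately show ?thesis by (simp add: K_def)
      next
        case False
        have "integral {min y 0 - 1..u} V = integral {min y 0 - 1..u} (\<lambda>_. 0::real)"
          using False by (intro integral_cong) (simp add: V_le0)
        then show ?thesis using False by (simp add: K_def)
      qed
      moreover have "\<forall>\<^sub>F u in nhds y. min y 0 - 1 < u"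
        by (rule order_tendstoD(1)[OF filterlim_ident]) auto
      ultimately show ?thesis by (auto elim: eventually_mono)
    qed
    ultimately show ?thesis by (simp add: DERIV_cong_ev)
  qed
  with that show thesis by blast
qed

text \<open>With \<open>K' = V\<close>, the mean \<open>m\<close> of \<open>V\<close> over \<open>[y1, y2]\<close> increases along a pair of solutions at a
  rate which dominates the logarithmic derivative of the gap; no integrability of
  \<open>\<Psi>' \<circ> y\<close> is needed.\<close>
lemma log_gap:
  assumes st: "s \<le> t" and d: "0 < d"
    and cont: "continuous_on {s..t} y1" "continuous_on {s..t} y2"
    and der1: "\<And>r. s < r \<Longrightarrow> r < t \<Longrightarrow> (y1 has_real_derivative v r - \<Psi> (y1 r)) (at r)"
    and der2: "\<And>r. s < r \<Longrightarrow> r < t \<Longrightarrow> (y2 has_real_derivative v r - \<Psi> (y2 r)) (at r)"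
    and less: "\<And>r. s \<le> r \<Longrightarrow> r \<le> t \<Longrightarrow> y1 r < y2 r"
    and H: "\<And>r. s < r \<Longrightarrow> r < t \<Longrightarrow>
        2 * d * \<bar>\<Psi> (y2 r) - \<Psi> (y1 r)\<bar> + (V (y2 r) - V (y1 r)) * \<bar>\<Psi> (y2 r) - \<Psi> (y1 r)\<bar>
         \<le> (v r - \<Psi> (y1 r)) * (V (y2 r) - V (y1 r)) + C * (y2 r - y1 r)"
  shows "\<bar>ln (y2 t - y1 t) - ln (y2 s - y1 s)\<bar> \<le> (V (y2 t) - V (y1 s) + C * (t - s)) / (2 * d)"
proof -
  obtain K where K: "\<And>y. (K has_real_derivative V y) (at y)" by (rule V_antiderivative) blast
  have Kcont: "continuous_on A K" for A by (rule DERIV_continuous_on) (rule has_field_derivative_at_within[OF K])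
  define m where "m r = (K (y2 r) - K (y1 r)) / (y2 r - y1 r)" for r
  have m_bounds: "V (y1 r) \<le> m r" "m r \<le> V (y2 r)" if "s \<le> r" "r \<le> t" for r
  proof -
    have "\<exists>z>y1 r. z < y2 r \<and> K (y2 r) - K (y1 r) = (y2 r - y1 r) * V z"
      by (rule MVT2[OF less[OF that]]) (rule K)
    then obtain z where z: "y1 r < z" "z < y2 r" "K (y2 r) - K (y1 r) = (y2 r - y1 r) * V z" by blast
    then have "m r = V z" using less[OF that] by (simp add: m_def)
    then show "V (y1 r) \<le> m r" "m r \<le> V (y2 r)" using z V_mono by auto
  qed
  define q where "q r = (\<Psi> (y2 r) - \<Psi> (y1 r)) / (y2 r - y1 r)" for r
  have lnder: "((\<lambda>r. ln (y2 r - y1 r)) has_real_derivative - q r) (at r)" if r: "s < r" "r < t" for r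
    using r less[of r] by (auto intro!: derivative_eq_intros der1 der2 simp: q_def divide_simps)
  have mder: "\<exists>e. (m has_real_derivative e) (at r) \<and> 2 * d * \<bar>q r\<bar> \<le> e + C" if r: "s < r" "r < t" for r
  proof -
    let ?D = "y2 r - y1 r" and ?dP = "\<Psi> (y2 r) - \<Psi> (y1 r)" and ?dV = "V (y2 r) - V (y1 r)"
    let ?p = "v r - \<Psi> (y1 r)"
    have D: "?D > 0" using less[of r] r by simp
    \<comment> \<open>Inserted into the quotient rule this leaves
      \<open>(?p * ?dV - (V (y2 r) - m r) * ?dP) / ?D\<close>: the first term is a gain, the second
      a product of two differences.\<close>
    have mK: "K (y2 r) - K (y1 r) = m r * ?D" using D by (simp add: m_def)
    let ?e = "(?p * ?dV - (V (y2 r) - m r) * ?dP) / ?D"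
    have "(m has_real_derivative
        ((V (y2 r) * (v r - \<Psi> (y2 r)) - V (y1 r) * (v r - \<Psi> (y1 r))) * ?D
           - (K (y2 r) - K (y1 r)) * ((v r - \<Psi> (y2 r)) - (v r - \<Psi> (y1 r)))) / (?D * ?D)) (at r)"
      unfolding m_def
      using D r by (intro DERIV_divide DERIV_diff DERIV_chain2[OF K] der1 der2) auto
    also have "((V (y2 r) * (v r - \<Psi> (y2 r)) - V (y1 r) * (v r - \<Psi> (y1 r))) * ?D
           - (K (y2 r) - K (y1 r)) * ((v r - \<Psi> (y2 r)) - (v r - \<Psi> (y1 r)))) / (?D * ?D) = ?e"
      unfolding mK using D by (simp add: divide_simps) (simp add: algebra_simps)
    finally have 1: "(m has_real_derivative ?e) (at r)" .
    have "(V (y2 r) - m r) * ?dP \<le> (V (y2 r) - m r) * \<bar>?dP\<bar>"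
      using m_bounds[of r] r by (intro mult_left_mono) auto
    also have "\<dots> \<le> ?dV * \<bar>?dP\<bar>"
      using m_bounds[of r] r by (intro mult_right_mono) auto
    \<comment> \<open>\<open>H\<close> says exactly what makes \<open>m' + C\<close> dominate
      \<open>2 * d * |q|\<close>. It is kept as a hypothesis because it has two sources: in a strip
      it holds with \<open>C = 0\<close>, elsewhere \<open>C\<close> comes from a Lipschitz bound on
      \<open>V\<close>.\<close>
    finally have "2 * d * \<bar>?dP\<bar> \<le> ?p * ?dV - (V (y2 r) - m r) * ?dP + C * ?D"
      using H[OF r] by linarith
    then have "2 * d * \<bar>?dP\<bar> / ?D \<le> (?p * ?dV - (V (y2 r) - m r) * ?dP + C * ?D) / ?D"
      using D by (intro divide_right_mono) auto
    then have "2 * d * \<bar>q r\<bar> \<le> ?e + C"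
      using D by (simp add: q_def add_divide_distrib)
    with 1 show ?thesis by blast
  qed
  have mcont: "continuous_on {s..t} m"
    unfolding m_def using less
    by (intro continuous_intros cont continuous_on_compose2[OF Kcont[of UNIV]]) (auto simp: less_imp_neq dual_order.strict_implies_not_eq)
  have lncont: "continuous_on {s..t} (\<lambda>r. ln (y2 r - y1 r))"
    using less by (intro continuous_intros cont) (auto simp: dual_order.strict_implies_not_eq)
  \<comment> \<open>Since \<open>|q| \<le> (m' + C) / (2 * d)\<close>, the logarithm of the gap
    increases after adding \<open>(m + C * r) / (2 * d)\<close> and decreases after subtracting it.
    The two monotonicities bound its change from both sides.\<close>
  have "ln (y2 s - y1 s) + (m s + C * s) / (2 * d) \<le> ln (y2 t - y1 t) + (m t + C * t) / (2 * d)"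
  proof (rule DERIV_nonneg_imp_increasing_open[OF st])
    fix r assume r: "s < r" "r < t"
    obtain e where e: "(m has_real_derivative e) (at r)" "2 * d * \<bar>q r\<bar> \<le> e + C" using mder[OF r] by blast
    have "((\<lambda>r. ln (y2 r - y1 r) + (m r + C * r) / (2 * d)) has_real_derivative - q r + (e + C) / (2 * d)) (at r)"
      by (intro  DERIV_add DERIV_cdivide DERIV_cmult_Id lnder[OF r] e(1))
    moreover have "0 \<le> - q r + (e + C) / (2 * d)"
    proof -
      have "\<bar>q r\<bar> \<le> (e + C) / (2 * d)" using e(2) d by (simp add: pos_le_divide_eq algebra_simps)
      then show ?thesis by linarith
    qed
    ultimately show "\<exists>y. ((\<lambda>r. ln (y2 r - y1 r) + (m r + C * r) / (2 * d)) has_real_derivative y) (at r) \<and> 0 \<le> y"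
      by blast
  qed (intro continuous_intros mcont lncont, use d in auto)
  moreover have "ln (y2 t - y1 t) - (m t + C * t) / (2 * d) \<le> ln (y2 s - y1 s) - (m s + C * s) / (2 * d)"
  proof (rule DERIV_nonpos_imp_decreasing_open[OF st])
    fix r assume r: "s < r" "r < t"
    obtain e where e: "(m has_real_derivative e) (at r)" "2 * d * \<bar>q r\<bar> \<le> e + C" using mder[OF r] by blast
    have "((\<lambda>r. ln (y2 r - y1 r) - (m r + C * r) / (2 * d)) has_real_derivative - q r - (e + C) / (2 * d)) (at r)"
      by (intro DERIV_diff DERIV_add DERIV_cdivide DERIV_cmult_Id lnder[OF r] e(1))
    moreover have "- q r - (e + C) / (2 * d) \<le> 0"
    proof -
      have "\<bar>q r\<bar> \<le> (e + C) / (2 * d)" using e(2) d by (simp add: pos_le_divide_eq algebra_simps)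
      then show ?thesis by linarith
    qed
    ultimately show "\<exists>y. ((\<lambda>r. ln (y2 r - y1 r) - (m r + C * r) / (2 * d)) has_real_derivative y) (at r) \<and> y \<le> 0"
      by blast
  qed (intro continuous_intros mcont lncont, use d in auto)
  moreover have "(m t + C * t) / (2 * d) - (m s + C * s) / (2 * d) \<le> (V (y2 t) - V (y1 s) + C * (t - s)) / (2 * d)"
    using m_bounds[of s] m_bounds[of t] st d
    by (simp add: diff_divide_distrib[symmetric]) (intro divide_right_mono, auto simp: algebra_simps)
  ultimately show ?thesis by linarith
qed

end

lemma continuous_on_UNIV_if_agrees:
  fixes g :: "real \<Rightarrow> 'a::topological_space"
  assumes "\<And>N. \<exists>g'. continuous_on UNIV g' \<and> (\<forall>t\<le>N. g t = g' t)"
  shows "continuous_on UNIV g"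
proof -
  have "continuous_on {..<N} g" for N
  proof -
    obtain g' where "continuous_on UNIV g'" "\<forall>t\<le>N. g t = g' t" using assms by blast
    then show ?thesis
      by (subst continuous_on_cong[OF refl, of _ _ g']) (auto elim: continuous_on_subset)
  qed
  then have "continuous_on (\<Union>N. {..<N}) g"
    by (intro continuous_on_open_UN) auto
  moreover have "(\<Union>N. {..<N}) = (UNIV :: real set)" by (auto intro: gt_ex)
  ultimately show ?thesis by simp
qed

lemma continuous_on_integral_upper:
  fixes f :: "real \<Rightarrow> real"
  assumes "continuous_on UNIV f"
  shows "continuous_on UNIV (\<lambda>t. integral {0..t} f)"
proof (rule continuous_on_UNIV_if_agrees)
  fix N :: real
  have c: "continuous_on {0..max N 0} (\<lambda>t. integral {0..t} f)"
    by (intro indefinite_integral_continuous_1 integrable_continuous_interval continuous_on_subset[OF assms]) auto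
  have "continuous_on UNIV (\<lambda>t. integral {0..max 0 (min t N)} f)"
    by (rule continuous_on_compose2[OF c]) (auto intro!: continuous_intros)
  moreover have "integral {0..t} f = integral {0..max 0 (min t N)} f" if "t \<le> N" for t
    using that by (cases "0 \<le> t") (auto simp: max_def min_def)
  ultimately show "\<exists>g'. continuous_on UNIV g' \<and> (\<forall>t\<le>N. integral {0..t} f = g' t)" by blast
qed

lemma tendsto_by_subsequences:
  fixes f :: "nat \<Rightarrow> 'a::metric_space"
  assumes "\<And>r :: nat \<Rightarrow> nat. strict_mono r \<Longrightarrow> \<exists>s :: nat \<Rightarrow> nat. strict_mono s \<and> (\<lambda>k. f (r (s k))) \<longlonglongrightarrow> l"
  shows "f \<longlonglongrightarrow> l"
proof (rule ccontr)
  assume "\<not> f \<longlonglongrightarrow> l"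
  then obtain e where e: "e > 0" "\<not> eventually (\<lambda>k. dist (f k) l < e) sequentially"
    by (auto simp: tendsto_iff)
  then have "\<exists>k\<ge>n. e \<le> dist (f k) l" for n
    by (auto simp: eventually_sequentially not_less)
  then have "infinite {k. e \<le> dist (f k) l}"
    unfolding infinite_nat_iff_unbounded_le by auto
  then obtain r :: "nat \<Rightarrow> nat" where r: "strict_mono r" "\<And>k. r k \<in> {k. e \<le> dist (f k) l}"
    using infinite_enumerate by blast
  from assms[OF r(1)] obtain s :: "nat \<Rightarrow> nat" where "(\<lambda>k. f (r (s k))) \<longlonglongrightarrow> l" by blast
  from tendstoD[OF this e(1)] have "\<forall>\<^sub>F k in sequentially. dist (f (r (s k))) l < e" .
  then obtain k where "dist (f (r (s k))) l < e" using eventually_happens by fastforce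
  with r(2)[of "s k"] show False by simp
qed

section \<open>Pairs of characteristics: gap bounds, order and uniqueness\<close>

context drift
begin

text \<open>Here \<open>C = 0\<close>. Of the gain \<open>3 * d * ?dV \<ge> 3 * d * ?dP\<close> one
  third absorbs the product \<open>?dV * ?dP \<le> d * ?dP\<close>, and \<open>2 * d * ?dP\<close>
  is left. The bound is independent of the elapsed time and vanishes with
  \<open>V (y2 t)\<close>.\<close>

lemma strip_gap:
  assumes "strip v d eta" "sol v z1 T y1" "sol v z2 T y2" "0 \<le> s" "s \<le> t" "t \<le> T"
    and less: "\<And>r. s \<le> r \<Longrightarrow> r \<le> t \<Longrightarrow> y1 r < y2 r"
    and in_strip: "\<And>r. s \<le> r \<Longrightarrow> r \<le> t \<Longrightarrow> y2 r \<le> eta"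
  shows "\<bar>ln (y2 t - y1 t) - ln (y2 s - y1 s)\<bar> \<le> (V (y2 t) - V (y1 s)) / (2 * d)"
proof -
  have d: "0 < d" "V eta \<le> d" using assms(1) by (auto simp: strip_def)
  have "\<bar>ln (y2 t - y1 t) - ln (y2 s - y1 s)\<bar> \<le> (V (y2 t) - V (y1 s) + 0 * (t - s)) / (2 * d)"
  proof (rule log_gap[where v = v])
    fix r assume r: "s < r" "r < t"
    let ?dP = "\<bar>\<Psi> (y2 r) - \<Psi> (y1 r)\<bar>" and ?dV = "V (y2 r) - V (y1 r)"
    have 1: "?dP \<le> ?dV" using less[of r] r by (intro Psi_V_diff) auto
    have 2: "?dV \<le> d" using V_mono[of "y2 r" eta] in_strip[of r] r V_nonneg[of "y1 r"] d by auto
    have "3 * d \<le> v r - \<Psi> (y1 r)"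
      using less[of r] in_strip[of r] r by (intro strip_drift[OF assms(1)]) auto
    then have "3 * d * ?dV \<le> (v r - \<Psi> (y1 r)) * ?dV" using 1 by (intro mult_right_mono) auto
    moreover have "?dV * ?dP \<le> d * ?dP" using 2 by (intro mult_right_mono) auto
    moreover have "3 * d * ?dP \<le> 3 * d * ?dV" using 1 d by (intro mult_left_mono) auto
    ultimately show "2 * d * ?dP + ?dV * ?dP \<le> (v r - \<Psi> (y1 r)) * ?dV + 0 * (y2 r - y1 r)"
      by (simp add: algebra_simps)
  qed (use assms d in \<open>auto simp: sol_def elim: continuous_on_subset\<close>)
  then show ?thesis by simp
qed

text \<open>\<open>V\<close> need not be Lipschitz at 0, but it is for pairs whose upper point is
  above \<open>eta\<close>: if the lower point is below \<open>eta / 2\<close>, the gap exceeds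
  \<open>eta / 2\<close>, and all of \<open>V R\<close> is at most a multiple of it.\<close>

lemma V_lipschitz_far:
  assumes "0 < eta"
  obtains \<Lambda> where "0 \<le> \<Lambda>"
    "\<And>x y. x < y \<Longrightarrow> - R \<le> x \<Longrightarrow> y \<le> R \<Longrightarrow> eta \<le> y \<Longrightarrow> V y - V x \<le> \<Lambda> * (y - x)"
proof -
  have "compact ((\<lambda>y. \<bar>\<Psi>' y\<bar>) ` {eta/2..R})"
    using assms by (intro compact_continuous_image continuous_intros continuous_on_subset[OF Psi'_cont]) auto
  then obtain M where M: "\<And>y. eta/2 \<le> y \<Longrightarrow> y \<le> R \<Longrightarrow> \<bar>\<Psi>' y\<bar> \<le> M"
    by (force dest!: compact_imp_bounded simp: bounded_iff)
  let ?L = "max \<bar>M\<bar> (V R * (2 / eta))"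
  have "V y - V x \<le> ?L * (y - x)" if xy: "x < y" "- R \<le> x" "y \<le> R" "eta \<le> y" for x y
  proof (cases "eta/2 \<le> x")
    case True
    have "\<exists>z>x. z < y \<and> V y - V x = (y - x) * \<bar>\<Psi>' z\<bar>"
      using True assms xy by (intro MVT2 V_deriv) auto
    then obtain z where z: "x < z" "z < y" "V y - V x = (y - x) * \<bar>\<Psi>' z\<bar>" by blast
    have "\<bar>\<Psi>' z\<bar> \<le> ?L" using M[of z] z True xy by auto
    then show ?thesis using z(3) xy by (simp add: mult.commute mult_left_mono)
  next
    case False
    have "V y - V x \<le> V R * 1" using V_mono[of y R] V_nonneg[of x] xy by auto
    also have "\<dots> \<le> V R * (2 / eta * (y - x))"
      using False xy assms by (intro mult_left_mono V_nonneg) (auto simp: field_simps)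
    also have "\<dots> = V R * (2 / eta) * (y - x)" by simp
    also have "\<dots> \<le> ?L * (y - x)" using xy by (intro mult_right_mono) auto
    finally show ?thesis .
  qed
  with that[of ?L] show thesis by (auto simp: le_max_iff_disj)
qed

lemma gap_bound:
  assumes "strip v d eta" "0 \<le> T"
  obtains B where "0 \<le> B"
    "\<And>z1 z2 y1 y2 s t. sol v z1 T y1 \<Longrightarrow> sol v z2 T y2 \<Longrightarrow> 0 \<le> s \<Longrightarrow> s \<le> t \<Longrightarrow> t \<le> T \<Longrightarrow>
      (\<And>r. s \<le> r \<Longrightarrow> r \<le> t \<Longrightarrow> y1 r < y2 r) \<Longrightarrow>
      (\<And>r. s \<le> r \<Longrightarrow> r \<le> t \<Longrightarrow> - R \<le> y1 r \<and> y2 r \<le> R) \<Longrightarrow>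
      \<bar>ln (y2 t - y1 t) - ln (y2 s - y1 s)\<bar> \<le> B"
proof -
  have d: "0 < d" "0 < eta" "V eta \<le> d" and v: "\<And>r. p0 + 4 * d \<le> v r" "\<And>r. v r \<le> rho"
    using assms(1) by (auto simp: strip_def)
  obtain \<Lambda> where L: "0 \<le> \<Lambda>"
    "\<And>x y. x < y \<Longrightarrow> - R \<le> x \<Longrightarrow> y \<le> R \<Longrightarrow> eta \<le> y \<Longrightarrow> V y - V x \<le> \<Lambda> * (y - x)"
    using V_lipschitz_far[OF d(2)] by blast
  \<comment> \<open>\<open>S\<close> bounds the speed. Outside the strip the speed may have the
    wrong sign, so each of the three terms in the hypothesis of \<open>log_gap\<close> is estimated
    by a multiple of the variation difference, hence of the gap; the sum of the factors times
    \<open>\<Lambda>\<close> is \<open>C\<close>.\<close>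
  define S where "S = rho + p0 + V R"
  define C where "C = (2 * d + V R + S) * \<Lambda>"
  have rho: "0 \<le> rho" using v[of 0] p0_nonneg d by linarith
  have "0 \<le> S" using rho p0_nonneg V_nonneg[of R] by (simp add: S_def)
  then have C: "0 \<le> C" using L(1) d V_nonneg[of R] by (simp add: C_def)
  have bound: "\<bar>ln (y2 t - y1 t) - ln (y2 s - y1 s)\<bar> \<le> (V R + C * T) / (2 * d)"
    if sols: "sol v z1 T y1" "sol v z2 T y2" and st: "0 \<le> s" "s \<le> t" "t \<le> T"
      and less: "\<And>r. s \<le> r \<Longrightarrow> r \<le> t \<Longrightarrow> y1 r < y2 r"
      and bd: "\<And>r. s \<le> r \<Longrightarrow> r \<le> t \<Longrightarrow> - R \<le> y1 r \<and> y2 r \<le> R" for z1 z2 y1 y2 s t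
  proof -
    have "\<bar>ln (y2 t - y1 t) - ln (y2 s - y1 s)\<bar> \<le> (V (y2 t) - V (y1 s) + C * (t - s)) / (2 * d)"
    proof (rule log_gap[where v = v])
      fix r assume r: "s < r" "r < t"
      let ?dP = "\<bar>\<Psi> (y2 r) - \<Psi> (y1 r)\<bar>" and ?dV = "V (y2 r) - V (y1 r)" and ?D = "y2 r - y1 r"
      have lt: "y1 r < y2 r" and R: "- R \<le> y1 r" "y2 r \<le> R" using less[of r] bd[of r] r by auto
      have 1: "?dP \<le> ?dV" using lt by (intro Psi_V_diff) auto
      show "2 * d * ?dP + ?dV * ?dP \<le> (v r - \<Psi> (y1 r)) * ?dV + C * ?D"
      proof (cases "y2 r \<le> eta")
        case True
        have 2: "?dV \<le> d" using V_mono[OF True] V_nonneg[of "y1 r"] d by auto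
        have "3 * d \<le> v r - \<Psi> (y1 r)"
          using lt True by (intro strip_drift[OF assms(1)]) auto
        then have "3 * d * ?dV \<le> (v r - \<Psi> (y1 r)) * ?dV" using 1 by (intro mult_right_mono) auto
        moreover have "?dV * ?dP \<le> d * ?dP" using 2 by (intro mult_right_mono) auto
        moreover have "3 * d * ?dP \<le> 3 * d * ?dV" using 1 d by (intro mult_left_mono) auto
        moreover have "0 \<le> C * ?D" using C lt by simp
        ultimately show ?thesis by (simp add: algebra_simps)
      next
        case False
        have 2: "?dV \<le> \<Lambda> * ?D" using lt R False by (intro L) auto
        have "\<Psi> (y1 r) \<le> p0 + V R" using Psi_upper[of "y1 r"] V_mono[of "y1 r" R] lt R by simp
        then have 3: "\<bar>v r - \<Psi> (y1 r)\<bar> \<le> S"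
          using v[of r] Psi_nonneg[of "y1 r"] p0_nonneg d V_nonneg[of R] by (simp add: S_def abs_le_iff)
        have 4: "?dV \<le> V R" using V_mono[of "y2 r" R] V_nonneg[of "y1 r"] R by auto
        have "2 * d * ?dP \<le> 2 * d * ?dV" using 1 d by (intro mult_left_mono) auto
        moreover have "?dV * ?dP \<le> V R * ?dV" using 1 4 by (intro mult_mono V_nonneg) auto
        moreover have "- (v r - \<Psi> (y1 r)) * ?dV \<le> S * ?dV" using 1 3 by (intro mult_right_mono) auto
        moreover have "(2 * d + V R + S) * ?dV \<le> (2 * d + V R + S) * (\<Lambda> * ?D)"
          using 2 d V_nonneg[of R] \<open>0 \<le> S\<close> by (intro mult_left_mono) auto
        ultimately show ?thesis by (simp add: C_def algebra_simps)
      qed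
    qed (use sols st d less in \<open>auto simp: sol_def elim: continuous_on_subset\<close>)
    also have "\<dots> \<le> (V R + C * T) / (2 * d)"
    proof -
      have "V (y2 t) \<le> V R" using bd[of t] st by (intro V_mono) auto
      moreover have "C * (t - s) \<le> C * T" using C st by (intro mult_left_mono) auto
      ultimately show ?thesis using V_nonneg[of "y1 s"] d by (intro divide_right_mono) auto
    qed
    finally show ?thesis .
  qed
  have "0 \<le> (V R + C * T) / (2 * d)" using V_nonneg[of R] C d assms by auto
  then show thesis using bound by (rule that)
qed

lemma sol_pair_bounded:
  assumes "sol v z1 T y1" "sol v z2 T y2"
  obtains R where "\<And>r. 0 \<le> r \<Longrightarrow> r \<le> T \<Longrightarrow> - R \<le> y1 r \<and> y2 r \<le> R"
proof -
  have "bounded (y1 ` {0..T})" "bounded (y2 ` {0..T})"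
    using assms by (auto simp: sol_def intro!: compact_imp_bounded compact_continuous_image)
  then obtain R1 R2 where "\<forall>r\<in>{0..T}. \<bar>y1 r\<bar> \<le> R1" "\<forall>r\<in>{0..T}. \<bar>y2 r\<bar> \<le> R2"
    by (auto simp: bounded_iff)
  then show thesis by (intro that[of "max R1 R2"]) (force simp: abs_le_iff)
qed

text \<open>Forwards this is monotonicity in the initial value, backwards it is uniqueness: the gap would
  have to pass through a level which \<open>gap_bound\<close> forbids.\<close>
lemma gap_persists:
  assumes v: "adm v" and sols: "sol v z1 T y1" "sol v z2 T y2"
    and s: "s \<in> {0..T}" and t: "t \<in> {0..T}" and pos: "y1 s < y2 s"
  shows "y1 t < y2 t"
proof (rule ccontr)
  assume neg: "\<not> y1 t < y2 t"
  obtain d eta where st: "strip v d eta" using strip_exists[OF v zero_less_one] by blast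
  obtain R where R: "\<And>r. 0 \<le> r \<Longrightarrow> r \<le> T \<Longrightarrow> - R \<le> y1 r \<and> y2 r \<le> R"
    using sol_pair_bounded[OF sols] by blast
  let ?D = "\<lambda>r. y2 r - y1 r" and ?I = "closed_segment s t"
  have "0 \<le> T" using t by simp
  from gap_bound[OF st this, of R] obtain B where B: "0 \<le> B"
    "\<And>s t. 0 \<le> s \<Longrightarrow> s \<le> t \<Longrightarrow> t \<le> T \<Longrightarrow> (\<And>r. s \<le> r \<Longrightarrow> r \<le> t \<Longrightarrow> y1 r < y2 r) \<Longrightarrow>
      (\<And>r. s \<le> r \<Longrightarrow> r \<le> t \<Longrightarrow> - R \<le> y1 r \<and> y2 r \<le> R) \<Longrightarrow> \<bar>ln (?D t) - ln (?D s)\<bar> \<le> B"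
    using sols by metis
  have I: "?I \<subseteq> {0..T}" using s t by (simp add: closed_segment_subset)
  have cont: "continuous_on {0..T} ?D" using sols by (auto simp: sol_def intro!: continuous_intros)
  \<comment> \<open>Half of the smallest gap that \<open>gap_bound\<close> permits as long as the
    order persists.\<close>
  define c where "c = ?D s * exp (- B) / 2"
  have Ds: "0 < ?D s" using pos by simp
  have c: "0 < c" "c < ?D s * exp (- B)" using Ds by (auto simp: c_def)
  have "?D s * exp (- B) \<le> ?D s" using B(1) Ds by (simp add: mult_left_le)
  then have cs: "c < ?D s" using c by linarith
  have hits: "\<exists>q\<in>closed_segment s r. ?D q = c" if r: "r \<in> ?I" "?D r \<le> c" for r
  proof -
    have "closed_segment s r \<subseteq> ?I" using r(1) by (simp add: closed_segment_subset)
    then have "connected (?D ` closed_segment s r)"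
      using I by (intro connected_continuous_image continuous_on_subset[OF cont]) auto
    then have "c \<in> ?D ` closed_segment s r"
      by (rule connectedD_interval[where x = "?D r" and y = "?D s"]) (use r cs in auto)
    then show ?thesis by auto
  qed
  \<comment> \<open>\<open>q\<close> is the time nearest to \<open>s\<close> at which the gap equals
    \<open>c\<close>. Between \<open>s\<close> and \<open>q\<close> the gap stays positive, as a
    loss of sign would force a nearer such time; so \<open>gap_bound\<close> applies there and
    excludes the value \<open>c\<close>. Segments treat both directions of time together.\<close>
  define S where "S = {r \<in> ?I. ?D r = c}"
  have "closed S" unfolding S_def
    by (intro continuous_closed_preimage_constant continuous_on_subset[OF cont I]) auto
  moreover have "S \<noteq> {}" using hits[of t] neg c by (auto simp: S_def)
  ultimately obtain q where q: "q \<in> S" and near: "\<And>r. r \<in> S \<Longrightarrow> dist s q \<le> dist s r"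
    using distance_attains_inf[of S s] by blast
  have "q \<noteq> s" using q cs by (auto simp: S_def)
  have between: "y1 r < y2 r" if r: "r \<in> closed_segment s q" for r
  proof (rule ccontr)
    assume "\<not> y1 r < y2 r"
    moreover have sub: "closed_segment s q \<subseteq> ?I" using q by (simp add: S_def closed_segment_subset)
    ultimately obtain p where p: "p \<in> closed_segment s r" "?D p = c" using hits[of r] r c by auto
    have "closed_segment s r \<subseteq> closed_segment s q" using r by (simp add: closed_segment_subset)
    then have "p \<in> S" using p sub by (auto simp: S_def)
    have "p \<noteq> r" using p c \<open>\<not> y1 r < y2 r\<close> by auto
    then have "dist s p < dist s q" using p(1) r
      by (auto simp: closed_segment_eq_real_ivl dist_real_def split: if_splits)
    with near[OF \<open>p \<in> S\<close>] show False by simp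
  qed
  have qI: "q \<in> {0..T}" "?D q = c" using q I by (auto simp: S_def)
  have "\<bar>ln (?D s) - ln (?D q)\<bar> \<le> B"
  proof (cases "s \<le> q")
    case True
    then have "\<bar>ln (?D q) - ln (?D s)\<bar> \<le> B"
      using s qI between by (intro B(2) R) (auto simp: closed_segment_eq_real_ivl)
    then show ?thesis by (simp only: abs_minus_commute)
  next
    case False
    then show ?thesis
      using s qI between by (intro B(2) R) (auto simp: closed_segment_eq_real_ivl)
  qed
  then have "ln (?D s * exp (- B)) \<le> ln c" using Ds qI(2) by (simp add: ln_mult)
  moreover have "0 < ?D s * exp (- B)" using Ds by simp
  ultimately show False using c by (simp only: ln_le_cancel_iff)
qed

lemma sol_order:
  assumes "adm v" "sol v z1 T y1" "sol v z2 T y2" "z1 < z2" "0 \<le> t" "t \<le> T"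
  shows "y1 t < y2 t"
  using gap_persists[OF assms(1-3), of 0 t] assms by (simp add: sol_def)

lemma sol_unique:
  assumes v: "adm v" and sols: "sol v z T y1" "sol v z T y2" and t: "0 \<le> t" "t \<le> T"
  shows "y1 t = y2 t"
  using gap_persists[OF v sols, of t 0] gap_persists[OF v sols(2,1), of t 0] sols t
  by (cases "y1 t" "y2 t" rule: linorder_cases) (auto simp: sol_def)

lemma sol_rate:
  assumes "adm v" "sol v z T y" "\<And>r. 0 \<le> r \<Longrightarrow> r \<le> T \<Longrightarrow> y r \<le> M"
    and "0 \<le> s" "s \<le> T" "0 \<le> t" "t \<le> T"
  shows "\<bar>y t - y s\<bar> \<le> (rho + p0 + V M) * \<bar>t - s\<bar>"
proof -
  have ordered: "\<bar>y t - y s\<bar> \<le> (rho + p0 + V M) * (t - s)" if st: "0 \<le> s" "s \<le> t" "t \<le> T" for s t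
  proof -
    have "y s + (p0 + V M) * s \<le> y t + (p0 + V M) * t"
    proof (rule DERIV_nonneg_imp_increasing_open[OF st(2)])
      fix x assume x: "s < x" "x < t"
      then have "\<Psi> (y x) \<le> p0 + V M"
        using Psi_upper[of "y x"] V_mono[OF assms(3), of x] st by auto
      then show "\<exists>e. ((\<lambda>r. y r + (p0 + V M) * r) has_real_derivative e) (at x) \<and> 0 \<le> e"
        using x st assms(2) admD(2)[OF assms(1), of x] p0_nonneg
        by (intro exI[of _ "v x - \<Psi> (y x) + (p0 + V M)"])
           (auto simp: sol_def intro!: derivative_eq_intros)
    next
      show "continuous_on {s..t} (\<lambda>r. y r + (p0 + V M) * r)"
        using assms(2) st by (intro continuous_intros) (auto simp: sol_def intro: continuous_on_subset)
    qed
    then have lo: "y s - y t \<le> (p0 + V M) * (t - s)" by (simp add: algebra_simps)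
    have hi: "y t - y s \<le> rho * (t - s)" using sol_upper[OF assms(1,2) st] by simp
    have nn: "0 \<le> rho * (t - s)" "0 \<le> (p0 + V M) * (t - s)"
      using st p0_nonneg V_nonneg[of M] admD(4)[OF assms(1)] by auto
    show ?thesis using lo hi nn by (simp add: distrib_right)
  qed
  show ?thesis
  proof (cases "s \<le> t")
    case True then show ?thesis using ordered[of s t] assms by simp
  next
    case False then show ?thesis using ordered[of t s] assms by (simp add: abs_minus_commute)
  qed
qed

section \<open>Existence of characteristics, the flow and its stability\<close>

lemma sol_integral:
  assumes "continuous_on UNIV v" "sol v z T y" "0 \<le> t" "t \<le> T"
  shows "y t = z + integral {0..t} (\<lambda>r. v r - \<Psi> (y r))"
proof -
  have "((\<lambda>r. v r - \<Psi> (y r)) has_integral y t - y 0) {0..t}"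
    using assms
    by (intro fundamental_theorem_of_calculus_interior)
       (auto simp: sol_def has_real_derivative_iff_has_vector_derivative[symmetric] elim: continuous_on_subset)
  then show ?thesis using assms by (simp add: integral_unique sol_def)
qed

text \<open>Limits in the compactness arguments are known only pointwise. The integral equation
  survives dominated convergence, and it returns first the continuity of \<open>y\<close> and then
  its derivative.\<close>

lemma sol_of_integral:
  assumes v: "continuous_on UNIV v"
    and int: "(\<lambda>r. v r - \<Psi> (y r)) integrable_on {0..T}"
    and eq: "\<And>t. 0 \<le> t \<Longrightarrow> t \<le> T \<Longrightarrow> y t = z + integral {0..t} (\<lambda>r. v r - \<Psi> (y r))"
    and T: "0 \<le> T"
  shows "sol v z T y"
proof -
  have "continuous_on {0..T} (\<lambda>t. z + integral {0..t} (\<lambda>r. v r - \<Psi> (y r)))"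
    by (intro continuous_intros indefinite_integral_continuous_1 int)
  then have cy: "continuous_on {0..T} y"
    using eq by (subst continuous_on_cong[OF refl]) auto
  have cF: "continuous_on {0..T} (\<lambda>r. v r - \<Psi> (y r))"
    by (intro continuous_intros continuous_on_subset[OF v] continuous_on_compose2[OF Psi_cont cy]) auto
  have "(y has_real_derivative v t - \<Psi> (y t)) (at t)" if t: "0 < t" "t < T" for t
  proof -
    have "((\<lambda>u. integral {0..u} (\<lambda>r. v r - \<Psi> (y r))) has_real_derivative v t - \<Psi> (y t)) (at t within {0..T})"
      using t by (intro integral_has_real_derivative[OF cF]) auto
    moreover have "at t within {0..T} = at t" using t by (intro at_within_interior) auto
    ultimately have "((\<lambda>u. z + integral {0..u} (\<lambda>r. v r - \<Psi> (y r))) has_real_derivative v t - \<Psi> (y t)) (at t)"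
      by (auto intro!: derivative_eq_intros)
    moreover have "\<forall>\<^sub>F u in nhds t. z + integral {0..u} (\<lambda>r. v r - \<Psi> (y r)) = y u"
    proof -
      have "\<forall>\<^sub>F u in nhds t. u \<in> {0<..<T}" using t by (intro eventually_nhds_in_open) auto
      then show ?thesis by eventually_elim (use eq in auto)
    qed
    ultimately show ?thesis by (simp add: DERIV_cong_ev)
  qed
  then show ?thesis using cy eq[of 0] T by (auto simp: sol_def)
qed

text \<open>A Peano argument: with \<open>\<Psi>\<close> evaluated at the delayed point the equation
  is solved by steps, and the delays \<open>1 / (k + 1)\<close> tend to 0 along a convergent
  subsequence. The solution is global because \<open>\<Psi> \<ge> 0\<close> caps it from above,
  which caps \<open>\<Psi>\<close> along it and thereby the speed downwards.\<close>

lemma sol_exists: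
  assumes v: "adm v"
  shows "\<exists>y. \<forall>T. 0 \<le> T \<longrightarrow> sol v z T y"
proof -
  have vc: "continuous_on UNIV v" using admD(1)[OF v] .
  have rho: "0 < rho" using admD(4)[OF v] p0_nonneg by linarith
  define M where "M N = p0 + V (\<bar>z\<bar> + rho * max N 0)" for N
  have M: "0 \<le> M N" for N using p0_nonneg V_nonneg by (simp add: M_def)
  define P where "P g \<longleftrightarrow> continuous_on UNIV g \<and> (\<forall>t. g t \<le> z + rho * max t 0)" for g :: "real \<Rightarrow> real"
  define \<Delta> where "\<Delta> h g t = z + integral {0..t} (\<lambda>r. v r - \<Psi> (g (r - h)))" for h g and t :: real
  have cF: "continuous_on UNIV (\<lambda>r. v r - \<Psi> (g (r - h)))" if "continuous_on UNIV g" for g h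
    by (intro continuous_intros vc continuous_on_compose2[OF Psi_cont] continuous_on_compose2[OF that]) auto
  have iF: "(\<lambda>r. v r - \<Psi> (g (r - h))) integrable_on {s..t}" if "continuous_on UNIV g" for g h s t
    by (intro integrable_continuous_interval continuous_on_subset[OF cF[OF that]]) auto
  have "\<exists>g. P g \<and> (\<forall>t\<le>0. g t = z) \<and> (\<forall>t\<ge>0. g t = \<Delta> h g t)" if h: "0 < h" for h
  proof -
    have P0: "P (\<lambda>_. z)" using rho by (auto simp: P_def)
    have Pstep: "P (\<lambda>t. if t < 0 then z else \<Delta> h g t)" if g: "P g" for g
    proof -
      have gc: "continuous_on UNIV g" using g by (simp add: P_def)
      \<comment> \<open>For \<open>t < 0\<close> the integral runs over an empty interval and
        \<open>\<Delta> h g t\<close> is \<open>z\<close> anyway, so no continuity is lost at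
        0.\<close>
      have eq: "(\<lambda>t. if t < 0 then z else \<Delta> h g t) = \<Delta> h g" by (auto simp: \<Delta>_def)
      have "\<Delta> h g t \<le> z + rho * max t 0" for t
      proof (cases "0 \<le> t")
        case True
        have "integral {0..t} (\<lambda>r. v r - \<Psi> (g (r - h))) \<le> integral {0..t} (\<lambda>_. rho)"
          using admD(3)[OF v] Psi_nonneg by (intro integral_le iF gc) (auto simp: diff_le_eq add_increasing2)
        with True show ?thesis by (simp add: \<Delta>_def max_def mult.commute)
      qed (simp add: \<Delta>_def)
      moreover have "continuous_on UNIV (\<Delta> h g)"
        unfolding \<Delta>_def by (intro continuous_intros continuous_on_integral_upper cF gc)
      ultimately show ?thesis unfolding eq by (simp add: P_def)
    qed
    have causal: "\<Delta> h g t = \<Delta> h g' t" if "P g" "P g'" "\<And>r. r \<le> t - h \<Longrightarrow> g r = g' r" for g g' t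
      unfolding \<Delta>_def using that by (intro arg_cong2[where f = "(+)"] integral_cong) auto
    have Ploc: "P g" if loc: "\<And>N. \<exists>g'. P g' \<and> (\<forall>t\<le>N. g t = g' t)" for g
    proof -
      have "continuous_on UNIV g"
        using loc unfolding P_def by (intro continuous_on_UNIV_if_agrees) blast
      moreover have "g t \<le> z + rho * max t 0" for t using loc[of t] by (auto simp: P_def)
      ultimately show ?thesis by (simp add: P_def)
    qed
    obtain g where g: "P g" "\<And>t. t < 0 \<Longrightarrow> g t = z" "\<And>t. 0 \<le> t \<Longrightarrow> g t = \<Delta> h g t"
      using delay_fixpoint[where P = P and \<Delta> = "\<Delta> h" and c = z, OF h causal P0 Pstep Ploc] by blast
    have "g 0 = z" using g(3)[of 0] by (simp add: \<Delta>_def)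
    then have "\<forall>t\<le>0. g t = z" using g(2) by (auto simp: less_eq_real_def)
    with g show ?thesis by blast
  qed
  then have "\<forall>k :: nat. \<exists>g. P g \<and> (\<forall>t\<le>0. g t = z) \<and> (\<forall>t\<ge>0. g t = \<Delta> (1 / (real k + 1)) g t)"
    by simp
  from choice[OF this] obtain g :: "nat \<Rightarrow> real \<Rightarrow> real" where g: "\<And>k. P (g k)" "\<And>k t. t \<le> 0 \<Longrightarrow> g k t = z"
    "\<And>k t. 0 \<le> t \<Longrightarrow> g k t = \<Delta> (1 / (real k + 1)) (g k) t" by blast
  let ?h = "\<lambda>k :: nat. 1 / (real k + 1)"
  have gc: "continuous_on UNIV (g k)" for k using g(1) by (simp add: P_def)
  have gup: "g k t \<le> \<bar>z\<bar> + rho * max N 0" if "t \<le> N" for k t N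
  proof -
    have "g k t \<le> z + rho * max t 0" using g(1) by (simp add: P_def)
    also have "\<dots> \<le> \<bar>z\<bar> + rho * max N 0" using that rho by (intro add_mono mult_left_mono) auto
    finally show ?thesis .
  qed
  have Fbd: "\<bar>v r - \<Psi> (g k (r - ?h k))\<bar> \<le> rho + M N" if "r \<le> N" for r k N
  proof -
    have "0 \<le> ?h k" by simp
    then have "r - ?h k \<le> N" using that by linarith
    then have "g k (r - ?h k) \<le> \<bar>z\<bar> + rho * max N 0" by (rule gup)
    then have "\<Psi> (g k (r - ?h k)) \<le> M N"
      using Psi_upper[of "g k (r - ?h k)"] V_mono[of "g k (r - ?h k)"] unfolding M_def by fastforce
    then show ?thesis
      using admD(2,3)[OF v, of r] p0_nonneg Psi_nonneg[of "g k (r - ?h k)"] rho M[of N] by (simp add: abs_le_iff)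
  qed
  have lip: "\<bar>g k s - g k t\<bar> \<le> (rho + M N) * \<bar>s - t\<bar>" if "s \<in> {0..N}" "t \<in> {0..N}" for k s t N
  proof -
    have ord: "\<bar>g k t - g k s\<bar> \<le> (rho + M N) * (t - s)" if "0 \<le> s" "s \<le> t" "t \<le> N" for s t
    proof -
      let ?F = "\<lambda>r. v r - \<Psi> (g k (r - ?h k))"
      have "integral {0..s} ?F + integral {s..t} ?F = integral {0..t} ?F"
        using that by (intro Henstock_Kurzweil_Integration.integral_combine iF gc) auto
      then have "g k t - g k s = integral {s..t} ?F"
        using that g(3)[of t k] g(3)[of s k] by (simp add: \<Delta>_def)
      moreover have "norm (integral {s..t} ?F) \<le> (rho + M N) * (t - s)"
        using that Fbd by (intro integral_bound continuous_on_subset[OF cF[OF gc]]) auto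
      ultimately show ?thesis by simp
    qed
    show ?thesis
    proof (cases "s \<le> t")
      case True then show ?thesis using ord[of s t] that by (simp add: abs_minus_commute)
    next
      case False then show ?thesis using ord[of t s] that by simp
    qed
  qed
  have "\<bar>g k t\<bar> \<le> \<bar>z\<bar> + (rho + M t) * t" if "0 \<le> t" for k t
  proof -
    have "\<bar>g k t - z\<bar> \<le> (rho + M t) * t" using lip[of t t 0 k] g(2)[of 0 k] that by simp
    then show ?thesis by linarith
  qed
  moreover have "\<exists>L. \<forall>k. \<forall>s\<in>{0..N}. \<forall>t\<in>{0..N}. \<bar>g k s - g k t\<bar> \<le> L * \<bar>s - t\<bar>" for N
    using lip by blast
  ultimately obtain r y where r: "strict_mono (r :: nat \<Rightarrow> nat)"
    and y: "\<And>t. 0 \<le> t \<Longrightarrow> (\<lambda>k. g (r k) t) \<longlonglongrightarrow> y t"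
    using locally_lipschitz_subsequence[of g "\<lambda>t. \<bar>z\<bar> + (rho + M t) * t"] by blast
  have h0: "(\<lambda>k. ?h (r k)) \<longlonglongrightarrow> 0"
  proof -
    have "?h \<longlonglongrightarrow> 0" using LIMSEQ_inverse_real_of_nat by (simp add: inverse_eq_divide add.commute)
    from LIMSEQ_subseq_LIMSEQ[OF this r] show ?thesis by (simp add: o_def)
  qed
  \<comment> \<open>The delayed time may be negative. There \<open>g\<close> has the value
    \<open>z\<close> which it has at 0, so the time can be raised to 0 and the Lipschitz bound on
    \<open>{0..t}\<close> applies.\<close>
  have y': "(\<lambda>k. g (r k) (t - ?h (r k))) \<longlonglongrightarrow> y t" if t: "0 \<le> t" for t
  proof -
    have "(\<lambda>k. g (r k) (t - ?h (r k)) - g (r k) t) \<longlonglongrightarrow> 0"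
    proof (rule Lim_null_comparison[OF _ tendsto_mult_right_zero[OF h0, of "rho + M t"]], rule always_eventually, rule allI)
      fix k
      let ?s = "t - ?h (r k)"
      have "\<bar>g (r k) (max ?s 0) - g (r k) t\<bar> \<le> (rho + M t) * \<bar>max ?s 0 - t\<bar>"
        using t by (intro lip) auto
      also have "\<dots> \<le> (rho + M t) * ?h (r k)"
        using t rho M[of t] by (intro mult_left_mono) (auto simp: max_def)
      also have "g (r k) (max ?s 0) = g (r k) ?s" using g(2) by (auto simp: max_def)
      finally show "norm (g (r k) ?s - g (r k) t) \<le> (rho + M t) * ?h (r k)" by simp
    qed
    from tendsto_add[OF this y[OF t]] show ?thesis by simp
  qed
  have int: "(\<lambda>s. v s - \<Psi> (y s)) integrable_on {0..t}" and
    lim: "(\<lambda>k. integral {0..t} (\<lambda>s. v s - \<Psi> (g (r k) (s - ?h (r k))))) \<longlonglongrightarrow> integral {0..t} (\<lambda>s. v s - \<Psi> (y s))"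
    for t
  proof -
    note dc = dominated_convergence[where S = "{0..t}" and f = "\<lambda>k s. v s - \<Psi> (g (r k) (s - ?h (r k)))"
        and h = "\<lambda>_. rho + M t" and g = "\<lambda>s. v s - \<Psi> (y s)"]
    have cv: "(\<lambda>k. v s - \<Psi> (g (r k) (s - ?h (r k)))) \<longlonglongrightarrow> v s - \<Psi> (y s)" if "s \<in> {0..t}" for s
      using that by (intro tendsto_intros continuous_on_tendsto_compose[OF Psi_cont y']) auto
    show "(\<lambda>s. v s - \<Psi> (y s)) integrable_on {0..t}"
      by (rule dc(1)) (use iF[OF gc] Fbd cv in auto)
    show "(\<lambda>k. integral {0..t} (\<lambda>s. v s - \<Psi> (g (r k) (s - ?h (r k))))) \<longlonglongrightarrow> integral {0..t} (\<lambda>s. v s - \<Psi> (y s))"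
      by (rule dc(2)) (use iF[OF gc] Fbd cv in auto)
  qed
  have "y t = z + integral {0..t} (\<lambda>s. v s - \<Psi> (y s))" if "0 \<le> t" for t
  proof (rule LIMSEQ_unique[OF y[OF that]])
    show "(\<lambda>k. g (r k) t) \<longlonglongrightarrow> z + integral {0..t} (\<lambda>s. v s - \<Psi> (y s))"
      using g(3)[OF that] by (simp add: \<Delta>_def tendsto_add[OF tendsto_const lim])
  qed
  then have "sol v z T y" if "0 \<le> T" for T
    using that by (intro sol_of_integral[OF vc int]) auto
  then show ?thesis by blast
qed

text \<open>One trajectory for all final times. Its values at negative times are unspecified, hence
  the \<open>max 0\<close> in statements about joint continuity and measurability.\<close>

definition flow :: "(real \<Rightarrow> real) \<Rightarrow> real \<Rightarrow> real \<Rightarrow> real" where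
  "flow v z = (SOME y. \<forall>T. 0 \<le> T \<longrightarrow> sol v z T y)"

lemma flow_sol: "adm v \<Longrightarrow> 0 \<le> T \<Longrightarrow> sol v z T (flow v z)"
  unfolding flow_def using someI_ex[OF sol_exists, of v z] by blast

lemma flow_0 [simp]: "adm v \<Longrightarrow> flow v z 0 = z"
  using flow_sol[of v 0 z] by (simp add: sol_def)

lemma flow_unique: "adm v \<Longrightarrow> sol v z T y \<Longrightarrow> 0 \<le> t \<Longrightarrow> t \<le> T \<Longrightarrow> flow v z t = y t"
  by (rule sol_unique[OF _ flow_sol]) auto

lemma flow_mono_strict: "adm v \<Longrightarrow> z1 < z2 \<Longrightarrow> 0 \<le> t \<Longrightarrow> flow v z1 t < flow v z2 t"
  by (rule sol_order[OF _ flow_sol flow_sol]) auto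

lemma flow_deriv:
  assumes "adm v" "0 < t"
  shows "(flow v z has_real_derivative v t - \<Psi> (flow v z t)) (at t)"
  using flow_sol[OF assms(1), of "t + 1" z] assms by (auto simp: sol_def)

lemma flow_upper: "adm v \<Longrightarrow> 0 \<le> t \<Longrightarrow> flow v z t \<le> z + rho * t"
  using sol_upper[OF _ flow_sol[of v t z], of 0 t] by simp

lemma flow_lower: "adm v \<Longrightarrow> 0 \<le> t \<Longrightarrow> min z 0 \<le> flow v z t"
  by (rule sol_lower[OF _ flow_sol]) auto

lemma flow_continuous: "adm v \<Longrightarrow> continuous_on {0..} (flow v z)"
proof -
  assume v: "adm v"
  have "continuous (at t within {0..}) (flow v z)" if "0 \<le> t" for t
  proof -
    have "continuous_on {0..t+1} (flow v z)" using flow_sol[OF v, of "t+1" z] that by (simp add: sol_def)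
    then have "continuous (at t within {0..t+1}) (flow v z)"
      using that by (simp add: continuous_on_eq_continuous_within)
    moreover have "at t within {0..} = at t within {0..t+1}"
      by (rule at_within_nhd[of _ "{..<t+1}"]) auto
    ultimately show ?thesis by (simp add: continuous_within)
  qed
  then show ?thesis by (simp add: continuous_on_eq_continuous_within)
qed

lemma flow_rate:
  assumes "adm v" "0 \<le> s" "0 \<le> t" "s \<le> N" "t \<le> N"
  shows "\<bar>flow v z t - flow v z s\<bar> \<le> (rho + p0 + V (\<bar>z\<bar> + rho * N)) * \<bar>t - s\<bar>"
proof (rule sol_rate[OF assms(1) flow_sol])
  show "flow v z r \<le> \<bar>z\<bar> + rho * N" if "0 \<le> r" "r \<le> N" for r
  proof -
    have "0 \<le> rho" using admD(4)[OF assms(1)] p0_nonneg by simp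
    then have "rho * r \<le> rho * N" using that by (intro mult_left_mono)
    then show ?thesis using flow_upper[OF assms(1) that(1), of z] by simp
  qed
qed (use assms in auto)

text \<open>Uniqueness of the limit equation turns compactness into convergence.\<close>
lemma flow_stability:
  assumes w: "adm w" and v: "\<And>k. adm (v k)"
    and vw: "\<And>t. 0 \<le> t \<Longrightarrow> t \<le> T \<Longrightarrow> (\<lambda>k :: nat. v k t) \<longlonglongrightarrow> w t"
    and z: "zk \<longlonglongrightarrow> z" and t: "0 \<le> t" "t \<le> T"
  shows "(\<lambda>k. flow (v k) (zk k) t) \<longlonglongrightarrow> flow w z t"
proof (rule tendsto_by_subsequences)
  fix q :: "nat \<Rightarrow> nat" assume q: "strict_mono q"
  have rho: "0 < rho" using admD(4)[OF w] p0_nonneg by linarith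
  obtain Z where Z: "\<And>k. \<bar>zk k\<bar> \<le> Z"
    using z[THEN convergentI, THEN convergent_imp_Bseq] by (auto simp: Bseq_def)
  define L where "L = rho + p0 + V (Z + rho * T)"
  \<comment> \<open>Frozen after \<open>T\<close>, so that one bound and one Lipschitz constant
    serve the whole half-line on which the compactness lemma works.\<close>
  let ?F = "\<lambda>k s. flow (v (q k)) (zk (q k)) (min s T)"
  have T: "0 \<le> T" using t by simp
  have Frate: "\<bar>?F k s - ?F k u\<bar> \<le> L * \<bar>s - u\<bar>" if "0 \<le> s" "0 \<le> u" for k s u
  proof -
    let ?c = "rho + p0 + V (\<bar>zk (q k)\<bar> + rho * T)"
    have "\<bar>?F k s - ?F k u\<bar> \<le> ?c * \<bar>min s T - min u T\<bar>"
      using that T by (intro flow_rate v) auto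
    also have "\<dots> \<le> L * \<bar>s - u\<bar>"
      using rho p0_nonneg V_nonneg Z[of "q k"] T unfolding L_def
      by (intro mult_mono add_mono V_mono) (auto simp: min_def)
    finally show ?thesis .
  qed
  have "\<bar>?F k s\<bar> \<le> Z + rho * T" if "0 \<le> s" for k s
  proof -
    have "?F k s \<le> zk (q k) + rho * min s T" using that T by (intro flow_upper v) auto
    moreover have "rho * min s T \<le> rho * T" using rho by (intro mult_left_mono) auto
    moreover have "min (zk (q k)) 0 \<le> ?F k s" using that T by (intro flow_lower v) auto
    moreover have "0 \<le> rho * T" using rho T by simp
    ultimately show ?thesis using Z[of "q k"] by linarith
  qed
  moreover have "\<exists>L. \<forall>k. \<forall>s\<in>{0..N}. \<forall>t\<in>{0..N}. \<bar>?F k s - ?F k t\<bar> \<le> L * \<bar>s - t\<bar>" for N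
    using Frate by (intro exI[of _ L]) auto
  ultimately obtain r y where r: "strict_mono (r :: nat \<Rightarrow> nat)"
    and y: "\<And>t. 0 \<le> t \<Longrightarrow> (\<lambda>k. ?F (r k) t) \<longlonglongrightarrow> y t"
    using locally_lipschitz_subsequence[of ?F "\<lambda>_. Z + rho * T"] by blast
  let ?v = "\<lambda>k. v (q (r k))" and ?z = "\<lambda>k. zk (q (r k))"
  have qr: "strict_mono (\<lambda>k. q (r k))" using q r by (simp add: strict_mono_def)
  have y': "(\<lambda>k. flow (?v k) (?z k) s) \<longlonglongrightarrow> y s" if "0 \<le> s" "s \<le> T" for s
    using y[OF that(1)] that by (simp add: min_def)
  have v': "(\<lambda>k. ?v k s) \<longlonglongrightarrow> w s" if "0 \<le> s" "s \<le> T" for s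
    using LIMSEQ_subseq_LIMSEQ[OF vw[OF that] qr] by (simp add: o_def)
  have z': "?z \<longlonglongrightarrow> z" using LIMSEQ_subseq_LIMSEQ[OF z qr] by (simp add: o_def)
  have Fint: "(\<lambda>s. ?v k s - \<Psi> (flow (?v k) (?z k) s)) integrable_on {0..t}" for k t
    by (intro integrable_continuous_interval continuous_intros admD(1)[OF v]
        continuous_on_compose2[OF Psi_cont] continuous_on_subset[OF flow_continuous[OF v]]) auto
  have Fbd: "\<bar>?v k s - \<Psi> (flow (?v k) (?z k) s)\<bar> \<le> L" if "0 \<le> s" "s \<le> T" for k s
  proof -
    have "flow (?v k) (?z k) s \<le> ?z k + rho * s" using that by (intro flow_upper v)
    also have "\<dots> \<le> Z + rho * T" using Z[of "q (r k)"] rho that by (intro add_mono mult_left_mono) auto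
    finally have "\<Psi> (flow (?v k) (?z k) s) \<le> p0 + V (Z + rho * T)"
      using Psi_upper[of "flow (?v k) (?z k) s"] V_mono by fastforce
    then show ?thesis
      using admD(2,3)[OF v, of "q (r k)" s] p0_nonneg Psi_nonneg[of "flow (?v k) (?z k) s"] rho
        V_nonneg[of "Z + rho * T"] by (simp add: abs_le_iff L_def)
  qed
  have int: "(\<lambda>s. w s - \<Psi> (y s)) integrable_on {0..u}" and
    lim: "(\<lambda>k. integral {0..u} (\<lambda>s. ?v k s - \<Psi> (flow (?v k) (?z k) s))) \<longlonglongrightarrow> integral {0..u} (\<lambda>s. w s - \<Psi> (y s))"
    if "u \<le> T" for u
  proof -
    note dc = dominated_convergence[where S = "{0..u}" and f = "\<lambda>k s. ?v k s - \<Psi> (flow (?v k) (?z k) s)"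
        and h = "\<lambda>_. L" and g = "\<lambda>s. w s - \<Psi> (y s)"]
    have cv: "(\<lambda>k. ?v k s - \<Psi> (flow (?v k) (?z k) s)) \<longlonglongrightarrow> w s - \<Psi> (y s)" if "s \<in> {0..u}" for s
      using that \<open>u \<le> T\<close>
      by (intro tendsto_intros continuous_on_tendsto_compose[OF Psi_cont y'] v') auto
    show "(\<lambda>s. w s - \<Psi> (y s)) integrable_on {0..u}"
      by (rule dc(1)) (use Fint Fbd cv that in auto)
    show "(\<lambda>k. integral {0..u} (\<lambda>s. ?v k s - \<Psi> (flow (?v k) (?z k) s))) \<longlonglongrightarrow> integral {0..u} (\<lambda>s. w s - \<Psi> (y s))"
      by (rule dc(2)) (use Fint Fbd cv that in auto)
  qed
  have yeq: "y u = z + integral {0..u} (\<lambda>s. w s - \<Psi> (y s))" if "0 \<le> u" "u \<le> T" for u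
  proof (rule LIMSEQ_unique[OF y'[OF that]])
    have "flow (?v k) (?z k) u = ?z k + integral {0..u} (\<lambda>s. ?v k s - \<Psi> (flow (?v k) (?z k) s))" for k
      using that T by (intro sol_integral[OF admD(1)[OF v] flow_sol[OF v T]]) auto
    moreover have "(\<lambda>k. ?z k + integral {0..u} (\<lambda>s. ?v k s - \<Psi> (flow (?v k) (?z k) s)))
      \<longlonglongrightarrow> z + integral {0..u} (\<lambda>s. w s - \<Psi> (y s))"
      by (intro tendsto_add z' lim that)
    ultimately show "(\<lambda>k. flow (?v k) (?z k) u) \<longlonglongrightarrow> z + integral {0..u} (\<lambda>s. w s - \<Psi> (y s))" by simp
  qed
  have "sol w z T y" using yeq T by (intro sol_of_integral admD(1)[OF w] int) auto
  then have "flow w z t = y t" by (rule flow_unique[OF w _ t])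
  then show "\<exists>s. strict_mono s \<and> (\<lambda>k. flow (v (q (s k))) (zk (q (s k))) t) \<longlonglongrightarrow> flow w z t"
    using y'[OF t] r by auto
qed

lemma flow_causal:
  assumes "adm v" "adm w" "\<And>r. 0 \<le> r \<Longrightarrow> r \<le> t \<Longrightarrow> v r = w r" "0 \<le> t"
  shows "flow v z t = flow w z t"
proof -
  have "sol v z t (flow w z)" using flow_sol[OF assms(2,4), of z] assms(3) by (auto simp: sol_def)
  then show ?thesis by (rule flow_unique[OF assms(1)]) (use assms in auto)
qed

end

section \<open>Dependence of the flow on the starting point\<close>

context drift
begin

lemma flow_gap_bound:
  assumes v: "adm v" and T: "0 \<le> T"
  obtains B where
    "\<And>z1 z2 t. z1 < z2 \<Longrightarrow> \<bar>z1\<bar> \<le> R \<Longrightarrow> \<bar>z2\<bar> \<le> R \<Longrightarrow> 0 \<le> t \<Longrightarrow> t \<le> T \<Longrightarrow>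
      exp (- B) * (z2 - z1) \<le> flow v z2 t - flow v z1 t \<and> flow v z2 t - flow v z1 t \<le> exp B * (z2 - z1)"
proof -
  have rho: "0 < rho" using admD(4)[OF v] p0_nonneg by linarith
  obtain d eta where st: "strip v d eta" using strip_exists[OF v zero_less_one] by blast
  obtain B where B: "0 \<le> B"
    "\<And>z1 z2 y1 y2 s t. sol v z1 T y1 \<Longrightarrow> sol v z2 T y2 \<Longrightarrow> 0 \<le> s \<Longrightarrow> s \<le> t \<Longrightarrow> t \<le> T \<Longrightarrow>
      (\<And>r. s \<le> r \<Longrightarrow> r \<le> t \<Longrightarrow> y1 r < y2 r) \<Longrightarrow>
      (\<And>r. s \<le> r \<Longrightarrow> r \<le> t \<Longrightarrow> - (R + rho * T) \<le> y1 r \<and> y2 r \<le> R + rho * T) \<Longrightarrow>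
      \<bar>ln (y2 t - y1 t) - ln (y2 s - y1 s)\<bar> \<le> B"
    using gap_bound[OF st T, of "R + rho * T"] by metis
  show thesis
  proof (rule that)
    fix z1 z2 t assume z: "z1 < z2" "\<bar>z1\<bar> \<le> R" "\<bar>z2\<bar> \<le> R" and t: "0 \<le> t" "t \<le> T"
    let ?D = "\<lambda>r. flow v z2 r - flow v z1 r"
    have D: "0 < ?D r" if "0 \<le> r" for r using flow_mono_strict[OF v z(1) that] by simp
    have bd: "- (R + rho * T) \<le> flow v z1 r \<and> flow v z2 r \<le> R + rho * T" if r: "0 \<le> r" "r \<le> t" for r
    proof
      have "rho * r \<le> rho * T" using r t rho by (intro mult_left_mono) auto
      then show "flow v z2 r \<le> R + rho * T" using flow_upper[OF v r(1), of z2] z by simp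
      have "0 \<le> rho * T" using rho T by simp
      then show "- (R + rho * T) \<le> flow v z1 r" using flow_lower[OF v r(1), of z1] z by linarith
    qed
    have "\<bar>ln (?D t) - ln (?D 0)\<bar> \<le> B"
      using t D bd by (intro B(2)[OF flow_sol[OF v T] flow_sol[OF v T]]) auto
    then have "- B + ln (z2 - z1) \<le> ln (?D t)" "ln (?D t) \<le> B + ln (z2 - z1)" using v by auto
    then have "exp (- B + ln (z2 - z1)) \<le> exp (ln (?D t))" "exp (ln (?D t)) \<le> exp (B + ln (z2 - z1))"
      by (simp_all only: exp_le_cancel_iff)
    then show "exp (- B) * (z2 - z1) \<le> ?D t \<and> ?D t \<le> exp B * (z2 - z1)"
      using D[OF t(1)] z(1) unfolding exp_add by simp
  qed
qed

lemma flow_lipschitz: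
  assumes v: "adm v" and T: "0 \<le> T"
  obtains C where "0 \<le> C"
    "\<And>z1 z2 t. \<bar>z1\<bar> \<le> R \<Longrightarrow> \<bar>z2\<bar> \<le> R \<Longrightarrow> 0 \<le> t \<Longrightarrow> t \<le> T \<Longrightarrow>
      \<bar>flow v z2 t - flow v z1 t\<bar> \<le> C * \<bar>z2 - z1\<bar>"
proof -
  obtain B where B: "\<And>z1 z2 t. z1 < z2 \<Longrightarrow> \<bar>z1\<bar> \<le> R \<Longrightarrow> \<bar>z2\<bar> \<le> R \<Longrightarrow> 0 \<le> t \<Longrightarrow> t \<le> T \<Longrightarrow>
      exp (- B) * (z2 - z1) \<le> flow v z2 t - flow v z1 t \<and> flow v z2 t - flow v z1 t \<le> exp B * (z2 - z1)"
    using flow_gap_bound[OF v T, of R] by blast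
  have "\<bar>flow v z2 t - flow v z1 t\<bar> \<le> exp B * \<bar>z2 - z1\<bar>"
    if "\<bar>z1\<bar> \<le> R" "\<bar>z2\<bar> \<le> R" "0 \<le> t" "t \<le> T" for z1 z2 t
  proof (cases z1 z2 rule: linorder_cases)
    case less
    then show ?thesis using B[of z1 z2 t] flow_mono_strict[OF v less that(3)] that by simp
  next
    case greater
    then show ?thesis using B[of z2 z1 t] flow_mono_strict[OF v greater that(3)] that by simp
  qed simp
  then show thesis by (intro that[of "exp B"]) auto
qed

lemma flow_jointly_continuous:
  assumes v: "adm v"
  shows "continuous_on UNIV (\<lambda>p. flow v (snd p) (max 0 (fst p)))"
proof -
  have "isCont (\<lambda>p. flow v (snd p) (max 0 (fst p))) (t0, z0)" for t0 z0
  proof -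
    let ?T = "max 0 t0 + 1" and ?R = "\<bar>z0\<bar> + 1"
    obtain C where C: "0 \<le> C"
      "\<And>z1 z2 t. \<bar>z1\<bar> \<le> ?R \<Longrightarrow> \<bar>z2\<bar> \<le> ?R \<Longrightarrow> 0 \<le> t \<Longrightarrow> t \<le> ?T \<Longrightarrow>
        \<bar>flow v z2 t - flow v z1 t\<bar> \<le> C * \<bar>z2 - z1\<bar>"
      using flow_lipschitz[OF v, of ?T ?R] by auto
    let ?L = "rho + p0 + V (\<bar>z0\<bar> + rho * ?T)"
    have "((\<lambda>p. flow v (snd p) (max 0 (fst p)) - flow v z0 (max 0 t0)) \<longlongrightarrow> 0) (at (t0, z0))"
    proof (rule Lim_null_comparison)
      show "((\<lambda>p. C * \<bar>snd p - z0\<bar> + ?L * \<bar>max 0 (fst p) - max 0 t0\<bar>) \<longlongrightarrow> 0) (at (t0, z0))"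
        by (rule tendsto_eq_intros refl | simp)+
      have "\<forall>\<^sub>F p in at (t0, z0). p \<in> {..<t0 + 1} \<times> {z0 - 1<..<z0 + 1}"
        by (rule eventually_at_in_open') (auto intro: open_Times)
      then show "\<forall>\<^sub>F p in at (t0, z0). norm (flow v (snd p) (max 0 (fst p)) - flow v z0 (max 0 t0))
          \<le> C * \<bar>snd p - z0\<bar> + ?L * \<bar>max 0 (fst p) - max 0 t0\<bar>"
      proof eventually_elim
        case (elim p)
        let ?t = "max 0 (fst p)"
        have "\<bar>flow v (snd p) ?t - flow v z0 ?t\<bar> \<le> C * \<bar>snd p - z0\<bar>"
          using elim by (intro C) auto
        moreover have "\<bar>flow v z0 ?t - flow v z0 (max 0 t0)\<bar> \<le> ?L * \<bar>?t - max 0 t0\<bar>"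
          using elim by (intro flow_rate[OF v]) auto
        ultimately show ?case unfolding real_norm_def[symmetric] by (rule norm_diff_triangle_le)
      qed
    qed
    then show ?thesis unfolding isCont_def by (simp add: LIM_zero_iff)
  qed
  then show ?thesis by (simp add: continuous_on_eq_continuous_at split_paired_all)
qed

text \<open>A trajectory that is below \<open>eta\<close> at time \<open>t\<close> was below
  \<open>eta\<close> all along, so \<open>strip_gap\<close> covers the whole of
  \<open>{0..t}\<close>; the term at the lower starting point is dropped by its sign.\<close>

lemma flow_strip_gap:
  assumes v: "adm v" and st: "strip v d eta" and z: "z1 < z2" and t: "0 \<le> t" and eta: "flow v z2 t < eta"
  shows "\<bar>ln ((flow v z2 t - flow v z1 t) / (z2 - z1))\<bar> \<le> V (flow v z2 t) / (2 * d)"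
proof -
  have d: "0 < d" using st by (simp add: strip_def)
  have "flow v z2 r \<le> eta" if "0 \<le> r" "r \<le> t" for r
    using sol_strip_before[OF v flow_sol[OF v t] st that(1) that(2) order_refl eta order_refl] by simp
  then have "\<bar>ln (flow v z2 t - flow v z1 t) - ln (flow v z2 0 - flow v z1 0)\<bar> \<le> (V (flow v z2 t) - V (flow v z1 0)) / (2 * d)"
    using t z v by (intro strip_gap[OF st flow_sol[OF v t] flow_sol[OF v t]] flow_mono_strict) auto
  also have "\<dots> \<le> V (flow v z2 t) / (2 * d)"
    using V_nonneg d by (intro divide_right_mono) auto
  finally show ?thesis
    using v z t flow_mono_strict[OF v z t] by (simp add: ln_div)
qed

text \<open>The expected limit is minus the integral of \<open>\<Psi>'\<close> along the trajectory,
  but this integral is singular at 0. Time is therefore split at some \<open>s\<close>: before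
  \<open>s\<close> the trajectories lie in a layer so thin that the logarithm moves by at most
  \<open>e / 2\<close>; after \<open>s\<close> they stay away from 0, where \<open>\<Psi>'\<close>
  is continuous. Both \<open>s\<close> and the centre \<open>l\<close> depend on
  \<open>e\<close>.\<close>

lemma flow_log_quotient_limit:
  assumes v: "adm v" and t: "0 \<le> t" and e: "0 < e"
  shows "\<exists>l \<delta>. 0 < \<delta> \<and> (\<forall>z1 z2. z1 < z2 \<longrightarrow> \<bar>z1 - z\<bar> < \<delta> \<longrightarrow> \<bar>z2 - z\<bar> < \<delta> \<longrightarrow>
    \<bar>ln ((flow v z2 t - flow v z1 t) / (z2 - z1)) - l\<bar> \<le> e)"
proof -
  have rho: "0 < rho" using admD(4)[OF v] p0_nonneg by linarith
  obtain d eta where st: "strip v d eta" using strip_exists[OF v zero_less_one] by blast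
  have d: "0 < d" "0 < eta" using st by (auto simp: strip_def)
  have "isCont V 0" using V_cont by (simp add: continuous_on_eq_continuous_at)
  then obtain k where k: "k > 0" "\<And>y. \<bar>y\<bar> < k \<Longrightarrow> \<bar>V y\<bar> < d * e"
    using d e V_le0[of 0] unfolding continuous_at_eps_delta
    by (metis dist_real_def diff_zero mult_pos_pos order_refl)
  \<comment> \<open>Below \<open>\<kappa>\<close> the bound \<open>V / (2 * d)\<close> of
    \<open>flow_strip_gap\<close> is at most \<open>e / 2\<close>.\<close>
  define \<kappa> where "\<kappa> = min (k/2) eta"
  have "\<bar>\<kappa>\<bar> < k" using k(1) d by (auto simp: \<kappa>_def min_def)
  from k(2)[OF this] have kap: "0 < \<kappa>" "\<kappa> \<le> eta" "V \<kappa> \<le> d * e" using k(1) d by (auto simp: \<kappa>_def)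
  \<comment> \<open>Three cases: \<open>z\<close> starts right of 0, and \<open>s = 0\<close>; the
    trajectory is still in the layer at \<open>t\<close>, and \<open>s = t\<close>; otherwise
    \<open>s\<close> is a passage through \<open>\<kappa> / 2\<close>.\<close>
  have "\<exists>s c. 0 \<le> s \<and> s \<le> t \<and> 0 < c \<and> (s = 0 \<or> flow v z s < \<kappa>) \<and> (s < t \<longrightarrow> (\<forall>r\<in>{s..t}. c \<le> flow v z r))"
  proof -
    consider "0 < z" | "flow v z t < \<kappa>" | "z \<le> 0" "\<kappa> \<le> flow v z t" by linarith
    then show ?thesis
    proof cases
      case 1
      have "\<exists>d' eta'. strip v d' eta' \<and> min z eta \<le> eta'"
        using st by (intro exI[of _ d] exI[of _ eta]) auto
      then have "min z eta \<le> flow v z r" if "0 \<le> r" "r \<le> t" for r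
        using v by (intro sol_stay_above[OF v flow_sol[OF v t, of z] order_refl that]) auto
      then show ?thesis using 1 d t by (intro exI[of _ 0] exI[of _ "min z eta"]) auto
    next
      case 2
      then show ?thesis using t by (intro exI[of _ t] exI[of _ 1]) auto
    next
      case 3
      have "\<exists>s\<ge>0. s \<le> t \<and> flow v z s = \<kappa> / 2"
        using 3 kap t v by (intro IVT' continuous_on_subset[OF flow_continuous[OF v]]) auto
      then obtain s where s: "0 \<le> s" "s \<le> t" "flow v z s = \<kappa> / 2" by blast
      have "\<exists>d' eta'. strip v d' eta' \<and> \<kappa> / 2 \<le> eta'"
        using st kap by (intro exI[of _ d] exI[of _ eta]) auto
      then have "\<kappa> / 2 \<le> flow v z r" if "s \<le> r" "r \<le> t" for r
        using s by (intro sol_stay_above[OF v flow_sol[OF v t, of z] s(1) that]) auto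
      then show ?thesis using s kap by (intro exI[of _ s] exI[of _ "\<kappa>/2"]) auto
    qed
  qed
  then obtain s c where s: "0 \<le> s" "s \<le> t" "s = 0 \<or> flow v z s < \<kappa>" and c: "0 < c"
    and above0: "s < t \<longrightarrow> (\<forall>r\<in>{s..t}. c \<le> flow v z r)" by blast
  have above: "c \<le> flow v z r" if "s < t" "s \<le> r" "r \<le> t" for r using above0 that by auto
  let ?R = "\<bar>z\<bar> + 1"
  obtain C where C: "0 \<le> C"
    "\<And>z1 z2 r. \<bar>z1\<bar> \<le> ?R \<Longrightarrow> \<bar>z2\<bar> \<le> ?R \<Longrightarrow> 0 \<le> r \<Longrightarrow> r \<le> t \<Longrightarrow>
      \<bar>flow v z2 r - flow v z1 r\<bar> \<le> C * \<bar>z2 - z1\<bar>"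
    using flow_lipschitz[OF v t, of ?R] by metis
  let ?M = "?R + rho * t"
  \<comment> \<open>Integrated over a time of length at most \<open>t\<close> this costs at most
    \<open>e / 2\<close>; the 1 avoids a division by 0.\<close>
  let ?e = "e / (2 * (t + 1))"
  have "uniformly_continuous_on {c/2..?M} \<Psi>'"
    using c by (intro compact_uniformly_continuous continuous_on_subset[OF Psi'_cont]) auto
  then obtain w where w: "0 < w" "\<And>x y. x \<in> {c/2..?M} \<Longrightarrow> y \<in> {c/2..?M} \<Longrightarrow> \<bar>x - y\<bar> < w \<Longrightarrow> \<bar>\<Psi>' x - \<Psi>' y\<bar> < ?e"
    unfolding uniformly_continuous_on_def dist_real_def using e t
    by (metis abs_minus_commute add_nonneg_pos divide_pos_pos mult_pos_pos zero_less_numeral zero_less_one)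
  \<comment> \<open>\<open>\<delta>\<close> will be so small that trajectories starting within
    \<open>\<delta>\<close> of \<open>z\<close> stay above \<open>c / 2\<close> after
    \<open>s\<close>, stay within the modulus of continuity \<open>w\<close> of
    \<open>\<Psi>'\<close>, and are inside the layer at time \<open>s\<close>.\<close>
  have lim1: "((\<lambda>\<delta>. C * \<delta>) \<longlongrightarrow> 0) (at_right 0)" by (rule tendsto_eq_intros refl | simp)+
  have "\<forall>\<^sub>F \<delta> in at_right 0. C * \<delta> < min w (c/2)" "\<forall>\<^sub>F \<delta> in at_right (0::real). \<delta> < 1"
    using order_tendstoD(2)[OF lim1, of "min w (c/2)"] w c order_tendstoD(2)[of "\<lambda>x::real. x" 0 "at_right 0" 1]
    by auto
  moreover have "\<forall>\<^sub>F \<delta> in at_right 0. s = 0 \<or> C * \<delta> < \<kappa> - flow v z s"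
    using s(3) order_tendstoD(2)[OF lim1, of "\<kappa> - flow v z s"] by auto
  moreover have "\<forall>\<^sub>F \<delta> in at_right (0::real). 0 < \<delta>" by (rule eventually_at_right_less)
  ultimately have "\<forall>\<^sub>F \<delta> in at_right 0. C * \<delta> < min w (c/2) \<and> \<delta> < 1 \<and> (s = 0 \<or> C * \<delta> < \<kappa> - flow v z s) \<and> 0 < \<delta>"
    by (intro eventually_conj)
  from eventually_happens'[OF trivial_limit_at_right_real this]
  obtain \<delta> where del: "0 < \<delta>" "\<delta> < 1" "C * \<delta> < w" "C * \<delta> < c/2" "s = 0 \<or> C * \<delta> < \<kappa> - flow v z s"
    by (metis min_less_iff_conj)
  define l where "l = - integral {s..t} (\<lambda>r. \<Psi>' (flow v z r))"
  have "\<bar>ln ((flow v z2 t - flow v z1 t) / (z2 - z1)) - l\<bar> \<le> e"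
    if z: "z1 < z2" "\<bar>z1 - z\<bar> < \<delta>" "\<bar>z2 - z\<bar> < \<delta>" for z1 z2
  proof -
    let ?y1 = "flow v z1" and ?y2 = "flow v z2"
    let ?D = "\<lambda>r. ?y2 r - ?y1 r"
    have D: "0 < ?D r" if "0 \<le> r" for r using flow_mono_strict[OF v z(1) that] by simp
    have near: "\<bar>flow v x r - flow v z r\<bar> \<le> C * \<delta>" if "\<bar>x - z\<bar> < \<delta>" "0 \<le> r" "r \<le> t" for x r
    proof -
      have "\<bar>flow v x r - flow v z r\<bar> \<le> C * \<bar>x - z\<bar>" using that del by (intro C) auto
      also have "\<dots> \<le> C * \<delta>" using that C(1) by (intro mult_left_mono) auto
      finally show ?thesis .
    qed
    have A: "\<bar>ln (?D s / (z2 - z1))\<bar> \<le> e / 2"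
    proof (cases "s = 0")
      case True
      then show ?thesis using v z e by simp
    next
      case False
      then have lt: "?y2 s < \<kappa>" using near[OF z(3) s(1,2)] del(5) by linarith
      have "\<bar>ln (?D s / (z2 - z1))\<bar> \<le> V (?y2 s) / (2 * d)"
        using lt kap by (intro flow_strip_gap[OF v st z(1) s(1)]) auto
      also have "\<dots> \<le> (d * e) / (2 * d)"
        using V_mono[of "?y2 s" \<kappa>] lt kap d by (intro divide_right_mono) auto
      finally show ?thesis using d by simp
    qed
    have B: "\<bar>ln (?D t) - ln (?D s) - l\<bar> \<le> e / 2"
    proof (cases "s < t")
      case False
      then show ?thesis using s e by (simp add: l_def)
    next
      case True
      \<comment> \<open>By the mean value theorem the logarithm of the gap has derivative
        \<open>- \<Psi>' x\<close> with \<open>x\<close> between the two trajectories, so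
        \<open>F\<close> has derivative \<open>\<Psi>' (flow v z r) - \<Psi>' x\<close>, of size at
        most \<open>?e\<close>.\<close>
      define F where "F r = ln (?D r) + integral {s..r} (\<lambda>r. \<Psi>' (flow v z r))" for r
      have in_range: "flow v x r \<in> {c/2..?M}" if "\<bar>x - z\<bar> < \<delta>" "s \<le> r" "r \<le> t" for x r
      proof -
        have "flow v z r - c/2 \<le> flow v x r" using near[OF that(1), of r] that s del by linarith
        moreover have "flow v x r \<le> x + rho * r" using that s by (intro flow_upper[OF v]) auto
        moreover have "rho * r \<le> rho * t" using that rho by (intro mult_left_mono) auto
        ultimately show ?thesis using above[OF True that(2,3)] that del by auto
      qed
      have contP: "continuous_on {s..t} (\<lambda>r. \<Psi>' (flow v z r))"
        using in_range[of z] del c s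
        by (intro continuous_on_compose2[OF Psi'_cont] continuous_on_subset[OF flow_continuous[OF v]]) force+
      have Fder: "\<exists>x. (F has_real_derivative x) (at r) \<and> \<bar>x\<bar> \<le> ?e" if r: "s < r" "r < t" for r
      proof -
        have "((\<lambda>u. integral {s..u} (\<lambda>r. \<Psi>' (flow v z r))) has_real_derivative \<Psi>' (flow v z r)) (at r within {s..t})"
          using r by (intro integral_has_real_derivative[OF contP]) auto
        moreover have "at r within {s..t} = at r" using r by (intro at_within_interior) auto
        ultimately have 1: "((\<lambda>u. integral {s..u} (\<lambda>r. \<Psi>' (flow v z r))) has_real_derivative \<Psi>' (flow v z r)) (at r)"
          by simp
        have r0: "0 < r" using r s by simp
        have lt: "?y1 r < ?y2 r" using D[of r] r0 by simp
        have "\<exists>x>?y1 r. x < ?y2 r \<and> \<Psi> (?y2 r) - \<Psi> (?y1 r) = (?y2 r - ?y1 r) * \<Psi>' x"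
          using in_range[OF z(2), of r] r c lt by (intro MVT2 Psi_deriv) auto
        then obtain x where x: "?y1 r < x" "x < ?y2 r" "\<Psi> (?y2 r) - \<Psi> (?y1 r) = ?D r * \<Psi>' x" by blast
        have 2: "((\<lambda>r. ln (?D r)) has_real_derivative - \<Psi>' x) (at r)"
        proof -
          have "((\<lambda>r. ln (?D r)) has_real_derivative ((v r - \<Psi> (?y2 r)) - (v r - \<Psi> (?y1 r))) * (1 / ?D r)) (at r)"
            using lt by (auto intro!: derivative_eq_intros flow_deriv[OF v r0] simp: divide_simps)
          also have "((v r - \<Psi> (?y2 r)) - (v r - \<Psi> (?y1 r))) * (1 / ?D r) = - \<Psi>' x"
            using x(3) D[of r] r0 by (simp add: field_simps)
          finally show ?thesis .
        qed
        have "\<bar>\<Psi>' (flow v z r) - \<Psi>' x\<bar> < ?e"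
        proof (rule w(2))
          show "flow v z r \<in> {c/2..?M}" using in_range[of z r] del r by simp
          show "x \<in> {c/2..?M}" using in_range[OF z(2), of r] in_range[OF z(3), of r] x r by auto
          show "\<bar>flow v z r - x\<bar> < w"
            using near[OF z(2), of r] near[OF z(3), of r] x r r0 del by linarith
        qed
        then have 3: "\<bar>- \<Psi>' x + \<Psi>' (flow v z r)\<bar> \<le> ?e" by linarith
        show ?thesis unfolding F_def
          by (rule exI[of _ "- \<Psi>' x + \<Psi>' (flow v z r)"]) (use DERIV_add[OF 2 1] 3 in auto)
      qed
      have Fcont: "continuous_on {s..t} F"
        unfolding F_def using D s
        by (intro continuous_intros continuous_on_subset[OF flow_continuous[OF v]]
            indefinite_integral_continuous_1 integrable_continuous_interval contP)
           (auto simp: less_imp_neq[symmetric])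
      have "\<exists>l x. s < x \<and> x < t \<and> (F has_real_derivative l) (at x) \<and> F t - F s = (t - s) * l"
        using Fder by (intro MVT[OF True Fcont]) (metis real_differentiable_def)
      then obtain l' x where x: "s < x" "x < t" "(F has_real_derivative l') (at x)" "F t - F s = (t - s) * l'" by blast
      have "\<bar>l'\<bar> \<le> ?e" using Fder[OF x(1,2)] DERIV_unique[OF x(3)] by blast
      then have "(t - s) * \<bar>l'\<bar> \<le> (t - s) * ?e" using s by (intro mult_left_mono) auto
      then have "\<bar>F t - F s\<bar> \<le> (t - s) * ?e" unfolding x(4) abs_mult using s by simp
      also have "\<dots> \<le> (t + 1) * ?e" using s t e by (intro mult_right_mono) auto
      also have "\<dots> = e / 2" using t by (simp add: field_simps)
      finally have "\<bar>F t - F s\<bar> \<le> e / 2" .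
      moreover have "F t - F s = ln (?D t) - ln (?D s) - l" by (simp add: F_def l_def)
      ultimately show ?thesis by simp
    qed
    have "ln (?D t / (z2 - z1)) = ln (?D t) - ln (?D s) + ln (?D s / (z2 - z1))"
      using D[of s] D[of t] s t z by (simp add: ln_div)
    then show ?thesis using A B by linarith
  qed
  then show ?thesis using del(1) by blast
qed

text \<open>Taking logarithms gives positivity of the derivative together with its existence: the
  difference quotients tend to \<open>exp l\<close>.\<close>

lemma flow_diff_initial:
  assumes v: "adm v" and t: "0 \<le> t"
  obtains J where "0 < J" "((\<lambda>z. flow v z t) has_real_derivative J) (at z)"
proof -
  let ?q = "\<lambda>x. (flow v x t - flow v z t) / (x - z)"
  have "\<exists>l. eventually (\<lambda>x. \<bar>ln (?q x) - l\<bar> \<le> e) (at z)" if e: "0 < e" for e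
  proof -
    obtain l \<delta> where l: "0 < \<delta>" "\<And>z1 z2. z1 < z2 \<Longrightarrow> \<bar>z1 - z\<bar> < \<delta> \<Longrightarrow> \<bar>z2 - z\<bar> < \<delta> \<Longrightarrow>
      \<bar>ln ((flow v z2 t - flow v z1 t) / (z2 - z1)) - l\<bar> \<le> e"
      using flow_log_quotient_limit[OF v t e, of z] by blast
    have "\<bar>ln (?q x) - l\<bar> \<le> e" if x: "x \<noteq> z" "\<bar>x - z\<bar> < \<delta>" for x
    proof (cases "x < z")
      case True
      have "?q x = (flow v z t - flow v x t) / (z - x)" using True by (simp add: field_simps)
      then show ?thesis using l(2)[OF True x(2)] l(1) by simp
    next
      case False
      then show ?thesis using l(2)[of z x] x l(1) by simp
    qed
    then have "eventually (\<lambda>x. \<bar>ln (?q x) - l\<bar> \<le> e) (at z)"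
      using l(1) by (auto simp: eventually_at dist_real_def intro!: exI[of _ \<delta>])
    then show ?thesis by blast
  qed
  then obtain l where l: "((\<lambda>x. ln (?q x)) \<longlongrightarrow> l) (at z)"
    using approx_limit_exists[of "at z" "\<lambda>x. ln (?q x)"] by auto
  have pos: "0 < ?q x" if "x \<noteq> z" for x
    using flow_mono_strict[OF v _ t, of x z] flow_mono_strict[OF v _ t, of z x] that
    by (cases "x < z") (auto simp: zero_less_divide_iff)
  have "((\<lambda>x. exp (ln (?q x))) \<longlongrightarrow> exp l) (at z)" by (intro tendsto_intros l)
  moreover have "\<forall>\<^sub>F x in at z. exp (ln (?q x)) = ?q x"
    using pos by (auto simp: eventually_at_filter)
  ultimately have "(?q \<longlongrightarrow> exp l) (at z)" by (rule Lim_transform_eventually)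
  then have "((\<lambda>z. flow v z t) has_real_derivative exp l) (at z)" by (simp add: has_field_derivative_iff)
  then show thesis by (intro that[of "exp l"]) auto
qed

text \<open>The limit is taken from the right because \<open>flow_strip_gap\<close> is expressed
  through the upper trajectory, which then tends to the one from \<open>z\<close>. The bound tends
  to 0 at the boundary, so there the derivative tends to 1.\<close>

lemma flow_diff_strip:
  assumes v: "adm v" and st: "strip v d eta" and t: "0 \<le> t" and eta: "flow v z t < eta"
    and J: "((\<lambda>z. flow v z t) has_real_derivative J) (at z)" "0 < J"
  shows "\<bar>ln J\<bar> \<le> V (flow v z t) / (2 * d)"
proof -
  have c: "((\<lambda>x. flow v x t) \<longlongrightarrow> flow v z t) (at z)" using J(1) DERIV_isCont isCont_def by blast
  have q: "((\<lambda>x. (flow v x t - flow v z t) / (x - z)) \<longlongrightarrow> J) (at z)"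
    using J(1) by (simp add: has_field_derivative_iff)
  have d: "0 < d" using st by (simp add: strip_def)
  have Vc: "isCont V y" for y using V_cont by (simp add: continuous_on_eq_continuous_at)
  have le: "at_right z \<le> at z" by (simp add: at_le)
  show ?thesis
  proof (rule tendsto_le[where F = "at_right z"])
    show "((\<lambda>x. V (flow v x t) / (2 * d)) \<longlongrightarrow> V (flow v z t) / (2 * d)) (at_right z)"
      using d by (intro tendsto_intros isCont_tendsto_compose[OF Vc] tendsto_mono[OF le c]) auto
    show "((\<lambda>x. \<bar>ln ((flow v x t - flow v z t) / (x - z))\<bar>) \<longlongrightarrow> \<bar>ln J\<bar>) (at_right z)"
      using J(2) by (intro tendsto_intros tendsto_mono[OF le q]) auto
    have "\<forall>\<^sub>F x in at_right z. flow v x t < eta"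
      using order_tendstoD(2)[OF tendsto_mono[OF le c] eta] .
    moreover have "\<forall>\<^sub>F x in at_right z. z < x" by (rule eventually_at_right_less)
    ultimately show "\<forall>\<^sub>F x in at_right z. \<bar>ln ((flow v x t - flow v z t) / (x - z))\<bar> \<le> V (flow v x t) / (2 * d)"
    proof eventually_elim
      case (elim x)
      then show ?case by (intro flow_strip_gap[OF v st _ t])
    qed
  qed simp
qed

end

section \<open>The change of variables straightening the growth rate\<close>

text \<open>Applied to \<open>1 / a\<close>, which gives \<open>A\<close>, and to the absolute value
  of the derivative of \<open>b / a\<close>, which gives the variation: both may be singular at 0
  and are merely integrable there.\<close>

lemma primitive_from_zero:
  fixes g :: "real \<Rightarrow> real"
  assumes c: "continuous_on {0<..} g" and i: "set_integrable lborel {0<..<1} g"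
  shows primitive_continuous: "continuous_on {0..} (\<lambda>x. integral {0..x} g)"
    and primitive_deriv: "0 < x \<Longrightarrow> ((\<lambda>x. integral {0..x} g) has_real_derivative g x) (at x)"
proof -
  have "g integrable_on {0<..<1}" using set_borel_integral_eq_integral(1)[OF i] .
  then have 1: "g integrable_on {0..1}"
    using integrable_on_Icc_iff_Ioo by blast
  have int: "g integrable_on {0..x}" for x
  proof (cases "x \<le> 1")
    case True
    then show ?thesis by (intro integrable_subinterval_real[OF 1]) auto
  next
    case False
    have "g integrable_on {1..x}"
      by (intro integrable_continuous_interval continuous_on_subset[OF c]) auto
    with 1 False show ?thesis
      by (intro Henstock_Kurzweil_Integration.integrable_combine[of 0 1 x g]) auto
  qed
  have "continuous (at x within {0..}) (\<lambda>x. integral {0..x} g)" if "0 \<le> x" for x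
  proof -
    have "continuous_on {0..x+1} (\<lambda>x. integral {0..x} g)"
      by (rule indefinite_integral_continuous_1[OF int])
    then have "continuous (at x within {0..x+1}) (\<lambda>x. integral {0..x} g)"
      using that by (simp add: continuous_on_eq_continuous_within)
    moreover have "at x within {0..} = at x within {0..x+1}"
      by (rule at_within_nhd[of _ "{..<x+1}"]) auto
    ultimately show ?thesis by (simp add: continuous_within)
  qed
  then show "continuous_on {0..} (\<lambda>x. integral {0..x} g)"
    by (simp add: continuous_on_eq_continuous_within)
  show "((\<lambda>x. integral {0..x} g) has_real_derivative g x) (at x)" if "0 < x"
  proof -
    have "isCont g x" using c that by (simp add: continuous_on_eq_continuous_at)
    then have "((\<lambda>u. integral {0..u} g) has_vector_derivative g x) (at x within {0..x+1})"
      using that by (intro integral_has_vector_derivative_continuous_at[where S = "{}", simplified] int)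
        (auto intro: continuous_at_imp_continuous_at_within)
    moreover have "at x within {0..x+1} = at x" using that by (intro at_within_interior) auto
    ultimately show ?thesis by (simp add: has_real_derivative_iff_has_vector_derivative)
  qed
qed

lemma linear_growth:
  fixes g :: "real \<Rightarrow> real"
  assumes c: "continuous_on {0..} g" and d: "\<And>x. 0 < x \<Longrightarrow> g differentiable (at x)"
    and b: "bounded (deriv g ` {1<..})"
  obtains C where "0 < C" "\<And>x. 0 \<le> x \<Longrightarrow> \<bar>g x\<bar> \<le> C * (1 + x)"
proof -
  have "bounded (g ` {0..1})"
    by (intro compact_imp_bounded compact_continuous_image continuous_on_subset[OF c]) auto
  then obtain M where M: "\<forall>x\<in>{0..1}. \<bar>g x\<bar> \<le> M" by (auto simp: bounded_iff)
  from b obtain M' where M': "\<forall>x>1. \<bar>deriv g x\<bar> \<le> M'" by (auto simp: bounded_iff)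
  have pos: "0 \<le> M" "0 \<le> M'"
    using M[rule_format, of 0] M'[rule_format, of 2] abs_ge_zero[of "g 0"] abs_ge_zero[of "deriv g 2"]
    by (auto simp del: abs_ge_zero)
  have "\<bar>g x\<bar> \<le> (M + M' + 1) * (1 + x)" if x: "0 \<le> x" for x
  proof (cases "x \<le> 1")
    case True
    then have "\<bar>g x\<bar> \<le> M * 1" using M x by auto
    also have "\<dots> \<le> (M + M' + 1) * (1 + x)" using pos x by (intro mult_mono) auto
    finally show ?thesis .
  next
    case False
    have "\<exists>z>1. z < x \<and> g x - g 1 = (x - 1) * deriv g z"
      using False d by (intro MVT2) (auto simp: DERIV_deriv_iff_real_differentiable)
    then obtain z where z: "1 < z" "z < x" "g x - g 1 = (x - 1) * deriv g z" by blast
    have "\<bar>g x - g 1\<bar> = (x - 1) * \<bar>deriv g z\<bar>" unfolding z(3) using False by (simp add: abs_mult)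
    also have "\<dots> \<le> (x - 1) * M'" using M' z False by (intro mult_left_mono) auto
    finally have "\<bar>g x\<bar> \<le> M + (x - 1) * M'" using M[rule_format, of 1] by auto
    also have "\<dots> \<le> (M + M' + 1) * (1 + x)"
      using pos False by (simp add: algebra_simps)
    finally show ?thesis .
  qed
  then show thesis using pos by (intro that[of "M + M' + 1"]) auto
qed

locale ls_coeff =
  fixes a b :: "real \<Rightarrow> real" and p0 rho :: real
  assumes a_nonneg: "0 \<le> x \<Longrightarrow> 0 \<le> a x" and b_nonneg: "0 \<le> x \<Longrightarrow> 0 \<le> b x"
    and a_C0: "continuous_on {0..} a" and b_C0: "continuous_on {0..} b"
    and a_diff: "0 < x \<Longrightarrow> a differentiable (at x)" and a_C1: "continuous_on {0<..} (deriv a)"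
    and b_diff: "0 < x \<Longrightarrow> b differentiable (at x)" and b_C1: "continuous_on {0<..} (deriv b)"
    and a'_bdd: "bounded (deriv a ` {1<..})" and b'_bdd: "bounded (deriv b ` {1<..})"
    and a_pos: "0 < x \<Longrightarrow> 0 < a x"
    and inv_a_L1: "set_integrable lborel {0<..<1} (\<lambda>x. 1 / a x)"
    and Phi_lim: "((\<lambda>x. b x / a x) \<longlongrightarrow> p0) (at_right 0)"
    and Phi'_L1: "set_integrable lborel {0<..<1} (deriv (\<lambda>x. b x / a x))"
begin

lemma a_deriv: "0 < x \<Longrightarrow> (a has_real_derivative deriv a x) (at x)"
  and b_deriv: "0 < x \<Longrightarrow> (b has_real_derivative deriv b x) (at x)"
  using a_diff b_diff by (simp_all add: DERIV_deriv_iff_real_differentiable)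

definition A :: "real \<Rightarrow> real" where "A x = integral {0..x} (\<lambda>r. 1 / a r)"

definition Phi :: "real \<Rightarrow> real" where "Phi x = b x / a x"

text \<open>The inverse of \<open>A\<close>, extended by 0, so that every particle which has not yet
  entered sits at position 0.\<close>

definition X :: "real \<Rightarrow> real" where
  "X y = (if y \<le> 0 then 0 else THE x. 0 \<le> x \<and> A x = y)"

definition Psi :: "real \<Rightarrow> real" where "Psi y = (if y \<le> 0 then p0 else Phi (X y))"

definition Psi' :: "real \<Rightarrow> real" where "Psi' y = deriv Phi (X y) * a (X y)"

text \<open>The total variation of \<open>Psi\<close> between 0 and \<open>y\<close>, computed in
  the variable \<open>x\<close>, where the integrability hypothesis is stated.\<close>

definition Var :: "real \<Rightarrow> real" where "Var y = integral {0..X y} (\<lambda>r. \<bar>deriv Phi r\<bar>)"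

lemma inv_a_cont: "continuous_on {0<..} (\<lambda>r. 1 / a r)"
proof -
  have "continuous_on {0<..} a" by (rule continuous_on_subset[OF a_C0]) auto
  then show ?thesis using a_pos by (intro continuous_on_divide continuous_on_const) (auto simp: less_imp_neq[symmetric])
qed

lemmas A_continuous = primitive_continuous[OF inv_a_cont inv_a_L1, folded A_def]
lemmas A_deriv = primitive_deriv[OF inv_a_cont inv_a_L1, folded A_def]

lemma A_0 [simp]: "A 0 = 0" by (simp add: A_def)

lemma A_strict_mono: "0 \<le> x \<Longrightarrow> x < y \<Longrightarrow> A x < A y"
proof (rule DERIV_pos_imp_increasing_open[where f = A])
  fix r assume "0 \<le> x" "x < y" "x < r" "r < y"
  then show "\<exists>d. (A has_real_derivative d) (at r) \<and> 0 < d"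
    using A_deriv[of r] a_pos[of r] by (intro exI[of _ "1 / a r"]) auto
next
  assume "0 \<le> x" "x < y"
  then show "continuous_on {x..y} A" by (auto intro: continuous_on_subset[OF A_continuous])
qed

lemma A_less_iff: "0 \<le> x \<Longrightarrow> 0 \<le> y \<Longrightarrow> A x < A y \<longleftrightarrow> x < y"
  using A_strict_mono[of x y] A_strict_mono[of y x] by (cases x y rule: linorder_cases) auto

lemma A_inj: "0 \<le> x \<Longrightarrow> 0 \<le> y \<Longrightarrow> A x = A y \<longleftrightarrow> x = y"
  using A_less_iff[of x y] A_less_iff[of y x] by auto

lemma growth:
  obtains C where "0 < C" "\<And>x. 0 \<le> x \<Longrightarrow> a x \<le> C * (1 + x)" "\<And>x. 0 \<le> x \<Longrightarrow> b x \<le> C * (1 + x)"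
proof -
  obtain C1 where C1: "0 < C1" "\<And>x. 0 \<le> x \<Longrightarrow> \<bar>a x\<bar> \<le> C1 * (1 + x)"
    using linear_growth[OF a_C0 a_diff a'_bdd] by blast
  obtain C2 where C2: "0 < C2" "\<And>x. 0 \<le> x \<Longrightarrow> \<bar>b x\<bar> \<le> C2 * (1 + x)"
    using linear_growth[OF b_C0 b_diff b'_bdd] by blast
  have "a x \<le> (C1 + C2) * (1 + x)" "b x \<le> (C1 + C2) * (1 + x)" if "0 \<le> x" for x
  proof -
    have "C1 * (1 + x) \<le> (C1 + C2) * (1 + x)" "C2 * (1 + x) \<le> (C1 + C2) * (1 + x)"
      using C1(1) C2(1) that by (auto intro!: mult_right_mono)
    then show "a x \<le> (C1 + C2) * (1 + x)" "b x \<le> (C1 + C2) * (1 + x)"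
      using C1(2)[OF that] C2(2)[OF that] by linarith+
  qed
  with C1(1) C2(1) that[of "C1 + C2"] show thesis by simp
qed

text \<open>Linear growth of \<open>a\<close> gives \<open>1 / a x \<ge> 1 / (C * (1 + x))\<close>,
  hence \<open>A x \<ge> ln (1 + x) / C\<close>, which explains the witness
  \<open>exp (C * y)\<close>. In the straightened variable infinity is infinitely far away.\<close>

lemma A_surj:
  assumes "0 \<le> y" obtains x where "0 \<le> x" "A x = y"
proof -
  obtain C where C: "0 < C" "\<And>x. 0 \<le> x \<Longrightarrow> a x \<le> C * (1 + x)" by (rule growth) blast
  let ?x = "exp (C * y)"
  have x1: "1 \<le> ?x" using C assms by simp
  have "A 0 - ln (1 + 0) / C \<le> A ?x - ln (1 + ?x) / C"
  proof (rule DERIV_nonneg_imp_increasing_open[where f = "\<lambda>r. A r - ln (1 + r) / C"])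
    show "continuous_on {0..?x} (\<lambda>r. A r - ln (1 + r) / C)"
      using C by (intro continuous_intros continuous_on_subset[OF A_continuous]) auto
    fix r assume r: "0 < r" "r < ?x"
    have "((\<lambda>r. A r - ln (1 + r) / C) has_real_derivative 1 / a r - 1 / (1 + r) / C) (at r)"
      using r C by (auto intro!: derivative_eq_intros A_deriv simp: divide_simps)
    moreover have "1 / (1 + r) / C \<le> 1 / a r"
      using C(2)[of r] r C(1) a_pos[of r] by (simp add: divide_simps mult.commute)
    ultimately show "\<exists>d. ((\<lambda>r. A r - ln (1 + r) / C) has_real_derivative d) (at r) \<and> 0 \<le> d"
      by (intro exI[of _ "1 / a r - 1 / (1 + r) / C"]) simp
  qed simp
  moreover have "y \<le> ln (1 + ?x) / C"
  proof -
    have "ln ?x \<le> ln (1 + ?x)" by (subst ln_le_cancel_iff) (auto simp: add_pos_pos)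
    then show ?thesis using C(1) by (simp add: pos_le_divide_eq mult.commute)
  qed
  ultimately have "y \<le> A ?x" by simp
  then have "\<exists>x\<ge>0. x \<le> ?x \<and> A x = y"
    using assms by (intro IVT' continuous_on_subset[OF A_continuous]) auto
  with that show thesis by blast
qed

lemma X_A [simp]: "0 \<le> x \<Longrightarrow> X (A x) = x"
proof -
  assume x: "0 \<le> x"
  show "X (A x) = x"
  proof (cases "x = 0")
    case False
    then have "0 < A x" using A_strict_mono[of 0 x] x by simp
    moreover have "(THE x'. 0 \<le> x' \<and> A x' = A x) = x"
      using x A_inj by (intro the_equality) auto
    ultimately show ?thesis by (simp add: X_def)
  qed (simp add: X_def)
qed

lemma A_X: "0 \<le> y \<Longrightarrow> A (X y) = y" and X_nonneg: "0 \<le> X y"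
proof -
  have *: "A (X y) = y \<and> 0 \<le> X y" if y: "0 \<le> y" for y
  proof -
    obtain x where "0 \<le> x" "A x = y" by (rule A_surj[OF y])
    then show ?thesis by auto
  qed
  then show "0 \<le> y \<Longrightarrow> A (X y) = y" by blast
  show "0 \<le> X y" using *[of y] by (cases "0 \<le> y") (auto simp: X_def)
qed

lemma X_le0 [simp]: "y \<le> 0 \<Longrightarrow> X y = 0" by (simp add: X_def)

lemma A_pos: "0 < x \<Longrightarrow> 0 < A x" using A_strict_mono[of 0 x] by simp

lemma A_nonneg: "0 \<le> x \<Longrightarrow> 0 \<le> A x" using A_pos[of x] by (cases "x = 0") auto

lemma X_pos: "0 < y \<Longrightarrow> 0 < X y"
  using A_X[of y] X_nonneg[of y] by (cases "X y = 0") auto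

lemma X_less: "0 \<le> y \<Longrightarrow> 0 \<le> x \<Longrightarrow> X y < x \<longleftrightarrow> y < A x"
  using A_less_iff[OF X_nonneg, of x y] A_X[of y] by simp

lemma X_strict_mono: "0 \<le> y1 \<Longrightarrow> y1 < y2 \<Longrightarrow> X y1 < X y2"
  using X_less[of y1 "X y2"] A_X[of y2] X_nonneg[of y2] by simp

lemma X_isCont_pos: "0 < y \<Longrightarrow> isCont X y"
proof -
  assume y: "0 < y"
  have "isCont X (A (X y))"
  proof (rule isCont_inverse_function[where d = "X y / 2" and f = A and x = "X y"])
    show "0 < X y / 2" using X_pos[OF y] by simp
    have pos: "0 < z" if "\<bar>z - X y\<bar> \<le> X y / 2" for z
      using X_pos[OF y] that by linarith
    show "X (A z) = z" if "\<bar>z - X y\<bar> \<le> X y / 2" for z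
      using pos[OF that] by simp
    show "isCont A z" if "\<bar>z - X y\<bar> \<le> X y / 2" for z
      by (rule DERIV_isCont[OF A_deriv[OF pos[OF that]]])
  qed
  then show "isCont X y" using A_X y by simp
qed

lemma X_tendsto_0: "(X \<longlongrightarrow> 0) (nhds 0)"
proof (rule tendstoI)
  fix e :: real assume e: "0 < e"
  have "\<forall>\<^sub>F y in nhds 0. y < A e"
    using A_pos[OF e] by (intro order_tendstoD(2)[OF filterlim_ident]) auto
  then show "\<forall>\<^sub>F y in nhds 0. dist (X y) 0 < e"
  proof eventually_elim
    case (elim y)
    then show ?case using X_less[of y e] e X_nonneg[of y] by (cases "0 \<le> y") auto
  qed
qed

lemma X_continuous: "continuous_on UNIV X"
proof -
  have "isCont X y" for y
  proof (cases y "0::real" rule: linorder_cases)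
    case less
    have "\<forall>\<^sub>F u in nhds y. u \<in> {..<0}" using less by (intro eventually_nhds_in_open) auto
    then have "\<forall>\<^sub>F u in nhds y. X u = 0" by eventually_elim simp
    then show ?thesis by (subst isCont_cong) auto
  next
    case equal
    have "(X \<longlongrightarrow> 0) (at 0)"
      by (rule tendsto_mono[OF _ X_tendsto_0]) (simp add: at_within_def)
    then show ?thesis using equal by (simp add: isCont_def)
  qed (rule X_isCont_pos)
  then show ?thesis by (simp add: continuous_on_eq_continuous_at)
qed

lemma X_deriv: "0 < y \<Longrightarrow> (X has_real_derivative a (X y)) (at y)"
proof -
  assume y: "0 < y"
  have "(X has_real_derivative inverse (1 / a (X y))) (at y)"
    by (rule DERIV_inverse_function[where f = A and a = 0 and b = "y + 1"])
       (use y X_pos[OF y] a_pos[of "X y"] A_deriv[of "X y"] A_X X_isCont_pos in auto)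
  then show ?thesis by simp
qed

lemma Phi_deriv: "0 < x \<Longrightarrow> (Phi has_real_derivative deriv Phi x) (at x)"
  and Phi'_cont: "continuous_on {0<..} (deriv Phi)"
proof -
  have D: "(Phi has_real_derivative (deriv b x * a x - b x * deriv a x) / (a x * a x)) (at x)" if "0 < x" for x
    unfolding Phi_def using a_pos[OF that] that by (intro DERIV_divide a_deriv b_deriv) auto
  then show "0 < x \<Longrightarrow> (Phi has_real_derivative deriv Phi x) (at x)"
    using DERIV_imp_deriv by metis
  have "continuous_on {0<..} (\<lambda>x. (deriv b x * a x - b x * deriv a x) / (a x * a x))"
  proof -
    have "continuous_on {0<..} a" "continuous_on {0<..} b"
      by (rule continuous_on_subset[OF a_C0] continuous_on_subset[OF b_C0]; auto)+
    then show ?thesis using a_pos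
      by (intro continuous_on_divide continuous_on_diff continuous_on_mult a_C1 b_C1)
         (auto simp: less_imp_neq[symmetric])
  qed
  moreover have "deriv Phi x = (deriv b x * a x - b x * deriv a x) / (a x * a x)" if "0 < x" for x
    using D[OF that] by (rule DERIV_imp_deriv)
  ultimately show "continuous_on {0<..} (deriv Phi)"
    by (subst continuous_on_cong[OF refl]) auto
qed

lemma abs_Phi'_cont: "continuous_on {0<..} (\<lambda>r. \<bar>deriv Phi r\<bar>)"
  by (intro continuous_intros Phi'_cont)

lemma abs_Phi'_L1: "set_integrable lborel {0<..<1} (\<lambda>r. \<bar>deriv Phi r\<bar>)"
  using set_integrable_abs[OF Phi'_L1] by (simp add: Phi_def[abs_def])

lemma Psi_isCont: "isCont Psi y"
proof (cases y "0::real" rule: linorder_cases)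
  case less
  have "\<forall>\<^sub>F u in nhds y. u \<in> {..<0}" using less by (intro eventually_nhds_in_open) auto
  then have "\<forall>\<^sub>F u in nhds y. Psi u = p0" by eventually_elim (simp add: Psi_def)
  then show ?thesis by (subst isCont_cong) auto
next
  case greater
  have "\<forall>\<^sub>F u in nhds y. u \<in> {0<..}" using greater by (intro eventually_nhds_in_open) auto
  then have "\<forall>\<^sub>F u in nhds y. Psi u = Phi (X u)" by eventually_elim (simp add: Psi_def)
  moreover have "isCont (\<lambda>u. Phi (X u)) y"
    using X_isCont_pos[OF greater] DERIV_isCont[OF Phi_deriv[OF X_pos[OF greater]]]
    by (rule isCont_o2)
  ultimately show ?thesis by (subst isCont_cong) auto
next
  case equal
  have "(Psi \<longlongrightarrow> p0) (at_left 0)"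
  proof (rule Lim_transform_eventually[OF tendsto_const])
    have "\<forall>\<^sub>F u in at_left (0::real). u \<in> {..<0}" by (simp add: eventually_at_filter)
    then show "\<forall>\<^sub>F u in at_left 0. p0 = Psi u" by eventually_elim (simp add: Psi_def)
  qed
  moreover have "(Psi \<longlongrightarrow> p0) (at_right 0)"
  proof (rule Lim_transform_eventually)
    have pos: "\<forall>\<^sub>F u in at_right (0::real). 0 < u" by (rule eventually_at_right_less)
    \<comment> \<open>The limit of \<open>b / a\<close> is one-sided, so \<open>X\<close> has to
      approach 0 through positive values.\<close>
    have "filterlim X (at_right 0) (at_right 0)"
      unfolding filterlim_at
    proof
      show "(X \<longlongrightarrow> 0) (at_right 0)"
        by (rule tendsto_mono[OF _ X_tendsto_0]) (simp add: at_within_def)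
      show "\<forall>\<^sub>F u in at_right 0. X u \<in> {0<..} \<and> X u \<noteq> 0"
        using pos by eventually_elim (use X_pos in force)
    qed
    then show "((\<lambda>u. b (X u) / a (X u)) \<longlongrightarrow> p0) (at_right 0)"
      by (rule filterlim_compose[OF Phi_lim])
    show "\<forall>\<^sub>F u in at_right 0. b (X u) / a (X u) = Psi u"
      using pos by eventually_elim (simp add: Psi_def Phi_def)
  qed
  ultimately have "(Psi \<longlongrightarrow> p0) (at 0)" by (simp add: filterlim_at_split)
  then show ?thesis using equal by (simp add: isCont_def Psi_def)
qed

lemma p0_ge_0: "0 \<le> p0"
proof (rule tendsto_lowerbound[OF Phi_lim])
  have "\<forall>\<^sub>F u in at_right (0::real). 0 < u" by (rule eventually_at_right_less)
  then show "\<forall>\<^sub>F x in at_right 0. 0 \<le> b x / a x"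
    by eventually_elim (simp add: a_nonneg b_nonneg)
qed simp

sublocale drift Psi Psi' Var p0 rho
proof
  show "continuous_on UNIV Psi" using Psi_isCont by (simp add: continuous_on_eq_continuous_at)
  show "y \<le> 0 \<Longrightarrow> Psi y = p0" for y by (simp add: Psi_def)
  show "0 \<le> Psi y" for y using p0_ge_0 a_nonneg b_nonneg X_nonneg by (simp add: Psi_def Phi_def)
  have XI: "X ` {0<..} \<subseteq> {0<..}" using X_pos by auto
  show "continuous_on {0<..} Psi'"
    unfolding Psi'_def using XI X_pos
    by (intro continuous_intros continuous_on_compose2[OF Phi'_cont] continuous_on_compose2[OF a_C0]
        continuous_on_subset[OF X_continuous]) (auto simp: X_nonneg)
  show "(Psi has_real_derivative Psi' y) (at y)" if y: "0 < y" for y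
  proof -
    have "\<forall>\<^sub>F u in nhds y. u \<in> {0<..}" using y by (intro eventually_nhds_in_open) auto
    then have ev: "\<forall>\<^sub>F u in nhds y. Phi (X u) = Psi u" by eventually_elim (simp add: Psi_def)
    have "((\<lambda>u. Phi (X u)) has_real_derivative Psi' y) (at y)"
      unfolding Psi'_def by (rule DERIV_chain2[OF Phi_deriv[OF X_pos[OF y]] X_deriv[OF y]])
    then show ?thesis using ev by (simp add: DERIV_cong_ev)
  qed
  show "continuous_on UNIV Var"
    unfolding Var_def
    by (rule continuous_on_compose2[OF primitive_continuous[OF abs_Phi'_cont abs_Phi'_L1] X_continuous])
       (auto simp: X_nonneg)
  show "y \<le> 0 \<Longrightarrow> Var y = 0" for y by (simp add: Var_def)
  show "(Var has_real_derivative \<bar>Psi' y\<bar>) (at y)" if y: "0 < y" for y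
  proof -
    have "(Var has_real_derivative \<bar>deriv Phi (X y)\<bar> * a (X y)) (at y)"
      unfolding Var_def
      by (rule DERIV_chain2[OF primitive_deriv[OF abs_Phi'_cont abs_Phi'_L1 X_pos[OF y]] X_deriv[OF y]])
    also have "\<bar>deriv Phi (X y)\<bar> * a (X y) = \<bar>Psi' y\<bar>"
      using a_nonneg[OF X_nonneg] by (simp add: Psi'_def abs_mult)
    finally show ?thesis .
  qed
qed

end

section \<open>Particles labelled by initial position or entrance time\<close>

locale ls_data = ls_coeff +
  fixes n fin :: "real \<Rightarrow> real"
  assumes n_cont: "continuous_on {p0..} n" and n_nonneg: "p0 \<le> x \<Longrightarrow> 0 \<le> n x"
    and fin_nonneg: "0 < x \<Longrightarrow> 0 \<le> fin x"
    and fin_L1: "set_integrable lborel {0<..} (\<lambda>x. (1 + x) * fin x)"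
    and uin: "p0 < rho - (LINT x:{0<..}|lborel. x * fin x)"
begin

text \<open>A label \<open>l > 0\<close> is a particle at \<open>x = l\<close> at time \<open>0\<close>; a label \<open>l \<le> 0\<close> is a particle which
  enters through \<open>x = 0\<close> at time \<open>- l\<close>, and \<open>zeta v l\<close> is the point of the extended line
  from which it starts at time \<open>0\<close>.\<close>
definition zeta :: "(real \<Rightarrow> real) \<Rightarrow> real \<Rightarrow> real" where
  "zeta v l = (if 0 \<le> l then A l else - integral {0..- l} (\<lambda>s. v s - p0))"

definition Q :: "(real \<Rightarrow> real) \<Rightarrow> real \<Rightarrow> real \<Rightarrow> real" where
  "Q v t l = X (flow v (zeta v l) t)"

text \<open>Number of particles per unit of label. No Jacobian occurs: a negative label is an
  entrance time, and \<open>n\<close> is the rate of entrance per unit of time.\<close>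

definition wt :: "(real \<Rightarrow> real) \<Rightarrow> real \<Rightarrow> real" where
  "wt v l = (if 0 < l then fin l else n (v (- l)))"

text \<open>The derivative in the label, as the limit of one sequence of quotients: joint Borel
  measurability in time and label is then immediate, and the value is the derivative wherever that
  exists. The increments are positive, so only labels to the right of \<open>l\<close> are
  used.\<close>

definition Qd :: "(real \<Rightarrow> real) \<Rightarrow> real \<Rightarrow> real \<Rightarrow> real" where
  "Qd v t l = lim (\<lambda>k. (Q v t (l + inverse (real (Suc k))) - Q v t l) / inverse (real (Suc k)))"

definition lab :: "(real \<Rightarrow> real) \<Rightarrow> real \<Rightarrow> real \<Rightarrow> real" where
  "lab v t x = (THE l. - t < l \<and> Q v t l = x)"

text \<open>The density of the image of the measure \<open>m l dl\<close> on \<open>{- t<..}\<close> under the positions \<open>Q v t\<close>.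
  The value at the label \<open>0\<close>, where \<open>Qd\<close> need not be a derivative, is set to \<open>0\<close>.\<close>
definition push :: "(real \<Rightarrow> real) \<Rightarrow> (real \<Rightarrow> real) \<Rightarrow> real \<Rightarrow> real \<Rightarrow> real" where
  "push v m t x = (if lab v t x = 0 then 0 else m (lab v t x) / Qd v t (lab v t x))"

abbreviation dens :: "(real \<Rightarrow> real) \<Rightarrow> real \<Rightarrow> real \<Rightarrow> real" where
  "dens v \<equiv> push v (wt v)"

section \<open>Entrance, particle positions and their growth\<close>

lemma entry_deriv:
  assumes "adm v" "0 < t"
  shows "((\<lambda>t. integral {0..t} (\<lambda>s. v s - p0)) has_real_derivative v t - p0) (at t)"
proof -
  have c: "continuous_on {0..t+1} (\<lambda>s. v s - p0)" by (intro continuous_intros admD(1)[OF assms(1)])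
  have "((\<lambda>t. integral {0..t} (\<lambda>s. v s - p0)) has_real_derivative v t - p0) (at t within {0..t+1})"
    using assms by (intro integral_has_real_derivative[OF c]) auto
  moreover have "at t within {0..t+1} = at t" using assms by (intro at_within_interior) auto
  ultimately show ?thesis by simp
qed

lemma entry_continuous:
  assumes "adm v" shows "continuous_on UNIV (\<lambda>t. integral {0..t} (\<lambda>s. v s - p0))"
  by (intro continuous_on_integral_upper continuous_intros admD(1)[OF assms])

lemma entry_strict_mono:
  assumes v: "adm v" and st: "0 \<le> s" "s < t"
  shows "integral {0..s} (\<lambda>s. v s - p0) < integral {0..t} (\<lambda>s. v s - p0)"
proof (rule DERIV_pos_imp_increasing_open[OF st(2)])
  show "\<exists>y. ((\<lambda>t. integral {0..t} (\<lambda>s. v s - p0)) has_real_derivative y) (at x) \<and> 0 < y" if "s < x" "x < t" for x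
    using entry_deriv[OF v, of x] admD(2)[OF v, of x] that st by (intro exI[of _ "v x - p0"]) auto
qed (rule continuous_on_subset[OF entry_continuous[OF v]], simp)

lemma zeta_0 [simp]: "zeta v 0 = 0" by (simp add: zeta_def)

lemma zeta_nonpos: "l \<le> 0 \<Longrightarrow> zeta v l = - integral {0..- l} (\<lambda>s. v s - p0)"
  by (auto simp: zeta_def)

lemma zeta_pos: "0 \<le> l \<Longrightarrow> zeta v l = A l"
  by (auto simp: zeta_def)

lemma zeta_neg: "adm v \<Longrightarrow> l < 0 \<Longrightarrow> zeta v l < 0"
  using entry_strict_mono[of v 0 "- l"] by (simp add: zeta_nonpos)

lemma zeta_strict_mono:
  assumes v: "adm v" and l: "l1 < l2" shows "zeta v l1 < zeta v l2"
proof -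
  consider "0 \<le> l1" | "l2 \<le> 0" | "l1 < 0" "0 < l2" by linarith
  then show ?thesis
  proof cases
    case 1 then show ?thesis using A_strict_mono[of l1 l2] l by (simp add: zeta_pos)
  next
    case 2 then show ?thesis using entry_strict_mono[OF v, of "- l2" "- l1"] l by (simp add: zeta_nonpos)
  next
    case 3 then show ?thesis using zeta_neg[OF v 3(1)] A_pos[of l2] by (simp add: zeta_pos)
  qed
qed

lemma zeta_continuous:
  assumes v: "adm v" shows "continuous_on UNIV (zeta v)"
proof -
  have "continuous_on ({..0} \<union> {0..}) (zeta v)"
  proof (rule continuous_on_closed_Un)
    have "continuous_on {..0} (\<lambda>l. - integral {0..- l} (\<lambda>s. v s - p0))"
      by (intro continuous_intros continuous_on_compose2[OF entry_continuous[OF v]]) auto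
    then show "continuous_on {..0} (zeta v)"
      by (subst continuous_on_cong[OF refl]) (auto simp: zeta_nonpos)
    show "continuous_on {0..} (zeta v)"
      using A_continuous by (subst continuous_on_cong[OF refl]) (auto simp: zeta_pos)
  qed auto
  moreover have "{..0} \<union> {0..} = (UNIV :: real set)" by auto
  ultimately show ?thesis by simp
qed

lemma zeta_deriv_pos: "0 < l \<Longrightarrow> (zeta v has_real_derivative 1 / a l) (at l)"
proof -
  assume l: "0 < l"
  have "\<forall>\<^sub>F u in nhds l. u \<in> {0<..}" using l by (intro eventually_nhds_in_open) auto
  then have "\<forall>\<^sub>F u in nhds l. A u = zeta v u" by eventually_elim (simp add: zeta_pos)
  with A_deriv[OF l] show ?thesis by (simp add: DERIV_cong_ev)
qed

lemma zeta_deriv_neg: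
  assumes v: "adm v" and l: "l < 0" shows "(zeta v has_real_derivative v (- l) - p0) (at l)"
proof -
  have "((\<lambda>u. integral {0..- u} (\<lambda>s. v s - p0)) has_real_derivative (v (- l) - p0) * - 1) (at l)"
    using l by (intro DERIV_chain2[OF entry_deriv[OF v]]) (auto intro!: derivative_eq_intros)
  from DERIV_minus[OF this]
  have 1: "((\<lambda>u. - integral {0..- u} (\<lambda>s. v s - p0)) has_real_derivative v (- l) - p0) (at l)" by simp
  have "\<forall>\<^sub>F u in nhds l. u \<in> {..<0}" using l by (intro eventually_nhds_in_open) auto
  then have "\<forall>\<^sub>F u in nhds l. - integral {0..- u} (\<lambda>s. v s - p0) = zeta v u"
    by eventually_elim (simp add: zeta_nonpos)
  with 1 show ?thesis by (simp add: DERIV_cong_ev)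
qed

text \<open>Left of 0 the drift is exactly \<open>v - p0\<close>, so the trajectory is explicit;
  \<open>zeta\<close> is chosen such that it arrives at 0 at time \<open>- l\<close>.\<close>

lemma flow_before_entry:
  assumes v: "adm v" and t: "0 \<le> t" "t \<le> - l"
  shows "flow v (zeta v l) t = integral {0..t} (\<lambda>s. v s - p0) - integral {0..- l} (\<lambda>s. v s - p0)"
proof (rule flow_unique[OF v _ t])
  have l: "l \<le> 0" using t by simp
  let ?y = "\<lambda>t. integral {0..t} (\<lambda>s. v s - p0) - integral {0..- l} (\<lambda>s. v s - p0)"
  have "(?y has_real_derivative v r - Psi (?y r)) (at r)" if r: "0 < r" "r < - l" for r
  proof -
    have "?y r \<le> 0" using entry_strict_mono[OF v, of r "- l"] r by simp
    then have "Psi (?y r) = p0" by (rule Psi_le0)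
    then show ?thesis using entry_deriv[OF v r(1)] by (auto intro!: derivative_eq_intros)
  qed
  then show "sol v (zeta v l) (- l) ?y"
    using l by (auto simp: sol_def zeta_nonpos intro!: continuous_intros continuous_on_subset[OF entry_continuous[OF v]])
qed

lemma flow_at_entry: "adm v \<Longrightarrow> l \<le> 0 \<Longrightarrow> flow v (zeta v l) (- l) = 0"
  using flow_before_entry[of v "- l" l] by simp

lemma flow_not_entered: "adm v \<Longrightarrow> 0 \<le> t \<Longrightarrow> l \<le> - t \<Longrightarrow> flow v (zeta v l) t \<le> 0"
  using flow_before_entry[of v t l] entry_strict_mono[of v t "- l"] by (cases "t = - l") auto

text \<open>At time \<open>?s\<close> the particle is at a point \<ge> 0. If it were at a point
  \<le> 0 at time \<open>t\<close>, it would have spent the time since \<open>?s\<close> in the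
  strip and gained \<open>3 * d * (t - ?s)\<close>.\<close>

lemma flow_entered:
  assumes v: "adm v" and t: "0 \<le> t" "- t < l"
  shows "0 < flow v (zeta v l) t"
proof (rule ccontr)
  assume neg: "\<not> 0 < flow v (zeta v l) t"
  obtain d eta where st: "strip v d eta" using strip_exists[OF v zero_less_one] by blast
  then have d: "0 < d" "0 < eta" by (auto simp: strip_def)
  let ?s = "max 0 (- l)"
  have "flow v (zeta v l) ?s + 3 * d * (t - ?s) \<le> flow v (zeta v l) t"
    using sol_strip_increase[OF v flow_sol[OF v t(1)] st, of ?s t "zeta v l"] t neg d by auto
  moreover have "0 \<le> flow v (zeta v l) ?s" "0 < flow v (zeta v l) ?s \<or> ?s < t"
  proof -
    show "0 \<le> flow v (zeta v l) ?s"
      using flow_at_entry[OF v, of l] A_nonneg[of l] v by (cases "l \<le> 0") (auto simp: zeta_pos)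
    show "0 < flow v (zeta v l) ?s \<or> ?s < t"
      using t A_pos[of l] v by (cases "0 < l") (auto simp: zeta_pos)
  qed
  ultimately show False using neg d t by (smt (verit) mult_pos_pos mult_nonneg_nonneg)
qed

lemma Q_nonneg: "0 \<le> Q v t l" by (simp add: Q_def X_nonneg)

lemma Q_eq_0: "adm v \<Longrightarrow> 0 \<le> t \<Longrightarrow> l \<le> - t \<Longrightarrow> Q v t l = 0"
  using flow_not_entered by (simp add: Q_def)

lemma Q_pos: "adm v \<Longrightarrow> 0 \<le> t \<Longrightarrow> - t < l \<Longrightarrow> 0 < Q v t l"
  using flow_entered X_pos by (simp add: Q_def)

lemma Q_start: "adm v \<Longrightarrow> Q v (max 0 (- l)) l = max l 0"
  using flow_at_entry[of v l] by (cases "0 \<le> l") (auto simp: Q_def zeta_pos)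

lemma A_Q: "adm v \<Longrightarrow> 0 \<le> t \<Longrightarrow> - t < l \<Longrightarrow> A (Q v t l) = flow v (zeta v l) t"
  using flow_entered[of v t l] by (simp add: Q_def A_X)

lemma Q_time_deriv:
  assumes v: "adm v" and t: "max 0 (- l) < t"
  shows "((\<lambda>t. Q v t l) has_real_derivative a (Q v t l) * v t - b (Q v t l)) (at t)"
proof -
  have pos: "0 < flow v (zeta v l) t" using t by (intro flow_entered[OF v]) auto
  have t0: "0 < t" using t by simp
  have "((\<lambda>t. Q v t l) has_real_derivative a (Q v t l) * (v t - Psi (flow v (zeta v l) t))) (at t)"
    unfolding Q_def by (rule DERIV_chain2[OF X_deriv[OF pos] flow_deriv[OF v t0]])
  also have "a (Q v t l) * (v t - Psi (flow v (zeta v l) t)) = a (Q v t l) * v t - b (Q v t l)"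
    using pos a_pos[OF X_pos[OF pos]] by (simp add: Psi_def Phi_def Q_def field_simps)
  finally show ?thesis .
qed

lemma Q_time_continuous: "adm v \<Longrightarrow> continuous_on {0..} (\<lambda>t. Q v t l)"
  unfolding Q_def by (intro continuous_on_compose2[OF X_continuous flow_continuous]) auto

lemma Q_jointly_continuous:
  assumes "adm v" shows "continuous_on UNIV (\<lambda>p. Q v (max 0 (fst p)) (snd p))"
proof -
  have "continuous_on UNIV ((\<lambda>p. flow v (snd p) (max 0 (fst p))) \<circ> (\<lambda>p. (fst p, zeta v (snd p))))"
    by (intro continuous_on_compose continuous_intros continuous_on_compose2[OF zeta_continuous[OF assms]]
        continuous_on_subset[OF flow_jointly_continuous[OF assms]]) auto
  then show ?thesis unfolding Q_def o_def fst_conv snd_conv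
    by (intro continuous_on_compose2[OF X_continuous]) auto
qed

lemma Q_label_continuous: "adm v \<Longrightarrow> 0 \<le> t \<Longrightarrow> continuous_on S (Q v t)"
  using continuous_on_compose2[OF Q_jointly_continuous, of v S "\<lambda>l. (t, l)"]
  by (simp add: max_def continuous_on_Pair)

text \<open>Fixed once for \<open>a\<close>, \<open>b\<close> and \<open>rho\<close>, and thus
  independent of the velocity: all a priori bounds inherit this uniformity.\<close>

definition rate :: real where
  "rate = (SOME C. 0 < C \<and> (\<forall>x\<ge>0. \<forall>u. 0 \<le> u \<and> u \<le> rho \<longrightarrow> \<bar>a x * u - b x\<bar> \<le> C * (1 + x)))"

lemma rate: "0 < rate" "0 \<le> x \<Longrightarrow> adm v \<Longrightarrow> \<bar>a x * v t - b x\<bar> \<le> rate * (1 + x)"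
proof -
  obtain C where C: "0 < C" "\<And>x. 0 \<le> x \<Longrightarrow> a x \<le> C * (1 + x)" "\<And>x. 0 \<le> x \<Longrightarrow> b x \<le> C * (1 + x)"
    by (rule growth) blast
  have "\<bar>a x * u - b x\<bar> \<le> (C * \<bar>rho\<bar> + C) * (1 + x)" if "0 \<le> x" "0 \<le> u" "u \<le> rho" for x u
  proof -
    have "a x * u \<le> (C * (1 + x)) * rho"
      using C that a_nonneg[of x] by (intro mult_mono) auto
    moreover have "0 \<le> a x * u" using a_nonneg that by simp
    moreover have "0 \<le> C * (1 + x) * rho" "0 \<le> C * (1 + x)" using C that by auto
    ultimately show ?thesis using C(3)[of x] b_nonneg[of x] that by (simp add: algebra_simps abs_le_iff)
  qed
  moreover have "0 < C * \<bar>rho\<bar> + C" using C(1) by (simp add: add_nonneg_pos)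
  ultimately have ex: "\<exists>C. 0 < C \<and> (\<forall>x\<ge>0. \<forall>u. 0 \<le> u \<and> u \<le> rho \<longrightarrow> \<bar>a x * u - b x\<bar> \<le> C * (1 + x))" by blast
  from someI_ex[OF this, folded rate_def]
  show "0 < rate" "0 \<le> x \<Longrightarrow> adm v \<Longrightarrow> \<bar>a x * v t - b x\<bar> \<le> rate * (1 + x)"
    using admD(2,3)[of v t] p0_ge_0 by (auto dest: order_less_imp_le)
qed

text \<open>Linear growth of the coefficients in \<open>x\<close> becomes a constant speed for
  \<open>ln (1 + x)\<close>; the exponential bounds on positions are this estimate
  exponentiated.\<close>

lemma Q_log_rate:
  assumes v: "adm v" and st: "max 0 (- l) \<le> s" "s \<le> t"
  shows "\<bar>ln (1 + Q v t l) - ln (1 + Q v s l)\<bar> \<le> rate * (t - s)"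
proof -
  have der: "\<exists>e. ((\<lambda>r. ln (1 + Q v r l)) has_real_derivative e) (at r) \<and> \<bar>e\<bar> \<le> rate" if r: "s < r" "r < t" for r
  proof -
    have "((\<lambda>r. ln (1 + Q v r l)) has_real_derivative (a (Q v r l) * v r - b (Q v r l)) / (1 + Q v r l)) (at r)"
      using Q_nonneg[of v r l] r st
      by (auto intro!: derivative_eq_intros Q_time_deriv[OF v] simp: divide_simps add_pos_nonneg)
    moreover have "\<bar>(a (Q v r l) * v r - b (Q v r l)) / (1 + Q v r l)\<bar> \<le> rate"
      using rate(2)[OF Q_nonneg v, of v r l r] Q_nonneg[of v r l] by (simp add: abs_divide divide_le_eq)
    ultimately show ?thesis by blast
  qed
  have cont: "continuous_on {s..t} (\<lambda>r. ln (1 + Q v r l))"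
    using Q_nonneg st
    by (intro continuous_intros continuous_on_subset[OF Q_time_continuous[OF v]])
       (auto simp: add_nonneg_eq_0_iff)
  have "ln (1 + Q v t l) - rate * t \<le> ln (1 + Q v s l) - rate * s"
  proof (rule DERIV_nonpos_imp_decreasing_open[OF st(2)])
    fix r assume "s < r" "r < t"
    from der[OF this] obtain e where e: "((\<lambda>r. ln (1 + Q v r l)) has_real_derivative e) (at r)" "\<bar>e\<bar> \<le> rate" by blast
    from DERIV_diff[OF e(1) DERIV_cmult_Id[of rate]] e(2)
    show "\<exists>y. ((\<lambda>r. ln (1 + Q v r l) - rate * r) has_real_derivative y) (at r) \<and> y \<le> 0"
      by (intro exI[of _ "e - rate"]) auto
  qed (intro continuous_intros cont)
  moreover have "ln (1 + Q v s l) + rate * s \<le> ln (1 + Q v t l) + rate * t"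
  proof (rule DERIV_nonneg_imp_increasing_open[OF st(2)])
    fix r assume "s < r" "r < t"
    from der[OF this] obtain e where e: "((\<lambda>r. ln (1 + Q v r l)) has_real_derivative e) (at r)" "\<bar>e\<bar> \<le> rate" by blast
    from DERIV_add[OF e(1) DERIV_cmult_Id[of rate]] e(2)
    show "\<exists>y. ((\<lambda>r. ln (1 + Q v r l) + rate * r) has_real_derivative y) (at r) \<and> 0 \<le> y"
      by (intro exI[of _ "e + rate"]) auto
  qed (intro continuous_intros cont)
  ultimately show ?thesis by (simp add: abs_le_iff algebra_simps)
qed

lemma Q_upper:
  assumes v: "adm v" and t: "0 \<le> t"
  shows "1 + Q v t l \<le> (1 + max l 0) * exp (rate * t)"
proof (cases "max 0 (- l) \<le> t")
  case True
  let ?s = "max 0 (- l)"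
  have "ln (1 + Q v t l) \<le> ln (1 + max l 0) + rate * (t - ?s)"
    using Q_log_rate[OF v order_refl True] Q_start[OF v, of l] by simp
  also have "\<dots> \<le> ln (1 + max l 0) + rate * t" using rate(1) by simp
  finally have "exp (ln (1 + Q v t l)) \<le> exp (ln (1 + max l 0) + rate * t)" by simp
  then show ?thesis using Q_nonneg[of v t l] by (simp add: exp_add add_pos_nonneg)
next
  case False
  then have "Q v t l = 0" using t by (intro Q_eq_0[OF v]) auto
  moreover have "1 \<le> exp (rate * t)" using rate(1) t by simp
  moreover have "exp (rate * t) \<le> (1 + max l 0) * exp (rate * t)" by simp
  ultimately show ?thesis by linarith
qed

lemma Q_lower:
  assumes v: "adm v" and t: "0 \<le> t" and l: "0 \<le> l"
  shows "(1 + l) * exp (- rate * t) \<le> 1 + Q v t l"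
proof -
  have "ln (1 + l) + - rate * t \<le> ln (1 + Q v t l)"
    using Q_log_rate[OF v, of l 0 t] Q_start[OF v, of l] t l by simp
  then have "exp (ln (1 + l) + - rate * t) \<le> exp (ln (1 + Q v t l))" by (simp only: exp_le_cancel_iff)
  then show ?thesis using Q_nonneg[of v t l] l unfolding exp_add by (simp add: add_pos_nonneg)
qed

lemma Q_rate:
  assumes v: "adm v" and "0 \<le> s" "0 \<le> t" "s \<le> N" "t \<le> N"
  shows "\<bar>Q v t l - Q v s l\<bar> \<le> rate * (1 + max l 0) * exp (rate * N) * \<bar>t - s\<bar>"
proof -
  let ?c = "rate * (1 + max l 0) * exp (rate * N)"
  have c: "0 \<le> ?c" using rate(1) by simp
  have der: "\<bar>a (Q v r l) * v r - b (Q v r l)\<bar> \<le> ?c" if "0 \<le> r" "r \<le> N" for r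
  proof -
    have "\<bar>a (Q v r l) * v r - b (Q v r l)\<bar> \<le> rate * (1 + Q v r l)" by (rule rate(2)[OF Q_nonneg v])
    also have "\<dots> \<le> rate * ((1 + max l 0) * exp (rate * r))"
      using rate(1) Q_upper[OF v that(1)] by (intro mult_left_mono) auto
    also have "\<dots> \<le> rate * ((1 + max l 0) * exp (rate * N))"
      using rate(1) that by (intro mult_left_mono) auto
    finally show ?thesis by (simp add: mult.assoc)
  qed
  have late: "\<bar>Q v t l - Q v s l\<bar> \<le> ?c * (t - s)" if st: "max 0 (- l) \<le> s" "s \<le> t" "t \<le> N" for s t
  proof -
    have cont: "continuous_on {s..t} (\<lambda>r. Q v r l)"
      using st by (intro continuous_on_subset[OF Q_time_continuous[OF v]]) auto
    have "Q v t l - ?c * t \<le> Q v s l - ?c * s"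
    proof (rule DERIV_nonpos_imp_decreasing_open[OF st(2)])
      fix r assume r: "s < r" "r < t"
      have "((\<lambda>r. Q v r l - ?c * r) has_real_derivative a (Q v r l) * v r - b (Q v r l) - ?c) (at r)"
        using r st by (intro DERIV_diff DERIV_cmult_Id Q_time_deriv[OF v]) auto
      then show "\<exists>y. ((\<lambda>r. Q v r l - ?c * r) has_real_derivative y) (at r) \<and> y \<le> 0"
        using der[of r] r st by (intro exI conjI) (assumption, auto)
    qed (intro continuous_intros cont)
    moreover have "Q v s l + ?c * s \<le> Q v t l + ?c * t"
    proof (rule DERIV_nonneg_imp_increasing_open[OF st(2)])
      fix r assume r: "s < r" "r < t"
      have "((\<lambda>r. Q v r l + ?c * r) has_real_derivative a (Q v r l) * v r - b (Q v r l) + ?c) (at r)"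
        using r st by (intro DERIV_add DERIV_cmult_Id Q_time_deriv[OF v]) auto
      then show "\<exists>y. ((\<lambda>r. Q v r l + ?c * r) has_real_derivative y) (at r) \<and> 0 \<le> y"
        using der[of r] r st by (intro exI conjI) (assumption, auto)
    qed (intro continuous_intros cont)
    ultimately show ?thesis by (simp add: abs_le_iff right_diff_distrib)
  qed
  have ord: "\<bar>Q v t l - Q v s l\<bar> \<le> ?c * (t - s)" if st: "0 \<le> s" "s \<le> t" "t \<le> N" for s t
  proof (cases "max 0 (- l) \<le> t")
    case False
    then have "Q v t l = 0" "Q v s l = 0" using st by (auto intro!: Q_eq_0[OF v])
    then show ?thesis using c st by simp
  next
    case True
    let ?s = "max s (max 0 (- l))"
    have "Q v s l = Q v ?s l"
    proof (cases "- l \<le> s")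
      case False
      then have "Q v s l = 0" "Q v (- l) l = 0" "?s = - l" using st by (auto intro!: Q_eq_0[OF v])
      then show ?thesis by simp
    qed (use st in \<open>simp add: max_def\<close>)
    moreover have "\<bar>Q v t l - Q v ?s l\<bar> \<le> ?c * (t - ?s)" using True st by (intro late) auto
    moreover have "?c * (t - ?s) \<le> ?c * (t - s)" using c by (intro mult_left_mono) auto
    ultimately show ?thesis by simp
  qed
  show ?thesis
  proof (cases "s \<le> t")
    case True then show ?thesis using ord[of s t] assms by simp
  next
    case False then show ?thesis using ord[of t s] assms by (simp add: abs_minus_commute)
  qed
qed

lemma Q_strict_mono:
  assumes v: "adm v" and t: "0 \<le> t" and l: "l1 < l2" "- t < l2"
  shows "Q v t l1 < Q v t l2"
proof (cases "l1 \<le> - t")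
  case True then show ?thesis using Q_eq_0[OF v t] Q_pos[OF v t l(2)] by simp
next
  case False
  then show ?thesis unfolding Q_def using flow_entered[OF v t, of l1]
    by (intro X_strict_mono flow_mono_strict[OF v] zeta_strict_mono[OF v] l t) auto
qed

lemma Q_mono: "adm v \<Longrightarrow> 0 \<le> t \<Longrightarrow> l1 \<le> l2 \<Longrightarrow> Q v t l1 \<le> Q v t l2"
  using Q_strict_mono[of v t l1 l2] Q_eq_0[of v t l1] Q_nonneg[of v t l2]
  by (cases "- t < l2") (auto simp: less_eq_real_def)

lemma Q_surj:
  assumes v: "adm v" and t: "0 \<le> t" and x: "0 < x"
  obtains l where "- t < l" "Q v t l = x"
proof -
  \<comment> \<open>Chosen so that the lower bound \<open>(1 + ?m) * exp (- rate * t)\<close> from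
    \<open>Q_lower\<close> exceeds \<open>1 + x\<close>.\<close>
  let ?m = "(1 + x) * exp (rate * t)"
  have "(1 + ?m) * exp (- rate * t) \<le> 1 + Q v t ?m" using x by (intro Q_lower[OF v t]) auto
  moreover have "(1 + ?m) * exp (- rate * t) = exp (- rate * t) + (1 + x)"
    by (simp add: distrib_right mult.assoc exp_add[symmetric])
  ultimately have "x \<le> Q v t ?m" by (smt (verit) exp_gt_zero)
  then have "\<exists>l\<ge>- t. l \<le> ?m \<and> Q v t l = x"
    using x t Q_eq_0[OF v t, of "- t"]
    by (intro IVT' Q_label_continuous[OF v t]) (auto intro: order_trans[of _ 0])
  then obtain l where l: "- t \<le> l" "Q v t l = x" by blast
  have "l \<noteq> - t" using l x Q_eq_0[OF v t, of "- t"] by auto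
  with l show thesis by (intro that[of l]) auto
qed

lemma Q_eq_iff: "adm v \<Longrightarrow> 0 \<le> t \<Longrightarrow> - t < l1 \<Longrightarrow> - t < l2 \<Longrightarrow> Q v t l1 = Q v t l2 \<longleftrightarrow> l1 = l2"
  using Q_strict_mono[of v t l1 l2] Q_strict_mono[of v t l2 l1] by (cases l1 l2 rule: linorder_cases) auto

lemma lab_Q: "adm v \<Longrightarrow> 0 \<le> t \<Longrightarrow> - t < l \<Longrightarrow> lab v t (Q v t l) = l"
  unfolding lab_def by (rule the_equality) (auto simp: Q_eq_iff)

lemma lab:
  assumes "adm v" "0 \<le> t" "0 < x"
  shows "- t < lab v t x" "Q v t (lab v t x) = x"
  using Q_surj[OF assms] lab_Q[OF assms(1,2)] by metis+

text \<open>Expresses the sublevel sets of \<open>lab\<close> through the continuous function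
  \<open>Q\<close>, which makes \<open>lab\<close> jointly measurable.\<close>

lemma lab_less_iff:
  assumes "adm v" "0 \<le> t" "0 < x"
  shows "lab v t x < c \<longleftrightarrow> x < Q v t c"
  using lab[OF assms] Q_strict_mono[OF assms(1,2), of "lab v t x" c] Q_mono[OF assms(1,2), of c "lab v t x"]
  by (metis linorder_not_less order_less_trans)

lemma Qd_eq:
  assumes "((\<lambda>l. Q v t l) has_real_derivative D) (at l)"
  shows "Qd v t l = D"
proof -
  have "filterlim (\<lambda>k. inverse (real (Suc k))) (at 0) sequentially"
    unfolding filterlim_at using LIMSEQ_inverse_real_of_nat by auto
  then have "(\<lambda>k. (Q v t (l + inverse (real (Suc k))) - Q v t l) / inverse (real (Suc k))) \<longlonglongrightarrow> D"
    using assms unfolding DERIV_def by (rule filterlim_compose[rotated])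
  then show ?thesis unfolding Qd_def by (rule limI)
qed

text \<open>The slope \<open>z'\<close> of \<open>zeta\<close> stays abstract, since it is
  \<open>1 / a l\<close> right of 0 and \<open>v (- l) - p0\<close> left of it. The flow derivative
  \<open>J\<close> is exposed because bounds on it yield the density estimate and the boundary
  flux.\<close>

lemma Q_label_deriv:
  assumes v: "adm v" and t: "0 \<le> t" and l: "- t < l"
    and z: "(zeta v has_real_derivative z') (at l)"
  obtains J where "0 < J" "((\<lambda>z. flow v z t) has_real_derivative J) (at (zeta v l))"
    "((\<lambda>l. Q v t l) has_real_derivative a (Q v t l) * (J * z')) (at l)"
    "Qd v t l = a (Q v t l) * (J * z')"
proof -
  obtain J where J: "0 < J" "((\<lambda>z. flow v z t) has_real_derivative J) (at (zeta v l))"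
    using flow_diff_initial[OF v t] by blast
  have "((\<lambda>l. Q v t l) has_real_derivative a (Q v t l) * (J * z')) (at l)"
    unfolding Q_def
    by (rule DERIV_chain2[OF X_deriv[OF flow_entered[OF v t l]] DERIV_chain2[OF J(2) z]])
  with J Qd_eq that show thesis by blast
qed

lemma Qd_pos:
  assumes v: "adm v" and t: "0 \<le> t" and l: "- t < l" "l \<noteq> 0"
  shows "0 < Qd v t l" "((\<lambda>l. Q v t l) has_real_derivative Qd v t l) (at l)"
proof -
  obtain z' where z: "(zeta v has_real_derivative z') (at l)" "0 < z'"
    using zeta_deriv_pos[of l v] zeta_deriv_neg[OF v, of l] a_pos[of l] admD(2)[OF v, of "- l"] l
    by (metis diff_gt_0_iff_gt linorder_neqE_linordered_idom zero_less_divide_1_iff)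
  obtain J where J: "0 < J" "((\<lambda>l. Q v t l) has_real_derivative a (Q v t l) * (J * z')) (at l)"
    "Qd v t l = a (Q v t l) * (J * z')"
    using Q_label_deriv[OF v t l(1) z(1)] by metis
  then show "0 < Qd v t l" "((\<lambda>l. Q v t l) has_real_derivative Qd v t l) (at l)"
    using a_pos[OF Q_pos[OF v t l(1)]] z by auto
qed

end

text \<open>Bridges the change of variables, which is formulated for Lebesgue measure, and the
  integrals over \<open>lborel\<close> in the statement of the problem.\<close>

lemma set_integrable_lebesgue_lborel:
  fixes f :: "real \<Rightarrow> real"
  assumes "(\<lambda>x. indicator S x * f x) \<in> borel_measurable borel"
  shows "set_integrable lebesgue S f \<longleftrightarrow> set_integrable lborel S f"
  unfolding set_integrable_def using assms by (simp add: integrable_completion)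

section \<open>Measurability, change of variables and the mass functional\<close>

context ls_data
begin

lemma fin_meas [measurable]: "(\<lambda>x. indicator {0<..} x * fin x) \<in> borel_measurable borel"
proof -
  have "(\<lambda>x. indicator {0<..} x *\<^sub>R ((1 + x) * fin x)) \<in> borel_measurable borel"
    using fin_L1 unfolding set_integrable_def by (simp add: borel_measurable_integrable)
  then have "(\<lambda>x. (indicator {0<..} x *\<^sub>R ((1 + x) * fin x)) / (1 + x)) \<in> borel_measurable borel"
    by measurable
  also have "(\<lambda>x. (indicator {0<..} x *\<^sub>R ((1 + x) * fin x)) / (1 + x)) = (\<lambda>x. indicator {0<..} x * fin x)"
    by (rule ext) (auto simp: indicator_def)
  finally show ?thesis .
qed

lemma n_comp_cont: "adm v \<Longrightarrow> continuous_on UNIV (\<lambda>l. n (v (- l)))"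
proof -
  assume v: "adm v"
  have "continuous_on UNIV (\<lambda>l. v (- l))"
    by (rule continuous_on_compose2[OF admD(1)[OF v, of UNIV]]) (auto intro!: continuous_intros)
  then show ?thesis
    by (rule continuous_on_compose2[OF n_cont]) (use admD(2)[OF v] in \<open>auto intro: less_imp_le\<close>)
qed

lemma wt_meas: assumes "adm v" shows "wt v \<in> borel_measurable borel"
proof -
  have [measurable]: "(\<lambda>l. n (v (- l))) \<in> borel_measurable borel"
    using n_comp_cont[OF assms] by (rule borel_measurable_continuous_onI)
  have "(\<lambda>l. indicator {0<..} l * fin l + indicator {..0} l * n (v (- l))) \<in> borel_measurable borel"
    by measurable
  also have "(\<lambda>l. indicator {0<..} l * fin l + indicator {..0} l * n (v (- l))) = wt v"
    by (rule ext) (auto simp: indicator_def wt_def)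
  finally show ?thesis .
qed

lemma wt_nonneg: "adm v \<Longrightarrow> 0 \<le> wt v l"
  using admD(2)[of v "- l"] by (simp add: wt_def fin_nonneg n_nonneg)

definition nmax :: real where "nmax = Sup (n ` {p0..rho})"

lemma nmax: "p0 \<le> u \<Longrightarrow> u \<le> rho \<Longrightarrow> n u \<le> nmax"
proof -
  assume u: "p0 \<le> u" "u \<le> rho"
  have "continuous_on {p0..rho} n" by (rule continuous_on_subset[OF n_cont]) auto
  then have "bdd_above (n ` {p0..rho})"
    by (intro bounded_imp_bdd_above compact_imp_bounded compact_continuous_image) auto
  then show "n u \<le> nmax" unfolding nmax_def using u by (intro cSup_upper) auto
qed

text \<open>Free of the velocity. Multiplied by \<open>exp (rate * N)\<close> it dominates
  \<open>(1 + Q v t l) * wt v l\<close> for all admissible \<open>v\<close>, all \<open>t\<close> in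
  \<open>{0..N}\<close> and all \<open>l > - N\<close>.\<close>

definition dom :: "real \<Rightarrow> real \<Rightarrow> real" where
  "dom N l = indicator {0<..} l * ((1 + l) * fin l) + indicator {- N<..0} l * nmax"

lemma dom_integrable: "integrable lborel (dom N)"
proof -
  have "integrable lborel (\<lambda>l. indicator {0<..} l * ((1 + l) * fin l))"
    using fin_L1 unfolding set_integrable_def by simp
  moreover have "integrable lborel (\<lambda>l. indicator {- N<..0} l * nmax)"
    by (intro integrable_mult_left integrable_real_indicator) (cases "- N \<le> 0"; simp)+
  ultimately show ?thesis unfolding dom_def by (rule Bochner_Integration.integrable_add)
qed

lemma dom_bound:
  assumes "adm v" "- N < l"
  shows "(1 + max l 0) * wt v l \<le> dom N l" "0 \<le> dom N l"
proof -
  have "n (v (- l)) \<le> nmax" using admD(2,3)[OF assms(1), of "- l"] by (intro nmax) auto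
  then show 1: "(1 + max l 0) * wt v l \<le> dom N l"
    using assms(2) by (auto simp: dom_def wt_def indicator_def max_def)
  show "0 \<le> dom N l" by (rule order_trans[OF _ 1]) (simp add: wt_nonneg[OF assms(1)])
qed

lemma Q_continuous_pair:
  fixes f g :: "'b::topological_space \<Rightarrow> real"
  assumes "adm v" "continuous_on S f" "continuous_on S g"
  shows "continuous_on S (\<lambda>p. Q v (max 0 (f p)) (g p))"
  using continuous_on_compose2[OF Q_jointly_continuous[OF assms(1)] continuous_on_Pair[OF assms(2,3)]] by simp

lemma lab_meas:
  assumes v: "adm v"
  shows "(\<lambda>p. if 0 \<le> fst p \<and> 0 < snd p then lab v (fst p) (snd p) else 0) \<in> borel_measurable (borel :: (real \<times> real) measure)"
proof (subst borel_measurable_iff_less, rule allI)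
  fix c :: real
  have Qm: "(\<lambda>p::real\<times>real. Q v (max 0 (fst p)) c) \<in> borel_measurable borel"
    by (intro borel_measurable_continuous_onI Q_continuous_pair v continuous_intros)
  have m: "fst \<in> borel_measurable (borel :: (real \<times> real) measure)" "snd \<in> borel_measurable (borel :: (real \<times> real) measure)"
    by (auto intro!: borel_measurable_continuous_onI continuous_intros)
  have "{p \<in> space borel. (if 0 \<le> fst p \<and> 0 < snd p then lab v (fst p) (snd p) else 0) < c} =
    {p \<in> space borel. if 0 \<le> fst p \<and> 0 < snd p then snd p < Q v (max 0 (fst p)) c else 0 < c}"
    using lab_less_iff[OF v] by (auto split: if_splits)
  also have "\<dots> \<in> sets borel" using Qm m by measurable
  finally show "{p \<in> space borel. (if 0 \<le> fst p \<and> 0 < snd p then lab v (fst p) (snd p) else 0) < c} \<in> sets borel" .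
qed

lemma Qd_meas:
  assumes v: "adm v"
  shows "(\<lambda>p. Qd v (max 0 (fst p)) (snd p)) \<in> borel_measurable (borel :: (real \<times> real) measure)"
  unfolding Qd_def
proof (rule borel_measurable_lim_metric)
  fix k
  show "(\<lambda>p. (Q v (max 0 (fst p)) (snd p + inverse (real (Suc k))) - Q v (max 0 (fst p)) (snd p)) / inverse (real (Suc k)))
      \<in> borel_measurable (borel :: (real \<times> real) measure)"
    by (intro borel_measurable_continuous_onI continuous_intros Q_continuous_pair v) auto
qed

lemma push_joint_meas:
  assumes v: "adm v" and m [measurable]: "m \<in> borel_measurable borel"
  shows "(\<lambda>p. indicator ({0..} \<times> {0<..}) p * push v m (fst p) (snd p)) \<in> borel_measurable (borel :: (real \<times> real) measure)"
proof -
  define L where "L p = (if 0 \<le> fst p \<and> 0 < snd p then lab v (fst p) (snd p) else 0)" for p :: "real \<times> real"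
  have L [measurable]: "L \<in> borel_measurable borel" unfolding L_def by (rule lab_meas[OF v])
  have fm [measurable]: "fst \<in> borel_measurable (borel :: (real \<times> real) measure)"
    by (auto intro!: borel_measurable_continuous_onI continuous_intros)
  have "(\<lambda>p. (fst p, L p)) \<in> borel \<rightarrow>\<^sub>M (borel :: (real \<times> real) measure)"
    by (intro borel_measurable_Pair fm L)
  from measurable_compose[OF this Qd_meas[OF v]]
  have [measurable]: "(\<lambda>p. Qd v (max 0 (fst p)) (L p)) \<in> borel_measurable borel" by simp
  have "(\<lambda>p. if L p = 0 then 0 else m (L p) / Qd v (max 0 (fst p)) (L p)) \<in> borel_measurable borel"
    by measurable
  also have "(\<lambda>p. if L p = 0 then 0 else m (L p) / Qd v (max 0 (fst p)) (L p)) =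
      (\<lambda>p. indicator ({0..} \<times> {0<..}) p * push v m (fst p) (snd p))"
    by (rule ext) (auto simp: L_def push_def indicator_def max_def)
  finally show ?thesis .
qed

lemma push_meas:
  assumes v: "adm v" and m: "m \<in> borel_measurable borel" and t: "0 \<le> t"
  shows "(\<lambda>x. indicator {0<..} x * push v m t x) \<in> borel_measurable borel"
proof -
  have "(\<lambda>x. (t, x)) \<in> borel \<rightarrow>\<^sub>M (borel :: (real \<times> real) measure)"
    by (intro borel_measurable_Pair) auto
  from measurable_compose[OF this push_joint_meas[OF v m]] show ?thesis
    using t by (simp add: indicator_def of_bool_def)
qed

lemma dens_nonneg: "adm v \<Longrightarrow> 0 \<le> t \<Longrightarrow> 0 < x \<Longrightarrow> 0 \<le> dens v t x"
  using Qd_pos(1)[of v t "lab v t x"] lab(1)[of v t x] wt_nonneg[of v] by (auto simp: push_def)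

text \<open>The substitution \<open>x = Q v t l\<close>. Label 0, where differentiability may fail,
  and its position are removed first, as null sets. The weight \<open>m\<close> is general because
  later the plain Lebesgue measure on labels is transported as well.\<close>

lemma push_integral:
  fixes k :: "real \<Rightarrow> real"
  assumes v: "adm v" and t: "0 \<le> t" and k [measurable]: "k \<in> borel_measurable borel"
    and m [measurable]: "m \<in> borel_measurable borel"
  shows "set_integrable lborel {0<..} (\<lambda>x. k x * push v m t x) \<longleftrightarrow>
      set_integrable lborel {- t<..} (\<lambda>l. k (Q v t l) * m l)"
    and "(LINT x:{0<..}|lborel. k x * push v m t x) = (LINT l:{- t<..}|lborel. k (Q v t l) * m l)"
proof -
  let ?S = "{- t<..} - {0}" and ?S' = "{0<..} - {Q v t 0}"
  let ?f = "\<lambda>x. k x * push v m t x" and ?g = "\<lambda>l. k (Q v t l) * m l"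
  have [measurable]: "Q v t \<in> borel_measurable borel"
    by (rule borel_measurable_continuous_onI[OF Q_label_continuous[OF v t]])
  have mg: "(\<lambda>l. indicator {- t<..} l * ?g l) \<in> borel_measurable borel" "(\<lambda>l. indicator ?S l * ?g l) \<in> borel_measurable borel"
    by measurable
  note [measurable] = push_meas[OF v m t]
  have mf: "(\<lambda>x. indicator {0<..} x * ?f x) \<in> borel_measurable borel"
  proof -
    have "(\<lambda>x. k x * (indicator {0<..} x * push v m t x)) \<in> borel_measurable borel" by measurable
    then show ?thesis by (simp add: mult_ac)
  qed
  have mf': "(\<lambda>x. indicator ?S' x * ?f x) \<in> borel_measurable borel"
  proof -
    have "(\<lambda>x. indicator ?S' x * (indicator {0<..} x * ?f x)) \<in> borel_measurable borel"
      using mf by measurable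
    moreover have "(\<lambda>x. indicator ?S' x * (indicator {0<..} x * ?f x)) = (\<lambda>x. indicator ?S' x * ?f x)"
      by (rule ext) (auto simp: indicator_def)
    ultimately show ?thesis by simp
  qed
  have img: "Q v t ` ?S = ?S'"
  proof (intro equalityI subsetI)
    fix x assume "x \<in> Q v t ` ?S"
    then obtain l where l: "- t < l" "l \<noteq> 0" "x = Q v t l" by auto
    have "Q v t l \<noteq> Q v t 0"
      using Q_strict_mono[OF v t, of l 0] Q_strict_mono[OF v t, of 0 l] l t
      by (cases "l < 0") auto
    then show "x \<in> ?S'" using Q_pos[OF v t l(1)] l by auto
  next
    fix x assume x: "x \<in> ?S'"
    then obtain l where "- t < l" "Q v t l = x" using Q_surj[OF v t, of x] by auto
    with x show "x \<in> Q v t ` ?S" by auto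
  qed
  have inj: "inj_on (Q v t) ?S" by (rule inj_onI) (auto simp: Q_eq_iff[OF v t])
  have eq: "\<bar>Qd v t l\<bar> * ?f (Q v t l) = ?g l" if "l \<in> ?S" for l
    using that Qd_pos(1)[OF v t, of l] lab_Q[OF v t, of l] by (simp add: push_def)
  \<comment> \<open>The factor \<open>Qd\<close> cancels the denominator in \<open>push\<close>.
    Having the equivalence for every value \<open>c\<close> transfers integrability and the integral
    at once.\<close>
  have cov: "(\<lambda>l. \<bar>Qd v t l\<bar> * ?f (Q v t l)) absolutely_integrable_on ?S \<and>
      integral ?S (\<lambda>l. \<bar>Qd v t l\<bar> * ?f (Q v t l)) = c
     \<longleftrightarrow> ?f absolutely_integrable_on (Q v t ` ?S) \<and> integral (Q v t ` ?S) ?f = c" for c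
  proof (rule has_absolute_integral_change_of_variables_1'[where f = ?f, OF _ _ inj])
    show "(Q v t has_real_derivative Qd v t l) (at l within ?S)" if "l \<in> ?S" for l
      using that by (intro has_field_derivative_at_within[OF Qd_pos(2)[OF v t]]) auto
  qed simp
  have "?g absolutely_integrable_on ?S \<longleftrightarrow> (\<lambda>l. \<bar>Qd v t l\<bar> * ?f (Q v t l)) absolutely_integrable_on ?S"
    by (rule set_integrable_cong[OF refl refl eq[symmetric]])
  moreover have "integral ?S ?g = integral ?S (\<lambda>l. \<bar>Qd v t l\<bar> * ?f (Q v t l))"
    by (rule integral_cong[OF eq[symmetric]])
  ultimately have cov': "?g absolutely_integrable_on ?S \<and> integral ?S ?g = c
     \<longleftrightarrow> ?f absolutely_integrable_on ?S' \<and> integral ?S' ?f = c" for c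
    using cov[of c] unfolding img by simp
  have g_ae: "AE l in lborel. indicator {- t<..} l * ?g l = indicator ?S l * ?g l"
    using AE_lborel_singleton[of 0] by eventually_elim (auto simp: indicator_def)
  have f_ae: "AE x in lborel. indicator {0<..} x * ?f x = indicator ?S' x * ?f x"
    using AE_lborel_singleton[of "Q v t 0"] by eventually_elim (auto simp: indicator_def)
  have ig: "set_integrable lborel {- t<..} ?g \<longleftrightarrow> ?g absolutely_integrable_on ?S"
    unfolding set_integrable_lebesgue_lborel[OF mg(2)] unfolding set_integrable_def
    using mg g_ae by (intro integrable_cong_AE) auto
  have if': "set_integrable lborel {0<..} ?f \<longleftrightarrow> ?f absolutely_integrable_on ?S'"
    unfolding set_integrable_lebesgue_lborel[OF mf'] unfolding set_integrable_def
    using mf mf' f_ae by (intro integrable_cong_AE) auto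
  show iff: "set_integrable lborel {0<..} ?f \<longleftrightarrow> set_integrable lborel {- t<..} ?g"
    unfolding ig if' using cov' by blast
  \<comment> \<open>Without integrability both sides are 0 by convention, so the equation holds
    unconditionally.\<close>
  show "(LINT x:{0<..}|lborel. ?f x) = (LINT l:{- t<..}|lborel. ?g l)"
  proof (cases "set_integrable lborel {0<..} ?f")
    case False
    with iff have "\<not> set_integrable lborel {- t<..} ?g" by simp
    with False show ?thesis
      unfolding set_integrable_def set_lebesgue_integral_def by (simp add: not_integrable_integral_eq)
  next
    case True
    have "(LINT x:{0<..}|lborel. ?f x) = (LINT x:?S'|lborel. ?f x)"
      unfolding set_lebesgue_integral_def using mf mf' f_ae by (intro integral_cong_AE) auto
    also have "\<dots> = integral ?S' ?f"
      using True unfolding if' set_integrable_lebesgue_lborel[OF mf'] by (rule set_borel_integral_eq_integral(2))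
    also have "\<dots> = integral ?S ?g" using cov'[of "integral ?S' ?f"] True unfolding if' by simp
    also have "\<dots> = (LINT l:?S|lborel. ?g l)"
      using True unfolding iff ig set_integrable_lebesgue_lborel[OF mg(2)]
      by (rule set_borel_integral_eq_integral(2)[symmetric])
    also have "\<dots> = (LINT l:{- t<..}|lborel. ?g l)"
      unfolding set_lebesgue_integral_def using mg g_ae by (intro integral_cong_AE) auto
    finally show ?thesis .
  qed
qed

lemma pushforward:
  fixes k :: "real \<Rightarrow> real"
  assumes "adm v" "0 \<le> t" "k \<in> borel_measurable borel"
  shows "set_integrable lborel {0<..} (\<lambda>x. k x * dens v t x) \<longleftrightarrow>
      set_integrable lborel {- t<..} (\<lambda>l. k (Q v t l) * wt v l)"
    and "(LINT x:{0<..}|lborel. k x * dens v t x) = (LINT l:{- t<..}|lborel. k (Q v t l) * wt v l)"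
  by (rule push_integral[OF assms wt_meas[OF assms(1)]])+

lemma weighted_bound:
  assumes v: "adm v" and t: "0 \<le> t" "t \<le> N" and l: "- N < l"
  shows "(1 + Q v t l) * wt v l \<le> exp (rate * N) * dom N l"
proof -
  have "(1 + Q v t l) * wt v l \<le> ((1 + max l 0) * exp (rate * t)) * wt v l"
    by (intro mult_right_mono Q_upper v t wt_nonneg)
  also have "\<dots> \<le> ((1 + max l 0) * exp (rate * N)) * wt v l"
    using rate(1) t by (intro mult_right_mono mult_left_mono wt_nonneg v) auto
  also have "\<dots> = exp (rate * N) * ((1 + max l 0) * wt v l)" by simp
  also have "\<dots> \<le> exp (rate * N) * dom N l"
    by (intro mult_left_mono dom_bound v l) auto
  finally show ?thesis .
qed

lemma particle_integrable:
  assumes v: "adm v" and t: "0 \<le> t" "t \<le> N" and k [measurable]: "k \<in> borel_measurable borel"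
    and bound: "\<And>x. 0 \<le> x \<Longrightarrow> \<bar>k x\<bar> \<le> B * (1 + x)"
  shows "set_integrable lborel {- N<..} (\<lambda>l. k (Q v t l) * wt v l)"
proof -
  have [measurable]: "Q v t \<in> borel_measurable borel"
    by (rule borel_measurable_continuous_onI[OF Q_label_continuous[OF v t(1)]])
  have [measurable]: "wt v \<in> borel_measurable borel" by (rule wt_meas[OF v])
  have "0 \<le> B" using bound[of 0] by (simp add: order_trans[OF abs_ge_zero])
  show ?thesis unfolding set_integrable_def
  proof (rule Bochner_Integration.integrable_bound)
    show "integrable lborel (\<lambda>l. (B * exp (rate * N)) * dom N l)"
      by (intro integrable_mult_right dom_integrable)
    show "AE l in lborel. norm (indicator {- N<..} l *\<^sub>R (k (Q v t l) * wt v l)) \<le> norm ((B * exp (rate * N)) * dom N l)"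
    proof (rule AE_I2)
      fix l :: real
      show "norm (indicator {- N<..} l *\<^sub>R (k (Q v t l) * wt v l)) \<le> norm ((B * exp (rate * N)) * dom N l)"
      proof (cases "- N < l")
        case True
        have "\<bar>k (Q v t l) * wt v l\<bar> \<le> (B * (1 + Q v t l)) * wt v l"
          unfolding abs_mult using bound[OF Q_nonneg] wt_nonneg[OF v] by (simp add: mult_right_mono)
        also have "\<dots> \<le> B * (exp (rate * N) * dom N l)"
          unfolding mult.assoc using \<open>0 \<le> B\<close> by (intro mult_left_mono weighted_bound v t True) auto
        also have "\<dots> \<le> \<bar>(B * exp (rate * N)) * dom N l\<bar>" by (simp add: mult.assoc)
        finally show ?thesis using True by simp
      qed simp
    qed
  qed simp
qed

text \<open>The concentration which mass balance leaves when the particles are driven by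
  \<open>v\<close>; a consistent \<open>u\<close> is a fixed point.\<close>

definition Gam :: "(real \<Rightarrow> real) \<Rightarrow> real \<Rightarrow> real" where
  "Gam v t = rho - (LINT l:{- t<..}|lborel. Q v t l * wt v l)"

lemma Gam_dens: "adm v \<Longrightarrow> 0 \<le> t \<Longrightarrow> Gam v t = rho - (LINT x:{0<..}|lborel. x * dens v t x)"
  using pushforward(2)[of v t "\<lambda>x. x"] by (simp add: Gam_def)

text \<open>Labels between \<open>- N\<close> and \<open>- t\<close> sit at position 0, where
  \<open>k\<close> vanishes. The domain of integration can thus be made independent of time.\<close>

lemma particle_domain:
  assumes v: "adm v" and t: "0 \<le> t" "t \<le> N" and k: "k 0 = 0"
  shows "(LINT l:{- t<..}|lborel. k (Q v t l) * wt v l) = (LINT l:{- N<..}|lborel. k (Q v t l) * wt v l)"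
  unfolding set_lebesgue_integral_def
  using t k Q_eq_0[OF v t(1)]
  by (intro Bochner_Integration.integral_cong refl) (auto simp: indicator_def)

lemma Gam_eq: "adm v \<Longrightarrow> 0 \<le> t \<Longrightarrow> t \<le> N \<Longrightarrow> Gam v t = rho - (LINT l:{- N<..}|lborel. Q v t l * wt v l)"
  using particle_domain[of v t N "\<lambda>x. x"] by (simp add: Gam_def)

lemma Gam_le: "adm v \<Longrightarrow> 0 \<le> t \<Longrightarrow> Gam v t \<le> rho"
proof -
  assume v: "adm v"
  have "0 \<le> (LINT l:{- t<..}|lborel. Q v t l * wt v l)"
    unfolding set_lebesgue_integral_def
    by (intro Bochner_Integration.integral_nonneg) (simp add: Q_nonneg wt_nonneg[OF v])
  then show ?thesis by (simp add: Gam_def)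
qed

definition uin where "uin = rho - (LINT x:{0<..}|lborel. x * fin x)"

lemma Gam_0:
  assumes v: "adm v" shows "Gam v 0 = uin"
proof -
  have "Q v 0 l = l" if "0 < l" for l using Q_start[OF v, of l] that by simp
  then have "(LINT l:{0<..}|lborel. Q v 0 l * wt v l) = (LINT x:{0<..}|lborel. x * fin x)"
    by (intro set_lebesgue_integral_cong) (auto simp: wt_def)
  then show ?thesis by (simp add: Gam_def uin_def)
qed

text \<open>The constant does not involve \<open>v\<close>. This is the equicontinuity from which
  the concentration will be extracted.\<close>

lemma Gam_lipschitz:
  assumes v: "adm v" and st: "0 \<le> s" "0 \<le> t" "s \<le> N" "t \<le> N"
  shows "\<bar>Gam v t - Gam v s\<bar> \<le> rate * exp (rate * N) * (LINT l|lborel. dom N l) * \<bar>t - s\<bar>"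
proof -
  have i: "set_integrable lborel {- N<..} (\<lambda>l. Q v r l * wt v l)" if "0 \<le> r" "r \<le> N" for r
    using particle_integrable[OF v that, of "\<lambda>x. x" 1] by simp
  let ?c = "rate * exp (rate * N) * \<bar>t - s\<bar>"
  have e1: "Gam v s - Gam v t = (LINT l:{- N<..}|lborel. Q v t l * wt v l - Q v s l * wt v l)"
    using st by (simp add: Gam_eq[OF v, of _ N] set_integral_diff[OF i i])
  have e2: "norm (LINT l:{- N<..}|lborel. Q v t l * wt v l - Q v s l * wt v l) \<le> (LINT l|lborel. ?c * dom N l)"
    unfolding set_lebesgue_integral_def
  proof (rule Bochner_Integration.integral_norm_bound_integral)
    show "integrable lborel (\<lambda>l. indicator {- N<..} l *\<^sub>R (Q v t l * wt v l - Q v s l * wt v l))"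
      using set_integral_diff(1)[OF i i, of t s] st by (simp add: set_integrable_def)
    show "integrable lborel (\<lambda>l. ?c * dom N l)" by (intro integrable_mult_right dom_integrable)
    fix l :: real
    show "norm (indicator {- N<..} l *\<^sub>R (Q v t l * wt v l - Q v s l * wt v l)) \<le> ?c * dom N l"
    proof (cases "- N < l")
      case True
      have "\<bar>Q v t l * wt v l - Q v s l * wt v l\<bar> = \<bar>Q v t l - Q v s l\<bar> * wt v l"
        using wt_nonneg[OF v] by (simp add: abs_mult left_diff_distrib[symmetric])
      also have "\<dots> \<le> (rate * (1 + max l 0) * exp (rate * N) * \<bar>t - s\<bar>) * wt v l"
        by (intro mult_right_mono Q_rate v st wt_nonneg)
      also have "\<dots> = ?c * ((1 + max l 0) * wt v l)" by simp
      also have "\<dots> \<le> ?c * dom N l"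
        using rate(1) by (intro mult_left_mono dom_bound v True) auto
      finally show ?thesis using True by simp
    next
      case False
      have "0 \<le> dom N l"
        using False st by (auto simp: dom_def indicator_def)
      then show ?thesis using False rate(1) by simp
    qed
  qed
  have e3: "(LINT l|lborel. ?c * dom N l) = ?c * (LINT l|lborel. dom N l)"
    by (rule Bochner_Integration.integral_mult_right_zero)
  have "\<bar>Gam v t - Gam v s\<bar> \<le> ?c * (LINT l|lborel. dom N l)"
    using e2 unfolding e1[symmetric] e3 real_norm_def by (subst abs_minus_commute)
  then show ?thesis by (simp only: mult.assoc mult.commute[of "\<bar>t - s\<bar>"])
qed

lemma causal_particles:
  assumes v: "adm v" and w: "adm w" and t: "0 \<le> t" and eq: "\<And>r. 0 \<le> r \<Longrightarrow> r \<le> t \<Longrightarrow> v r = w r"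
    and l: "- t \<le> l"
  shows "Q v t l = Q w t l" "wt v l = wt w l" "zeta v l = zeta w l"
proof -
  show z: "zeta v l = zeta w l"
    unfolding zeta_def using eq l by (auto intro!: integral_cong)
  show "Q v t l = Q w t l" unfolding Q_def z using flow_causal[OF v w eq t] by simp
  show "wt v l = wt w l" using eq[of "- l"] l by (simp add: wt_def)
qed

lemma causal_Gam:
  assumes v: "adm v" and w: "adm w" and t: "0 \<le> t" and eq: "\<And>r. 0 \<le> r \<Longrightarrow> r \<le> t \<Longrightarrow> v r = w r"
  shows "Gam v t = Gam w t"
proof -
  have "(LINT l:{- t<..}|lborel. Q v t l * wt v l) = (LINT l:{- t<..}|lborel. Q w t l * wt w l)"
    using causal_particles[OF v w t eq] by (intro set_lebesgue_integral_cong) auto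
  then show ?thesis by (simp add: Gam_def)
qed

text \<open>Makes densities computed from velocities that are frozen at different later times agree,
  so that a single \<open>f\<close> can be defined on \<open>[0, T)\<close>.\<close>

lemma causal_dens:
  assumes v: "adm v" and w: "adm w" and t: "0 \<le> t" and eq: "\<And>r. 0 \<le> r \<Longrightarrow> r \<le> t \<Longrightarrow> v r = w r"
    and x: "0 < x"
  shows "dens v t x = dens w t x"
proof -
  note c = causal_particles[OF v w t eq]
  have l: "- t < lab v t x" by (rule lab(1)[OF v t x])
  have "Q w t (lab v t x) = x" using c(1)[of "lab v t x"] l lab(2)[OF v t x] by simp
  then have lab: "lab w t x = lab v t x" using lab_Q[OF w t l] by simp
  \<comment> \<open>All quotients in \<open>Qd\<close> use labels to the right of
    \<open>lab v t x\<close>, which are above \<open>- t\<close> and hence covered by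
    causality.\<close>
  have "Qd v t (lab v t x) = Qd w t (lab v t x)"
    unfolding Qd_def using l by (simp add: c(1) add_increasing2 less_imp_le)
  then show ?thesis using c(2)[of "lab v t x"] l by (simp add: push_def lab)
qed

end

section \<open>Weak continuity\<close>

text \<open>Measurable functions are almost everywhere limits of continuous ones; clipping to
  \<open>[- B, B]\<close> keeps the limit and adds the common bound needed for dominated
  convergence.\<close>

lemma bounded_measurable_approx:
  fixes f :: "real \<Rightarrow> real"
  assumes f: "f \<in> borel_measurable borel" and B: "\<And>x. \<bar>f x\<bar> \<le> B"
  obtains g where "\<And>k. continuous_on UNIV (g k)" "\<And>k x. \<bar>g (k :: nat) x\<bar> \<le> B"
    "AE x in lborel. (\<lambda>k. g k x) \<longlonglongrightarrow> f x"
proof -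
  have "f \<in> borel_measurable lebesgue" using f by (intro measurable_completion) simp
  then have "f measurable_on UNIV" by (simp add: measurable_on_iff_borel_measurable lebesgue_on_UNIV_eq)
  then obtain S h where S: "negligible S" "\<And>k. continuous_on UNIV (h (k :: nat))"
    "\<And>x. x \<notin> S \<Longrightarrow> (\<lambda>k. h k x) \<longlonglongrightarrow> f x"
    unfolding measurable_on_def by auto
  define g where "g k x = max (- B) (min B (h k x))" for k x
  have "0 \<le> B" using B[of 0] by simp
  have "AE x in lebesgue. x \<notin> S" using S(1) by (intro AE_not_in) (simp add: negligible_iff_null_sets)
  then have "AE x in lborel. x \<notin> S" by (simp add: AE_completion_iff)
  then have "AE x in lborel. (\<lambda>k. g k x) \<longlonglongrightarrow> f x"
  proof eventually_elim
    case (elim x)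
    have "(\<lambda>k. g k x) \<longlonglongrightarrow> max (- B) (min B (f x))"
      unfolding g_def by (intro tendsto_intros S(3) elim)
    then show ?case using B[of x] by (simp add: abs_le_iff max_def min_def split: if_splits)
  qed
  moreover have "continuous_on UNIV (g k)" for k
    unfolding g_def by (intro continuous_intros S(2))
  moreover have "\<bar>g k x\<bar> \<le> B" for k x using \<open>0 \<le> B\<close> by (auto simp: g_def)
  ultimately show thesis using that by blast
qed

context ls_data
begin

text \<open>\<open>Qd\<close> is the product of \<open>a (Q v t l)\<close>, the flow derivative and
  the slope of \<open>zeta\<close>; the last two are bounded below. The factor \<open>a\<close> may
  vanish at the boundary and is kept, to be paid for by the integrability of
  \<open>1 / a\<close>.\<close>

lemma Qd_lower:
  assumes v: "adm v" and N: "0 \<le> N" and R: "0 < R"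
  obtains c where "0 < c"
    "\<And>t l. 0 \<le> t \<Longrightarrow> t \<le> N \<Longrightarrow> - t < l \<Longrightarrow> l < R \<Longrightarrow> l \<noteq> 0 \<Longrightarrow> c * a (Q v t l) \<le> Qd v t l"
proof -
  \<comment> \<open>The added 1 leaves room for points slightly to the right of
    \<open>zeta v l\<close> in the difference quotient.\<close>
  let ?Z = "max \<bar>zeta v (- N)\<bar> \<bar>zeta v R\<bar> + 1"
  obtain B where B: "\<And>z1 z2 t. z1 < z2 \<Longrightarrow> \<bar>z1\<bar> \<le> ?Z \<Longrightarrow> \<bar>z2\<bar> \<le> ?Z \<Longrightarrow> 0 \<le> t \<Longrightarrow> t \<le> N \<Longrightarrow>
      exp (- B) * (z2 - z1) \<le> flow v z2 t - flow v z1 t \<and> flow v z2 t - flow v z1 t \<le> exp B * (z2 - z1)"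
    using flow_gap_bound[OF v N, of ?Z] by blast
  define c where "c = exp (- B)"
  have c: "0 < c" "\<And>z1 z2 t. z1 < z2 \<Longrightarrow> \<bar>z1\<bar> \<le> ?Z \<Longrightarrow> \<bar>z2\<bar> \<le> ?Z \<Longrightarrow> 0 \<le> t \<Longrightarrow> t \<le> N \<Longrightarrow>
      c * (z2 - z1) \<le> flow v z2 t - flow v z1 t"
    using B by (auto simp: c_def)
  from v obtain d where d: "0 < d" "\<And>t. p0 + d \<le> v t" by (auto simp: adm_def)
  obtain C where C: "0 < C" "\<And>x. 0 \<le> x \<Longrightarrow> a x \<le> C * (1 + x)" by (rule growth) blast
  \<comment> \<open>A lower bound for the slope of \<open>zeta v\<close> on both sides:
    \<open>v - p0 \<ge> d\<close> for \<open>l < 0\<close>, and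
    \<open>1 / a l \<ge> 1 / (C * (1 + R))\<close> for \<open>0 < l < R\<close>.\<close>
  let ?e = "min d (1 / (C * (1 + R)))"
  have e: "0 < ?e" using d C R by auto
  have "(c * ?e) * a (Q v t l) \<le> Qd v t l"
    if t: "0 \<le> t" "t \<le> N" and l: "- t < l" "l < R" "l \<noteq> 0" for t l
  proof -
    obtain z' where z: "(zeta v has_real_derivative z') (at l)" "?e \<le> z'"
    proof (cases "0 < l")
      case True
      have "a l \<le> C * (1 + l)" using C True by simp
      also have "\<dots> \<le> C * (1 + R)" using C l by (intro mult_left_mono) auto
      finally have "1 / (C * (1 + R)) \<le> 1 / a l" using a_pos[OF True] by (intro divide_left_mono) (auto intro!: mult_pos_pos)
      then have "?e \<le> 1 / a l" by (rule min.coboundedI2)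
      with zeta_deriv_pos[OF True, of v] show thesis by (rule that)
    next
      case False
      then have "l < 0" using l by simp
      have "d \<le> v (- l) - p0" using d(2)[of "- l"] by simp
      then have "?e \<le> v (- l) - p0" by (rule min.coboundedI1)
      with zeta_deriv_neg[OF v \<open>l < 0\<close>] show thesis by (rule that)
    qed
    obtain J where J: "0 < J" "((\<lambda>z. flow v z t) has_real_derivative J) (at (zeta v l))"
      "Qd v t l = a (Q v t l) * (J * z')"
      using Q_label_deriv[OF v t(1) l(1) z(1)] by metis
    have "zeta v (- N) \<le> zeta v l" "zeta v l \<le> zeta v R"
      using zeta_strict_mono[OF v, of "- N" l] zeta_strict_mono[OF v, of l R] t l by auto
    then have zl: "\<bar>zeta v l\<bar> \<le> ?Z - 1" by linarith
    have le: "at_right (zeta v l) \<le> at (zeta v l)" by (simp add: at_le)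
    have "c \<le> J"
    proof (rule tendsto_lowerbound)
      show "((\<lambda>x. (flow v x t - flow v (zeta v l) t) / (x - zeta v l)) \<longlongrightarrow> J) (at_right (zeta v l))"
        using J(2) tendsto_mono[OF le] by (auto simp: has_field_derivative_iff)
      have "\<forall>\<^sub>F x in at_right (zeta v l). zeta v l < x" by (rule eventually_at_right_less)
      moreover have "\<forall>\<^sub>F x in at_right (zeta v l). x < zeta v l + 1"
        by (rule order_tendstoD(2)[of "\<lambda>x. x" "zeta v l"]) (auto intro: tendsto_ident_at)
      ultimately show "\<forall>\<^sub>F x in at_right (zeta v l). c \<le> (flow v x t - flow v (zeta v l) t) / (x - zeta v l)"
      proof eventually_elim
        case (elim x)
        have "c * (x - zeta v l) \<le> flow v x t - flow v (zeta v l) t"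
          using zl elim t by (intro c(2)) auto
        then show ?case using elim by (simp add: pos_le_divide_eq)
      qed
    qed simp
    then have "c * ?e \<le> J * z'" using z(2) e c(1) J(1) by (intro mult_mono) auto
    then have "(c * ?e) * a (Q v t l) \<le> (J * z') * a (Q v t l)"
      by (intro mult_right_mono a_nonneg Q_nonneg)
    then show ?thesis by (simp add: J(3) mult_ac)
  qed
  with c(1) e show thesis by (intro that[of "c * ?e"]) auto
qed

lemma inv_a_integrable: "set_integrable lborel {0<..<R} (\<lambda>x. 1 / a x)"
proof (cases "R \<le> 1")
  case True
  then show ?thesis by (intro set_integrable_subset[OF inv_a_L1]) auto
next
  case False
  have "set_integrable lborel {1..R} (\<lambda>x. 1 / a x)"
    by (intro borel_integrable_atLeastAtMost' continuous_on_subset[OF inv_a_cont]) auto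
  then have "set_integrable lborel ({0<..<1} \<union> {1..R}) (\<lambda>x. 1 / a x)"
    by (intro set_integrable_Un inv_a_L1) auto
  then show ?thesis by (rule set_integrable_subset) auto
qed

text \<open>Labels distribute positions with a density of order \<open>1 / a\<close>, uniformly in time.\<close>
lemma label_integral_bound:
  assumes v: "adm v" and N: "0 \<le> N" and R: "0 < R"
  obtains c where "0 < c"
    "\<And>t \<xi> B. 0 \<le> t \<Longrightarrow> t \<le> N \<Longrightarrow> \<xi> \<in> borel_measurable borel \<Longrightarrow> (\<And>x. 0 \<le> \<xi> x) \<Longrightarrow> (\<And>x. \<xi> x \<le> B) \<Longrightarrow>
      (LINT l:{- t<..<R}|lborel. \<xi> (Q v t l)) \<le> c * (LINT x:{0<..<(1 + R) * exp (rate * N)}|lborel. \<xi> x * (1 / a x))"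
proof -
  obtain c where c: "0 < c"
    "\<And>t l. 0 \<le> t \<Longrightarrow> t \<le> N \<Longrightarrow> - t < l \<Longrightarrow> l < R \<Longrightarrow> l \<noteq> 0 \<Longrightarrow> c * a (Q v t l) \<le> Qd v t l"
    using Qd_lower[OF v N R] by blast
  let ?R = "(1 + R) * exp (rate * N)"
  have "(LINT l:{- t<..<R}|lborel. \<xi> (Q v t l)) \<le> (1 / c) * (LINT x:{0<..<?R}|lborel. \<xi> x * (1 / a x))"
    if t: "0 \<le> t" "t \<le> N" and \<xi> [measurable]: "\<xi> \<in> borel_measurable borel"
      and chi: "\<And>x. 0 \<le> \<xi> x" "\<And>x. \<xi> x \<le> B" for t \<xi> B
  proof -
    \<comment> \<open>Lebesgue measure on the labels below \<open>R\<close> is transported in place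
      of the particles. \<open>Q_upper\<close> keeps the image below \<open>?R\<close>, and the
      lower bound on \<open>Qd\<close> bounds its density by \<open>1 / (c * a x)\<close>.\<close>
    let ?m = "indicator {..<R} :: real \<Rightarrow> real"
    have m: "?m \<in> borel_measurable borel" by simp
    have "(LINT l:{- t<..<R}|lborel. \<xi> (Q v t l)) = (LINT l:{- t<..}|lborel. \<xi> (Q v t l) * ?m l)"
      unfolding set_lebesgue_integral_def
      by (intro Bochner_Integration.integral_cong refl) (auto simp: indicator_def)
    also have "\<dots> = (LINT x:{0<..}|lborel. \<xi> x * push v ?m t x)"
      by (rule push_integral(2)[OF v t(1) \<xi> m, symmetric])
    also have "\<dots> \<le> (LINT x:{0<..<?R}|lborel. (1 / c) * (\<xi> x * (1 / a x)))"
      unfolding set_lebesgue_integral_def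
    proof (rule integral_mono_AE')
      have "integrable lborel (\<lambda>x. (B * (1 / c)) * (indicator {0<..<?R} x *\<^sub>R (1 / a x)))"
        using inv_a_integrable[of ?R] unfolding set_integrable_def by (rule integrable_mult_right)
      moreover have "(\<lambda>x. indicator {0<..<?R} x *\<^sub>R ((1 / c) * (\<xi> x * (1 / a x)))) \<in> borel_measurable lborel"
      proof -
        have [measurable]: "(\<lambda>x. indicator {0<..<?R} x *\<^sub>R (1 / a x)) \<in> borel_measurable borel"
          using inv_a_integrable[of ?R] unfolding set_integrable_def by (simp add: borel_measurable_integrable)
        have "(\<lambda>x. (1 / c) * (\<xi> x * (indicator {0<..<?R} x *\<^sub>R (1 / a x)))) \<in> borel_measurable borel"
          by measurable
        then show ?thesis by (simp add: mult_ac)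
      qed
      ultimately show "integrable lborel (\<lambda>x. indicator {0<..<?R} x *\<^sub>R ((1 / c) * (\<xi> x * (1 / a x))))"
      proof (rule Bochner_Integration.integrable_bound)
        show "AE x in lborel. norm (indicator {0<..<?R} x *\<^sub>R ((1 / c) * (\<xi> x * (1 / a x))))
            \<le> norm ((B * (1 / c)) * (indicator {0<..<?R} x *\<^sub>R (1 / a x)))"
        proof (rule AE_I2)
          fix x :: real
          show "norm (indicator {0<..<?R} x *\<^sub>R ((1 / c) * (\<xi> x * (1 / a x))))
            \<le> norm ((B * (1 / c)) * (indicator {0<..<?R} x *\<^sub>R (1 / a x)))"
          proof (cases "x \<in> {0<..<?R}")
            case True
            then have "0 < a x" using a_pos by simp
            moreover have "0 \<le> B" using chi order_trans by blast
            ultimately show ?thesis using True chi[of x] c(1)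
              by (simp add: abs_mult divide_right_mono)
          qed simp
        qed
      qed
      have pos: "0 \<le> (1 / c) * (\<xi> x * (1 / a x))" if "0 < x" for x
        using chi(1)[of x] a_pos[OF that] c(1) by simp
      have le: "push v ?m t x \<le> (1 / c) * (1 / a x) * indicator {..<?R} x" if x: "0 < x" for x
      proof (cases "lab v t x \<noteq> 0 \<and> lab v t x < R")
        case True
        have l: "- t < lab v t x" "Q v t (lab v t x) = x" by (rule lab[OF v t(1) x])+
        have "c * a x \<le> Qd v t (lab v t x)" using c(2)[OF t l(1)] True l(2) by simp
        then have "1 / Qd v t (lab v t x) \<le> 1 / (c * a x)"
          using c(1) a_pos[OF x] by (intro divide_left_mono) (auto intro!: mult_pos_pos Qd_pos(1)[OF v t(1) l(1)] simp: True)
        moreover have "x < ?R"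
        proof -
          have "1 + Q v t R \<le> (1 + R) * exp (rate * t)" using Q_upper[OF v t(1), of R] R by simp
          also have "\<dots> \<le> ?R" using rate(1) t R by (intro mult_left_mono) auto
          finally show ?thesis using lab_less_iff[OF v t(1) x, of R] True by simp
        qed
        ultimately show ?thesis using True by (simp add: push_def)
      next
        case False
        then have "push v ?m t x = 0" by (auto simp: push_def)
        then show ?thesis using c(1) a_pos[OF x] by simp
      qed
      show "AE x in lborel. indicator {0<..} x *\<^sub>R (\<xi> x * push v ?m t x)
          \<le> indicator {0<..<?R} x *\<^sub>R ((1 / c) * (\<xi> x * (1 / a x)))"
      proof (rule AE_I2)
        fix x :: real
        show "indicator {0<..} x *\<^sub>R (\<xi> x * push v ?m t x)
          \<le> indicator {0<..<?R} x *\<^sub>R ((1 / c) * (\<xi> x * (1 / a x)))"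
        proof (cases "0 < x")
          case True
          have "\<xi> x * push v ?m t x \<le> \<xi> x * ((1 / c) * (1 / a x) * indicator {..<?R} x)"
            using le[OF True] chi(1) by (intro mult_left_mono) auto
          then show ?thesis using True by (auto simp: indicator_def mult_ac)
        qed simp
      qed
      show "AE x in lborel. 0 \<le> indicator {0<..<?R} x *\<^sub>R ((1 / c) * (\<xi> x * (1 / a x)))"
        using pos by (intro AE_I2) (auto simp: indicator_def)
    qed
    also have "\<dots> = (1 / c) * (LINT x:{0<..<?R}|lborel. \<xi> x * (1 / a x))"
      by (rule set_integral_mult_right)
    finally show ?thesis .
  qed
  with c(1) show thesis by (intro that[of "1 / c"]) auto
qed

lemma Q_meas: "adm v \<Longrightarrow> 0 \<le> t \<Longrightarrow> Q v t \<in> borel_measurable borel"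
  by (rule borel_measurable_continuous_onI[OF Q_label_continuous])

lemma dom_nonneg: "adm v \<Longrightarrow> 0 \<le> N \<Longrightarrow> 0 \<le> dom N l"
  using dom_bound(2)[of v N l] by (cases "- N < l") (auto simp: dom_def indicator_def)

lemma Q_tendsto:
  assumes v: "adm v" and u: "\<And>i. 0 \<le> u i" "u \<longlonglongrightarrow> t"
  shows "(\<lambda>i. Q v (u i) l) \<longlonglongrightarrow> Q v t l"
proof -
  have "0 \<le> t" using u by (intro LIMSEQ_le_const[OF u(2)]) auto
  then show ?thesis
    using u by (intro continuous_on_tendsto_compose[OF Q_time_continuous[OF v] u(2)]) auto
qed

text \<open>For continuous test functions the integrand converges for each label, as positions are
  continuous in time; only the label \<open>- t\<close>, which is just entering, has to be left
  out.\<close>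

lemma weakly_continuous_test:
  assumes v: "adm v" and N: "0 \<le> N" and \<psi>: "continuous_on UNIV \<psi>" and B: "\<And>x. \<bar>\<psi> x\<bar> \<le> B"
  shows "continuous_on {0..N} (\<lambda>t. LINT l:{- t<..}|lborel. (\<psi> (Q v t l) * (1 + Q v t l)) * wt v l)"
proof (rule continuous_on_sequentiallyI)
  fix u :: "nat \<Rightarrow> real" and t
  assume u: "\<forall>i. u i \<in> {0..N}" "t \<in> {0..N}" "u \<longlonglongrightarrow> t"
  have u0: "0 \<le> u i" "u i \<le> N" for i using u(1) by auto
  have t0: "0 \<le> t" using u by simp
  have B0: "0 \<le> B" using B[of 0] by simp
  have \<psi>m [measurable]: "\<psi> \<in> borel_measurable borel" by (rule borel_measurable_continuous_onI[OF \<psi>])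
  note [measurable] = wt_meas[OF v]
  have meas: "(\<lambda>l. indicator {- s<..} l *\<^sub>R ((\<psi> (Q v s l) * (1 + Q v s l)) * wt v l)) \<in> borel_measurable lborel" if "0 \<le> s" for s
  proof -
    note [measurable] = Q_meas[OF v that]
    show ?thesis by measurable
  qed
  show "(\<lambda>i. LINT l:{- u i<..}|lborel. (\<psi> (Q v (u i) l) * (1 + Q v (u i) l)) * wt v l)
      \<longlonglongrightarrow> (LINT l:{- t<..}|lborel. (\<psi> (Q v t l) * (1 + Q v t l)) * wt v l)"
    unfolding set_lebesgue_integral_def
  proof (rule integral_dominated_convergence)
    show "integrable lborel (\<lambda>l. (B * exp (rate * N)) * dom N l)"
      by (intro integrable_mult_right dom_integrable)
    show "AE l in lborel. (\<lambda>i. indicator {- u i<..} l *\<^sub>R ((\<psi> (Q v (u i) l) * (1 + Q v (u i) l)) * wt v l))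
        \<longlonglongrightarrow> indicator {- t<..} l *\<^sub>R ((\<psi> (Q v t l) * (1 + Q v t l)) * wt v l)"
      using AE_lborel_singleton[of "- t"]
    proof eventually_elim
      case (elim l)
      have "(\<lambda>i. (\<psi> (Q v (u i) l) * (1 + Q v (u i) l)) * wt v l) \<longlonglongrightarrow> (\<psi> (Q v t l) * (1 + Q v t l)) * wt v l"
        by (intro tendsto_intros Q_tendsto v u0 u(3) continuous_on_tendsto_compose[OF \<psi> Q_tendsto]) auto
      moreover have "(\<lambda>i. indicator {- u i<..} l :: real) \<longlonglongrightarrow> indicator {- t<..} l"
      proof (rule tendsto_eventually)
        show "\<forall>\<^sub>F i in sequentially. (indicator {- u i<..} l :: real) = indicator {- t<..} l"
        proof (cases "- t < l")
          case True
          then have "\<forall>\<^sub>F i in sequentially. - l < u i" by (intro order_tendstoD(1)[OF u(3)]) simp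
          then show ?thesis by eventually_elim (use True in auto)
        next
          case False
          then have "\<forall>\<^sub>F i in sequentially. u i < - l" using elim by (intro order_tendstoD(2)[OF u(3)]) simp
          then show ?thesis by eventually_elim (use False in auto)
        qed
      qed
      ultimately show ?case by (rule tendsto_scaleR[rotated])
    qed
    fix i
    show "AE l in lborel. norm (indicator {- u i<..} l *\<^sub>R ((\<psi> (Q v (u i) l) * (1 + Q v (u i) l)) * wt v l))
        \<le> (B * exp (rate * N)) * dom N l"
    proof (rule AE_I2)
      fix l :: real
      show "norm (indicator {- u i<..} l *\<^sub>R ((\<psi> (Q v (u i) l) * (1 + Q v (u i) l)) * wt v l))
        \<le> (B * exp (rate * N)) * dom N l"
      proof (cases "- u i < l")
        case True
        then have l: "- N < l" using u0(2)[of i] by simp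
        have "\<bar>(\<psi> (Q v (u i) l) * (1 + Q v (u i) l)) * wt v l\<bar> = \<bar>\<psi> (Q v (u i) l)\<bar> * ((1 + Q v (u i) l) * wt v l)"
          using Q_nonneg[of v "u i" l] wt_nonneg[OF v, of l] by (simp add: abs_mult)
        also have "\<dots> \<le> B * (exp (rate * N) * dom N l)"
          using Q_nonneg[of v "u i" l] wt_nonneg[OF v, of l] B0
          by (intro mult_mono B weighted_bound v u0 l) auto
        finally show ?thesis using True by simp
      next
        case False
        then show ?thesis using dom_nonneg[OF v N, of l] B0 by simp
      qed
    qed
  qed (intro meas u0 t0)+
qed

text \<open>The weight is split into a part bounded by \<open>K\<close> on labels below
  \<open>K\<close> and a remainder. On the remainder \<open>\<xi>\<close> is replaced by its bound
  \<open>B\<close>; on the other part the weight is replaced by \<open>K\<close>, which leaves an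
  integral with respect to plain Lebesgue measure on labels.\<close>

lemma weak_integral_truncated:
  assumes v: "adm v" and N: "0 \<le> N" and t: "0 \<le> t" "t \<le> N" and K: "0 < K"
    and \<xi> [measurable]: "\<xi> \<in> borel_measurable borel" and B: "\<And>x. \<bar>\<xi> x\<bar> \<le> B"
  shows "\<bar>LINT l:{- t<..}|lborel. (\<xi> (Q v t l) * (1 + Q v t l)) * wt v l\<bar> \<le> exp (rate * N) *
    (B * (LINT l|lborel. dom N l - indicator {..<K} l * min (dom N l) K)
      + K * (LINT l:{- t<..<K}|lborel. \<bar>\<xi> (Q v t l)\<bar>))"
proof -
  let ?tr = "\<lambda>l. indicator {..<K} l * min (dom N l) K"
  let ?E = "exp (rate * N)"
  have B0: "0 \<le> B" using B[of 0] by simp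
  note [measurable] = Q_meas[OF v t(1)] wt_meas[OF v]
  have domm [measurable]: "dom N \<in> borel_measurable borel"
    using dom_integrable[of N] by (simp add: borel_measurable_integrable)
  have d0: "0 \<le> dom N l" for l by (rule dom_nonneg[OF v N])
  have tr: "0 \<le> ?tr l" "?tr l \<le> dom N l" for l using d0[of l] K by (auto simp: indicator_def)
  have i1: "integrable lborel (\<lambda>l. dom N l - ?tr l)"
  proof (rule Bochner_Integration.integrable_bound[OF dom_integrable[of N]])
    show "AE l in lborel. norm (dom N l - ?tr l) \<le> norm (dom N l)"
      using tr d0 by (intro AE_I2) (auto simp: abs_le_iff intro: order_trans)
  qed simp
  have i2: "integrable lborel (\<lambda>l. indicator {- t<..<K} l *\<^sub>R \<bar>\<xi> (Q v t l)\<bar>)"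
  proof (rule Bochner_Integration.integrable_bound)
    show "integrable lborel (\<lambda>l. indicator {- t<..<K} l *\<^sub>R B)"
      using t K by (intro integrable_scaleR_left integrable_real_indicator) auto
    show "AE l in lborel. norm (indicator {- t<..<K} l *\<^sub>R \<bar>\<xi> (Q v t l)\<bar>) \<le> norm (indicator {- t<..<K} l *\<^sub>R B)"
      using B B0 by (intro AE_I2) (auto simp: indicator_def)
  qed simp
  have "norm (LINT l:{- t<..}|lborel. (\<xi> (Q v t l) * (1 + Q v t l)) * wt v l)
    \<le> (LINT l|lborel. ?E * (B * (dom N l - ?tr l) + K * (indicator {- t<..<K} l *\<^sub>R \<bar>\<xi> (Q v t l)\<bar>)))"
    unfolding set_lebesgue_integral_def
  proof (rule Bochner_Integration.integral_norm_bound_integral)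
    have "\<bar>\<xi> x * (1 + x)\<bar> \<le> B * (1 + x)" if "0 \<le> x" for x
      using B[of x] that by (simp add: abs_mult mult_right_mono)
    then have "set_integrable lborel {- t<..} (\<lambda>l. (\<xi> (Q v t l) * (1 + Q v t l)) * wt v l)"
      using particle_integrable[OF v t(1) order_refl, of "\<lambda>x. \<xi> x * (1 + x)" B] by simp
    then show "integrable lborel (\<lambda>l. indicator {- t<..} l *\<^sub>R ((\<xi> (Q v t l) * (1 + Q v t l)) * wt v l))"
      by (simp add: set_integrable_def)
    show "integrable lborel (\<lambda>l. ?E * (B * (dom N l - ?tr l) + K * (indicator {- t<..<K} l *\<^sub>R \<bar>\<xi> (Q v t l)\<bar>)))"
      by (intro integrable_mult_right Bochner_Integration.integrable_add i1 i2)
    fix l :: real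
    show "norm (indicator {- t<..} l *\<^sub>R ((\<xi> (Q v t l) * (1 + Q v t l)) * wt v l))
      \<le> ?E * (B * (dom N l - ?tr l) + K * (indicator {- t<..<K} l *\<^sub>R \<bar>\<xi> (Q v t l)\<bar>))"
    proof (cases "- t < l")
      case True
      let ?x = "\<bar>\<xi> (Q v t l)\<bar>"
      have "\<bar>(\<xi> (Q v t l) * (1 + Q v t l)) * wt v l\<bar> = ?x * ((1 + Q v t l) * wt v l)"
        using Q_nonneg[of v t l] wt_nonneg[OF v, of l] by (simp add: abs_mult)
      also have "\<dots> \<le> ?x * (?E * dom N l)"
        using True t by (intro mult_left_mono weighted_bound v t) auto
      also have "\<dots> = ?E * (?x * (dom N l - ?tr l) + ?x * ?tr l)" by (simp add: algebra_simps)
      also have "\<dots> \<le> ?E * (B * (dom N l - ?tr l) + K * (indicator {- t<..<K} l *\<^sub>R ?x))"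
      proof (intro mult_left_mono add_mono)
        show "?x * (dom N l - ?tr l) \<le> B * (dom N l - ?tr l)" using tr[of l] by (intro mult_right_mono B) simp
        have "?x * ?tr l \<le> ?x * (K * indicator {..<K} l)"
          by (intro mult_left_mono) (auto simp: indicator_def)
        then show "?x * ?tr l \<le> K * (indicator {- t<..<K} l *\<^sub>R ?x)"
          using True by (auto simp: indicator_def mult.commute)
      qed simp
      finally show ?thesis using True by simp
    next
      case False
      then show ?thesis using tr[of l] B0 K by (auto intro!: mult_nonneg_nonneg add_nonneg_nonneg)
    qed
  qed
  also have "\<dots> = ?E * (B * (LINT l|lborel. dom N l - ?tr l) + K * (LINT l:{- t<..<K}|lborel. \<bar>\<xi> (Q v t l)\<bar>))"
    unfolding set_lebesgue_integral_def
    using i1 i2 by (simp add: Bochner_Integration.integral_add)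
  finally show ?thesis by simp
qed

lemma truncation_small:
  assumes v: "adm v" and N: "0 \<le> N" and e: "0 < e"
  obtains K where "0 < K" "(LINT l|lborel. dom N l - indicator {..<K} l * min (dom N l) K) < e"
proof -
  have domm [measurable]: "dom N \<in> borel_measurable borel"
    using dom_integrable[of N] by (simp add: borel_measurable_integrable)
  have d0: "0 \<le> dom N l" for l by (rule dom_nonneg[OF v N])
  have "(\<lambda>k :: nat. LINT l|lborel. dom N l - indicator {..<real k} l * min (dom N l) (real k)) \<longlonglongrightarrow> (LINT l::real|lborel. 0)"
  proof (rule integral_dominated_convergence[OF _ _ dom_integrable[of N]])
    show "AE l in lborel. (\<lambda>k. dom N l - indicator {..<real k} l * min (dom N l) (real k)) \<longlonglongrightarrow> 0"
    proof (rule AE_I2, rule tendsto_eventually)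
      fix l :: real
      have "\<forall>\<^sub>F k in sequentially. max l (dom N l) < real k"
        using filterlim_real_sequentially unfolding filterlim_at_top_dense by blast
      then show "\<forall>\<^sub>F k in sequentially. dom N l - indicator {..<real k} l * min (dom N l) (real k) = 0"
        by eventually_elim (auto simp: indicator_def)
    qed
    show "AE l in lborel. norm (dom N l - indicator {..<real k} l * min (dom N l) (real k)) \<le> dom N l" for k
      using d0 by (intro AE_I2) (auto simp: indicator_def min_def)
  qed simp_all
  then have "(\<lambda>k :: nat. LINT l|lborel. dom N l - indicator {..<real k} l * min (dom N l) (real k)) \<longlonglongrightarrow> 0" by simp
  from order_tendstoD(2)[OF this e] eventually_gt_at_top[of 0]
  have "\<forall>\<^sub>F k in sequentially. (LINT l|lborel. dom N l - indicator {..<real k} l * min (dom N l) (real k)) < e \<and> 0 < k"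
    by (rule eventually_conj)
  then obtain k :: nat where "(LINT l|lborel. dom N l - indicator {..<real k} l * min (dom N l) (real k)) < e" "0 < k"
    using eventually_happens'[OF sequentially_bot] by blast
  then show thesis using that[of "real k"] by simp
qed

text \<open>Approximation of \<open>\<psi>\<close> by continuous functions that converge only almost
  everywhere. The distributions of positions at all times in \<open>{0..N}\<close> are controlled by
  the single measure \<open>dx / a\<close>, so one dominated limit makes the errors small uniformly
  in time, and continuity passes to the limit.\<close>

lemma weakly_continuous:
  assumes v: "adm v" and N: "0 \<le> N" and \<psi>: "\<psi> \<in> borel_measurable borel" and B: "\<And>x. \<bar>\<psi> x\<bar> \<le> B"
  shows "continuous_on {0..N} (\<lambda>t. LINT l:{- t<..}|lborel. (\<psi> (Q v t l) * (1 + Q v t l)) * wt v l)"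
proof -
  define I where "I f t = (LINT l:{- t<..}|lborel. (f (Q v t l) * (1 + Q v t l)) * wt v l)" for f t
  have B0: "0 \<le> B" using B[of 0] by simp
  obtain g where g: "\<And>k. continuous_on UNIV (g k)" "\<And>k x. \<bar>g (k :: nat) x\<bar> \<le> B"
    "AE x in lborel. (\<lambda>k. g k x) \<longlonglongrightarrow> \<psi> x"
    using bounded_measurable_approx[OF \<psi> B] by blast
  have gm: "g k \<in> borel_measurable borel" for k by (rule borel_measurable_continuous_onI[OF g(1)])
  note [measurable] = gm \<psi>
  have gb: "\<bar>g k x - \<psi> x\<bar> \<le> 2 * B" for k x using g(2)[of k x] B[of x] by linarith
  have integrable: "set_integrable lborel {- t<..} (\<lambda>l. (f (Q v t l) * (1 + Q v t l)) * wt v l)"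
    if f: "f \<in> borel_measurable borel" "\<And>x. \<bar>f x\<bar> \<le> B" and t: "0 \<le> t" for f t
  proof -
    note [measurable] = f(1)
    have "\<bar>f x * (1 + x)\<bar> \<le> B * (1 + x)" if "0 \<le> x" for x
      using f(2)[of x] that by (simp add: abs_mult mult_right_mono)
    then show ?thesis
      using particle_integrable[OF v t order_refl, of "\<lambda>x. f x * (1 + x)" B] by simp
  qed
  have diff: "I (g k) t - I \<psi> t = I (\<lambda>x. g k x - \<psi> x) t" if t: "0 \<le> t" for k t
    unfolding I_def using set_integral_diff(2)[OF integrable[OF gm g(2) t] integrable[OF \<psi> B t], symmetric]
    by (simp add: algebra_simps)
  have ul: "uniform_limit {0..N} (\<lambda>k. I (g k)) (I \<psi>) sequentially"
  proof (rule uniform_limitI)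
    fix e :: real assume e: "0 < e"
    let ?E = "exp (rate * N)"
    \<comment> \<open>Makes the truncation error \<open>?E * (2 * B * e1)\<close> at most
      \<open>e / 2\<close>; the 1 covers the case \<open>B = 0\<close>.\<close>
    define e1 where "e1 = e / (2 * ?E * (2 * B + 1))"
    have e1: "0 < e1" using e B0 by (simp add: e1_def)
    obtain K where K: "0 < K" "(LINT l|lborel. dom N l - indicator {..<K} l * min (dom N l) K) < e1"
      using truncation_small[OF v N e1] by blast
    obtain c where c: "0 < c"
      "\<And>t \<xi> B. 0 \<le> t \<Longrightarrow> t \<le> N \<Longrightarrow> \<xi> \<in> borel_measurable borel \<Longrightarrow> (\<And>x. 0 \<le> \<xi> x) \<Longrightarrow> (\<And>x. \<xi> x \<le> B) \<Longrightarrow>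
      (LINT l:{- t<..<K}|lborel. \<xi> (Q v t l)) \<le> c * (LINT x:{0<..<(1 + K) * exp (rate * N)}|lborel. \<xi> x * (1 / a x))"
      using label_integral_bound[OF v N K(1)] by blast
    let ?R = "(1 + K) * exp (rate * N)"
    have am [measurable]: "(\<lambda>x. indicator {0<..<?R} x *\<^sub>R (1 / a x)) \<in> borel_measurable borel"
      using inv_a_integrable[of ?R] unfolding set_integrable_def by (simp add: borel_measurable_integrable)
    have "(\<lambda>k. LINT x:{0<..<?R}|lborel. \<bar>g k x - \<psi> x\<bar> * (1 / a x)) \<longlonglongrightarrow> (LINT x::real|lborel. 0)"
      unfolding set_lebesgue_integral_def
    proof (rule integral_dominated_convergence[where w = "\<lambda>x. (2 * B) * (indicator {0<..<?R} x *\<^sub>R (1 / a x))"])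
      show "integrable lborel (\<lambda>x. (2 * B) * (indicator {0<..<?R} x *\<^sub>R (1 / a x)))"
        using inv_a_integrable[of ?R] unfolding set_integrable_def by (rule integrable_mult_right)
      show "AE x in lborel. (\<lambda>k. indicator {0<..<?R} x *\<^sub>R (\<bar>g k x - \<psi> x\<bar> * (1 / a x))) \<longlonglongrightarrow> 0"
        using g(3)
      proof eventually_elim
        case (elim x)
        have "(\<lambda>k. indicator {0<..<?R} x *\<^sub>R (\<bar>g k x - \<psi> x\<bar> * (1 / a x))) \<longlonglongrightarrow> indicator {0<..<?R} x *\<^sub>R (\<bar>\<psi> x - \<psi> x\<bar> * (1 / a x))"
          by (intro tendsto_intros elim)
        then show ?case by simp
      qed
      fix k
      have "(\<lambda>x. \<bar>g k x - \<psi> x\<bar> * (indicator {0<..<?R} x *\<^sub>R (1 / a x))) \<in> borel_measurable borel"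
        by measurable
      then show "(\<lambda>x. indicator {0<..<?R} x *\<^sub>R (\<bar>g k x - \<psi> x\<bar> * (1 / a x))) \<in> borel_measurable lborel"
        by (simp add: mult_ac)
      show "AE x in lborel. norm (indicator {0<..<?R} x *\<^sub>R (\<bar>g k x - \<psi> x\<bar> * (1 / a x)))
          \<le> (2 * B) * (indicator {0<..<?R} x *\<^sub>R (1 / a x))"
      proof (rule AE_I2)
        fix x :: real
        show "norm (indicator {0<..<?R} x *\<^sub>R (\<bar>g k x - \<psi> x\<bar> * (1 / a x)))
          \<le> (2 * B) * (indicator {0<..<?R} x *\<^sub>R (1 / a x))"
        proof (cases "x \<in> {0<..<?R}")
          case True
          then have "0 < a x" using a_pos by simp
          then have "\<bar>g k x - \<psi> x\<bar> * (1 / a x) \<le> 2 * B * (1 / a x)"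
            by (intro mult_right_mono gb) simp
          then show ?thesis using True \<open>0 < a x\<close> by (simp add: abs_mult)
        qed simp
      qed
    qed simp
    then have lim: "(\<lambda>k. ?E * (K * (c * (LINT x:{0<..<?R}|lborel. \<bar>g k x - \<psi> x\<bar> * (1 / a x))))) \<longlonglongrightarrow> ?E * (K * (c * 0))"
      by (intro tendsto_intros) simp
    then have "\<forall>\<^sub>F k in sequentially. ?E * (K * (c * (LINT x:{0<..<?R}|lborel. \<bar>g k x - \<psi> x\<bar> * (1 / a x)))) < e / 2"
      using e by (intro order_tendstoD(2)[OF lim]) simp
    then show "\<forall>\<^sub>F k in sequentially. \<forall>t\<in>{0..N}. dist (I (g k) t) (I \<psi> t) < e"
    proof eventually_elim
      case (elim k)
      show ?case
      proof
        fix t assume t: "t \<in> {0..N}"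
        have "dist (I (g k) t) (I \<psi> t) = \<bar>I (\<lambda>x. g k x - \<psi> x) t\<bar>"
          using diff[of t k] t by (simp add: dist_real_def)
        also have "\<dots> \<le> ?E * ((2 * B) * (LINT l|lborel. dom N l - indicator {..<K} l * min (dom N l) K)
             + K * (LINT l:{- t<..<K}|lborel. \<bar>g k (Q v t l) - \<psi> (Q v t l)\<bar>))"
          unfolding I_def using t by (intro weak_integral_truncated[OF v N _ _ K(1)] gb) auto
        also have "\<dots> \<le> ?E * ((2 * B) * e1 + K * (c * (LINT x:{0<..<?R}|lborel. \<bar>g k x - \<psi> x\<bar> * (1 / a x))))"
          using t K B0 c(2)[of t "\<lambda>x. \<bar>g k x - \<psi> x\<bar>" "2 * B"] gb
          by (intro mult_left_mono add_mono) auto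
        also have "\<dots> < ?E * ((2 * B) * e1) + e / 2"
          using elim by (simp add: distrib_left)
        also have "?E * ((2 * B) * e1) \<le> e / 2"
        proof -
          have "?E * ((2 * B) * e1) \<le> ?E * ((2 * B + 1) * e1)" using e1 by (intro mult_left_mono mult_right_mono) auto
          also have "\<dots> = e / 2"
          proof -
            have "2 * ?E * (2 * B + 1) \<noteq> 0" using B0 by simp
            then have "e1 * (2 * ?E * (2 * B + 1)) = e" unfolding e1_def by (rule nonzero_eq_divide_eq[THEN iffD1, OF _ refl])
            moreover have "e1 * (2 * ?E * (2 * B + 1)) = 2 * (?E * ((2 * B + 1) * e1))" by (simp only: mult_ac)
            ultimately show ?thesis by linarith
          qed
          finally show ?thesis .
        qed
        finally show "dist (I (g k) t) (I \<psi> t) < e" by simp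
      qed
    qed
  qed
  have "continuous_on {0..N} (I (g k))" for k
    unfolding I_def by (rule weakly_continuous_test[OF v N g(1) g(2)])
  then have "continuous_on {0..N} (I \<psi>)"
    by (intro uniform_limit_theorem[OF _ ul]) auto
  then show ?thesis by (simp add: I_def)
qed

text \<open>Pointwise convergence of the velocities is enough: starting points, positions and
  weights then converge for each label, and \<open>dom\<close> dominates all of them at
  once.\<close>

lemma Gam_stability:
  assumes w: "adm w" and v: "\<And>k. adm (v k)"
    and vw: "\<And>r. 0 \<le> r \<Longrightarrow> r \<le> T \<Longrightarrow> (\<lambda>k :: nat. v k r) \<longlonglongrightarrow> w r"
    and t: "0 \<le> t" "t \<le> T"
  shows "(\<lambda>k. Gam (v k) t) \<longlonglongrightarrow> Gam w t"
proof -
  have T: "0 \<le> T" using t by simp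
  have zlim: "(\<lambda>k. zeta (v k) l) \<longlonglongrightarrow> zeta w l" if l: "- T < l" for l
  proof (cases "0 \<le> l")
    case True then show ?thesis by (simp add: zeta_pos)
  next
    case False
    have "(\<lambda>k. integral {0..- l} (\<lambda>s. v k s - p0)) \<longlonglongrightarrow> integral {0..- l} (\<lambda>s. w s - p0)"
    proof (rule dominated_convergence(2)[where h = "\<lambda>_. rho"])
      show "(\<lambda>s. v k s - p0) integrable_on {0..- l}" for k
        by (intro integrable_continuous_interval continuous_intros admD(1)[OF v])
      show "norm (v k s - p0) \<le> rho" for k s
        using admD(2,3)[OF v, of k s] p0_ge_0 by simp
      show "(\<lambda>k. v k s - p0) \<longlonglongrightarrow> w s - p0" if "s \<in> {0..- l}" for s
        using that l by (intro tendsto_intros vw) auto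
    qed auto
    then show ?thesis using False by (simp add: zeta_nonpos tendsto_minus)
  qed
  have Qlim: "(\<lambda>k. Q (v k) t l) \<longlonglongrightarrow> Q w t l" if "- T < l" for l
    unfolding Q_def
    by (rule continuous_on_tendsto_compose[OF X_continuous flow_stability[OF w v vw zlim[OF that] t]]) auto
  have wlim: "(\<lambda>k. wt (v k) l) \<longlonglongrightarrow> wt w l" if l: "- T < l" for l
  proof (cases "0 < l")
    case True then show ?thesis by (simp add: wt_def)
  next
    case False
    have "(\<lambda>k. n (v k (- l))) \<longlonglongrightarrow> n (w (- l))"
      using False l admD(2)[OF v] admD(2)[OF w]
      by (intro continuous_on_tendsto_compose[OF n_cont vw]) (auto intro!: less_imp_le always_eventually)
    then show ?thesis using False by (simp add: wt_def)
  qed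
  have "(\<lambda>k. LINT l:{- T<..}|lborel. Q (v k) t l * wt (v k) l) \<longlonglongrightarrow> (LINT l:{- T<..}|lborel. Q w t l * wt w l)"
    unfolding set_lebesgue_integral_def
  proof (rule integral_dominated_convergence)
    show "integrable lborel (\<lambda>l. exp (rate * T) * dom T l)"
      by (intro integrable_mult_right dom_integrable)
    show "AE l in lborel. (\<lambda>k. indicator {- T<..} l *\<^sub>R (Q (v k) t l * wt (v k) l)) \<longlonglongrightarrow> indicator {- T<..} l *\<^sub>R (Q w t l * wt w l)"
    proof (rule AE_I2)
      fix l :: real
      show "(\<lambda>k. indicator {- T<..} l *\<^sub>R (Q (v k) t l * wt (v k) l)) \<longlonglongrightarrow> indicator {- T<..} l *\<^sub>R (Q w t l * wt w l)"
        by (cases "- T < l") (auto intro!: tendsto_intros Qlim wlim)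
    qed
    have meas: "(\<lambda>l. indicator {- T<..} l *\<^sub>R (Q u t l * wt u l)) \<in> borel_measurable lborel" if u: "adm u" for u
    proof -
      note [measurable] = Q_meas[OF u t(1)] wt_meas[OF u]
      show ?thesis by measurable
    qed
    show "(\<lambda>l. indicator {- T<..} l *\<^sub>R (Q w t l * wt w l)) \<in> borel_measurable lborel" by (rule meas[OF w])
    show "(\<lambda>l. indicator {- T<..} l *\<^sub>R (Q (v k) t l * wt (v k) l)) \<in> borel_measurable lborel" for k
      by (rule meas[OF v])
    fix k
    show "AE l in lborel. norm (indicator {- T<..} l *\<^sub>R (Q (v k) t l * wt (v k) l)) \<le> exp (rate * T) * dom T l"
    proof (rule AE_I2)
      fix l :: real
      show "norm (indicator {- T<..} l *\<^sub>R (Q (v k) t l * wt (v k) l)) \<le> exp (rate * T) * dom T l"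
      proof (cases "- T < l")
        case True
        have "\<bar>Q (v k) t l * wt (v k) l\<bar> \<le> (1 + Q (v k) t l) * wt (v k) l"
          using Q_nonneg[of "v k" t l] wt_nonneg[OF v, of k l] by (simp add: abs_mult distrib_right)
        also have "\<dots> \<le> exp (rate * T) * dom T l" by (rule weighted_bound[OF v t True])
        finally show ?thesis using True by simp
      next
        case False
        then show ?thesis using dom_nonneg[OF w T, of l] by simp
      qed
    qed
  qed
  then show ?thesis using Gam_eq[OF v t] Gam_eq[OF w t] by (simp add: tendsto_diff)
qed

end

section \<open>Weak formulation\<close>

lemma has_derivative_of_partials:
  fixes \<phi> \<phi>t \<phi>x :: "real \<Rightarrow> real \<Rightarrow> real"
  assumes dt: "\<And>t x. ((\<lambda>s. \<phi> s x) has_real_derivative \<phi>t t x) (at t)"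
    and dx: "\<And>t x. ((\<lambda>y. \<phi> t y) has_real_derivative \<phi>x t x) (at x)"
    and cx: "continuous_on UNIV (\<lambda>z. \<phi>x (fst z) (snd z))"
  shows "((\<lambda>(s, y). \<phi> s y) has_derivative (\<lambda>(ts, ty). \<phi>t t x * ts + \<phi>x t x * ty)) (at (t, x))"
proof -
  have eq: "blinfun_apply (blinfun_scaleR_left c) = (*) c" for c :: real
    by (simp add: fun_eq_iff mult.commute)
  have "((\<lambda>(s, y). \<phi> s y) has_derivative (\<lambda>(ts, ty). \<phi>t t x * ts + blinfun_scaleR_left (\<phi>x t x) ty))
      (at (t, x) within UNIV \<times> UNIV)"
  proof (rule has_derivative_partialsI[where fy = "\<lambda>s y. blinfun_scaleR_left (\<phi>x s y)"])
    show "((\<lambda>s. \<phi> s x) has_derivative (*) (\<phi>t t x)) (at t within UNIV)"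
      using dt[of x t] by (simp add: has_field_derivative_def)
    show "(\<phi> s has_derivative blinfun_apply (blinfun_scaleR_left (\<phi>x s y))) (at y within UNIV)" for s y
      using dx[of s y] unfolding eq by (simp add: has_field_derivative_def)
    have "isCont (\<lambda>z. \<phi>x (fst z) (snd z)) (t, x)" using cx by (simp add: continuous_on_eq_continuous_at)
    then have "isCont (\<lambda>z. blinfun_scaleR_left (\<phi>x (fst z) (snd z))) (t, x)"
      by (rule bounded_linear.isCont[OF bounded_linear_blinfun_scaleR_left])
    then show "continuous (at (t, x) within UNIV \<times> UNIV) (\<lambda>(x, y). blinfun_scaleR_left (\<phi>x x y))"
      by (simp add: case_prod_beta')
  qed auto
  then show ?thesis unfolding eq by simp
qed

lemma has_real_derivative_along_curve:
  fixes \<phi> \<phi>t \<phi>x :: "real \<Rightarrow> real \<Rightarrow> real"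
  assumes dt: "\<And>t x. ((\<lambda>s. \<phi> s x) has_real_derivative \<phi>t t x) (at t)"
    and dx: "\<And>t x. ((\<lambda>y. \<phi> t y) has_real_derivative \<phi>x t x) (at x)"
    and cx: "continuous_on UNIV (\<lambda>z. \<phi>x (fst z) (snd z))"
    and q: "(q has_real_derivative q') (at t)"
  shows "((\<lambda>s. \<phi> s (q s)) has_real_derivative \<phi>t t (q t) + \<phi>x t (q t) * q') (at t)"
proof -
  have "((\<lambda>s. (s, q s)) has_derivative (\<lambda>h. (h, q' * h))) (at t)"
    using q by (intro has_derivative_Pair has_derivative_ident) (simp add: has_field_derivative_def)
  from has_derivative_compose[OF this has_derivative_of_partials[OF dt dx cx]]
  have "((\<lambda>s. \<phi> s (q s)) has_derivative (\<lambda>h. \<phi>t t (q t) * h + \<phi>x t (q t) * (q' * h))) (at t)" by simp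
  moreover have "(\<lambda>h. \<phi>t t (q t) * h + \<phi>x t (q t) * (q' * h)) = (*) (\<phi>t t (q t) + \<phi>x t (q t) * q')"
    by (simp add: fun_eq_iff algebra_simps)
  ultimately show ?thesis unfolding has_field_derivative_def by simp
qed

lemma set_integrable_bounded_interval:
  fixes f :: "real \<Rightarrow> real"
  assumes "continuous_on {a..b} f" "S \<subseteq> {a..b}" "S \<in> sets borel"
  shows "set_integrable lborel S f"
  by (rule set_integrable_subset[OF borel_integrable_atLeastAtMost'[OF assms(1)]]) (use assms in auto)

context ls_data
begin

lemma fin_integrable: "set_integrable lborel {0<..} fin"
  unfolding set_integrable_def
proof (rule Bochner_Integration.integrable_bound)
  show "integrable lborel (\<lambda>x. indicator {0<..} x *\<^sub>R ((1 + x) * fin x))"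
    using fin_L1 by (simp add: set_integrable_def)
  show "(\<lambda>x. indicator {0<..} x *\<^sub>R fin x) \<in> borel_measurable lborel" using fin_meas by simp
  show "AE x in lborel. norm (indicator {0<..} x *\<^sub>R fin x) \<le> norm (indicator {0<..} x *\<^sub>R ((1 + x) * fin x))"
  proof (rule AE_I2)
    fix x :: real
    show "norm (indicator {0<..} x *\<^sub>R fin x) \<le> norm (indicator {0<..} x *\<^sub>R ((1 + x) * fin x))"
      using fin_nonneg[of x] by (cases "0 < x") (auto simp: abs_mult mult_le_cancel_right1)
  qed
qed

text \<open>The method of characteristics in weak form: the transport integrand is the time
  derivative of the test function along a particle. Integrating over time first and over labels
  afterwards leaves only the starting points of the particles, which are exactly the initial and the
  boundary term.\<close>

lemma weak_formulation:
  assumes v: "adm v" and tau: "0 < \<tau>" "T' < \<tau>"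
    and dt: "\<And>t x. ((\<lambda>s. \<phi> s x) has_real_derivative \<phi>t t x) (at t)"
    and dx: "\<And>t x. ((\<lambda>y. \<phi> t y) has_real_derivative \<phi>x t x) (at x)"
    and ct: "continuous_on UNIV (\<lambda>z. \<phi>t (fst z) (snd z))"
    and cx: "continuous_on UNIV (\<lambda>z. \<phi>x (fst z) (snd z))"
    and supp: "\<And>t x. 0 \<le> t \<Longrightarrow> 0 \<le> x \<Longrightarrow> T' < t \<or> R < x \<Longrightarrow> \<phi> t x = 0"
  shows "set_integrable lborel ({0..\<tau>} \<times> {0<..}) (\<lambda>z. (\<phi>t (fst z) (snd z) + (a (snd z) * v (fst z) - b (snd z)) * \<phi>x (fst z) (snd z))
             * dens v (fst z) (snd z))" (is "set_integrable _ _ ?G")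
    and "set_integrable lborel {0..<\<tau>} (\<lambda>t. \<phi> t 0 * n (v t))"
    and "set_integrable lborel {0<..} (\<lambda>x. \<phi> 0 x * fin x)"
    and "(LINT z:({0..\<tau>} \<times> {0<..})|lborel. (\<phi>t (fst z) (snd z) + (a (snd z) * v (fst z) - b (snd z)) * \<phi>x (fst z) (snd z))
             * dens v (fst z) (snd z)) + (LINT t:{0..<\<tau>}|lborel. \<phi> t 0 * n (v t))
         + (LINT x:{0<..}|lborel. \<phi> 0 x * fin x) = 0"
proof -
  define R' where "R' = max R 0"
  \<comment> \<open>The transport integrand; \<open>max 0 x\<close> extends the coefficients so that
    \<open>hh\<close> is continuous on the whole plane.\<close>
  define hh where "hh t x = \<phi>t t x + (a (max 0 x) * v t - b (max 0 x)) * \<phi>x t x" for t x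
  have amax: "continuous_on UNIV (\<lambda>x. a (max 0 x))" "continuous_on UNIV (\<lambda>x. b (max 0 x))"
    by (rule continuous_on_compose2[OF a_C0] continuous_on_compose2[OF b_C0]; auto intro!: continuous_intros)+
  have hh_cont: "continuous_on UNIV (\<lambda>p. hh (fst p) (snd p))"
    unfolding hh_def
    by (intro continuous_on_add continuous_on_mult continuous_on_diff ct cx
        continuous_on_compose2[OF amax(1) continuous_on_snd[OF continuous_on_id]]
        continuous_on_compose2[OF amax(2) continuous_on_snd[OF continuous_on_id]]
        continuous_on_compose2[OF admD(1)[OF v, of UNIV] continuous_on_fst[OF continuous_on_id]]) auto
  have phi_cont_x: "continuous_on UNIV (\<phi> t)" for t
    by (rule DERIV_continuous_on) (rule has_field_derivative_at_within[OF dx])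
  have phi_cont_t: "continuous_on UNIV (\<lambda>t. \<phi> t x)" for x
    by (rule DERIV_continuous_on) (rule has_field_derivative_at_within[OF dt])
  have phix0: "\<phi>x t x = 0" if "0 \<le> t" "R' < x" for t x
  proof -
    have "\<forall>\<^sub>F y in nhds x. y \<in> {R'<..}" using that by (intro eventually_nhds_in_open) auto
    then have "\<forall>\<^sub>F y in nhds x. \<phi> t y = 0"
      by eventually_elim (use that supp in \<open>auto simp: R'_def\<close>)
    then have "(\<phi> t has_real_derivative \<phi>x t x) (at x) = ((\<lambda>_. 0) has_real_derivative \<phi>x t x) (at x)"
      by (intro DERIV_cong_ev) auto
    then show ?thesis using dx[of t x] DERIV_unique[OF _ DERIV_const] by blast
  qed
  \<comment> \<open>The support condition concerns times \<ge> 0 only. For \<open>t > 0\<close> the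
    test function vanishes on a neighbourhood of \<open>t\<close>; the value at \<open>t = 0\<close>
    follows from the continuity of \<open>\<phi>t\<close>.\<close>
  have phit0: "\<phi>t t x = 0" if "0 \<le> t" "R' < x" for t x
  proof -
    have pos: "\<phi>t t x = 0" if t: "0 < t" for t
    proof -
      have "\<forall>\<^sub>F s in nhds t. s \<in> {0<..}" using t by (intro eventually_nhds_in_open) auto
      then have "\<forall>\<^sub>F s in nhds t. \<phi> s x = 0"
        by eventually_elim (use \<open>R' < x\<close> supp in \<open>auto simp: R'_def\<close>)
      then have "((\<lambda>s. \<phi> s x) has_real_derivative \<phi>t t x) (at t) = ((\<lambda>_. 0) has_real_derivative \<phi>t t x) (at t)"
        by (intro DERIV_cong_ev) auto
      then show ?thesis using dt[of x t] DERIV_unique[OF _ DERIV_const] by blast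
    qed
    show ?thesis
    proof (cases "t = 0")
      case True
      have "continuous_on UNIV (\<lambda>s. \<phi>t s x)"
        using continuous_on_compose2[OF ct continuous_on_Pair[OF continuous_on_id continuous_on_const[of UNIV x]]] by simp
      then have "((\<lambda>s. \<phi>t s x) \<longlongrightarrow> \<phi>t 0 x) (at_right 0)"
        by (metis UNIV_I continuous_on_def tendsto_within_subset subset_UNIV)
      moreover have "((\<lambda>s. \<phi>t s x) \<longlongrightarrow> 0) (at_right 0)"
      proof (rule tendsto_eventually)
        have "\<forall>\<^sub>F s in at_right (0::real). 0 < s" by (rule eventually_at_right_less)
        then show "\<forall>\<^sub>F s in at_right 0. \<phi>t s x = 0" by eventually_elim (rule pos)
      qed
      ultimately show ?thesis using True tendsto_unique[OF trivial_limit_at_right_real] by metis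
    qed (use that pos in auto)
  qed
  have "compact ((\<lambda>p. hh (fst p) (snd p)) ` ({0..\<tau>} \<times> {0..R'}))"
    by (intro compact_continuous_image continuous_on_subset[OF hh_cont] compact_Times) auto
  then have "bounded ((\<lambda>p. hh (fst p) (snd p)) ` ({0..\<tau>} \<times> {0..R'}))" by (rule compact_imp_bounded)
  then obtain H0 where H0: "\<forall>p\<in>{0..\<tau>} \<times> {0..R'}. \<bar>hh (fst p) (snd p)\<bar> \<le> H0" by (auto simp: bounded_iff)
  define H where "H = max H0 0"
  have H: "\<bar>hh t x\<bar> \<le> H" if "0 \<le> t" "t \<le> \<tau>" "0 \<le> x" for t x
  proof (cases "x \<le> R'")
    case True
    then show ?thesis using H0[rule_format, of "(t, x)"] that by (auto simp: H_def)
  next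
    case False
    then show ?thesis using phix0[of t x] phit0[of t x] that by (simp add: hh_def H_def)
  qed
  have H_nn: "0 \<le> H" by (simp add: H_def)
  have hm: "hh t \<in> borel_measurable borel" for t
    using continuous_on_compose2[OF hh_cont continuous_on_Pair[OF continuous_on_const[of UNIV t] continuous_on_id]]
    by (intro borel_measurable_continuous_onI) simp
  have part_int: "set_integrable lborel {- t<..} (\<lambda>l. k (Q v t l) * wt v l)"
    if "0 \<le> t" "k \<in> borel_measurable borel" "\<And>x. 0 \<le> x \<Longrightarrow> \<bar>k x\<bar> \<le> H" for t k
  proof (rule particle_integrable[OF v that(1) order_refl that(2)])
    show "\<bar>k x\<bar> \<le> H * (1 + x)" if "0 \<le> x" for x
      using \<open>\<And>x. 0 \<le> x \<Longrightarrow> \<bar>k x\<bar> \<le> H\<close>[OF that] H_nn that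
      by (meson le_add_same_cancel1 mult_left_mono order_trans mult_le_cancel_left1 add_increasing2 order_refl linorder_not_le)
  qed
  define F where "F p = indicator ({0..\<tau>} \<times> {0<..}) p * (hh (fst p) (snd p) * dens v (fst p) (snd p))" for p :: "real \<times> real"
  have F_meas: "F \<in> borel_measurable (lborel \<Otimes>\<^sub>M lborel)"
  proof -
    have [measurable]: "(\<lambda>p. hh (fst p) (snd p)) \<in> borel_measurable borel"
      by (rule borel_measurable_continuous_onI[OF hh_cont])
    have [measurable]: "{0..\<tau>} \<times> {0<..} \<in> sets (borel :: (real \<times> real) measure)"
      by (intro borel_Times) auto
    note [measurable] = push_joint_meas[OF v wt_meas[OF v]]
    have "(\<lambda>p. indicator ({0..\<tau>} \<times> {0<..}) p * (hh (fst p) (snd p) *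
        (indicator ({0..} \<times> {0<..}) p * dens v (fst p) (snd p)))) \<in> borel_measurable (borel :: (real \<times> real) measure)"
      by measurable
    also have "(\<lambda>p. indicator ({0..\<tau>} \<times> {0<..}) p * (hh (fst p) (snd p) *
        (indicator ({0..} \<times> {0<..}) p * dens v (fst p) (snd p)))) = F"
      by (rule ext) (auto simp: F_def indicator_def)
    finally show ?thesis by (simp add: lborel_prod)
  qed
  have F_slice: "F (t, x) = indicator {0..\<tau>} t * (indicator {0<..} x * (hh t x * dens v t x))" for t x
    by (auto simp: F_def indicator_def)
  have F_int2: "integrable lborel (\<lambda>x. F (t, x))" for t
  proof (cases "t \<in> {0..\<tau>}")
    case True
    then have "set_integrable lborel {0<..} (\<lambda>x. hh t x * dens v t x)"
      using H by (subst pushforward(1)[OF v _ hm]) (auto intro!: part_int hm)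
    then show ?thesis using True by (simp add: F_slice set_integrable_def)
  qed (simp add: F_slice)
  define C where "C = H * (exp (rate * \<tau>) * (LINT l|lborel. dom \<tau> l))"
  have C: "(LINT x:{0<..}|lborel. \<bar>hh t x\<bar> * dens v t x) \<le> C" if t: "0 \<le> t" "t \<le> \<tau>" for t
  proof -
    have hm': "(\<lambda>x. \<bar>hh t x\<bar>) \<in> borel_measurable borel" using hm[of t] by measurable
    have "(LINT x:{0<..}|lborel. \<bar>hh t x\<bar> * dens v t x) = (LINT l:{- t<..}|lborel. \<bar>hh t (Q v t l)\<bar> * wt v l)"
      by (rule pushforward(2)[OF v t(1) hm'])
    also have "\<dots> \<le> (LINT l|lborel. H * (exp (rate * \<tau>) * dom \<tau> l))"
      unfolding set_lebesgue_integral_def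
    proof (rule integral_mono)
      show "integrable lborel (\<lambda>l. indicator {- t<..} l *\<^sub>R (\<bar>hh t (Q v t l)\<bar> * wt v l))"
        using part_int[OF t(1) hm'] H t by (simp add: set_integrable_def)
      show "integrable lborel (\<lambda>l. H * (exp (rate * \<tau>) * dom \<tau> l))"
        by (intro integrable_mult_right dom_integrable)
      fix l :: real
      show "indicator {- t<..} l *\<^sub>R (\<bar>hh t (Q v t l)\<bar> * wt v l) \<le> H * (exp (rate * \<tau>) * dom \<tau> l)"
      proof (cases "- t < l")
        case True
        have "\<bar>hh t (Q v t l)\<bar> * wt v l \<le> H * ((1 + Q v t l) * wt v l)"
          using Q_nonneg[of v t l] wt_nonneg[OF v, of l] H_nn H[OF t Q_nonneg]
          by (intro mult_mono) (auto simp: distrib_right)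
        also have "\<dots> \<le> H * (exp (rate * \<tau>) * dom \<tau> l)"
          using True t H_nn by (intro mult_left_mono weighted_bound v t) auto
        finally show ?thesis using True by simp
      next
        case False
        then show ?thesis using dom_nonneg[OF v, of \<tau> l] tau(1) H_nn by simp
      qed
    qed
    also have "\<dots> = C" by (simp add: C_def)
    finally show ?thesis .
  qed
  have F_int: "integrable (lborel \<Otimes>\<^sub>M lborel) F"
  proof (rule lborel_pair.Fubini_integrable[OF F_meas])
    show "AE t in lborel. integrable lborel (\<lambda>x. F (t, x))" using F_int2 by simp
    show "integrable lborel (\<lambda>t. LINT x|lborel. norm (F (t, x)))"
    proof (rule Bochner_Integration.integrable_bound)
      show "integrable lborel (\<lambda>t. indicator {0..\<tau>} t *\<^sub>R C)"
        using tau by (intro integrable_scaleR_left integrable_real_indicator) auto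
      show "(\<lambda>t. LINT x|lborel. norm (F (t, x))) \<in> borel_measurable lborel"
        using F_meas by measurable
      show "AE t in lborel. norm (LINT x|lborel. norm (F (t, x))) \<le> norm (indicator {0..\<tau>} t *\<^sub>R C)"
      proof (rule AE_I2)
        fix t :: real
        show "norm (LINT x|lborel. norm (F (t, x))) \<le> norm (indicator {0..\<tau>} t *\<^sub>R C)"
        proof (cases "t \<in> {0..\<tau>}")
          case True
          have "(LINT x|lborel. norm (F (t, x))) = (LINT x:{0<..}|lborel. \<bar>hh t x\<bar> * dens v t x)"
            unfolding set_lebesgue_integral_def
            using True dens_nonneg[OF v, of t]
            by (intro Bochner_Integration.integral_cong) (auto simp: F_slice indicator_def abs_mult)
          moreover have "0 \<le> (LINT x|lborel. norm (F (t, x)))" by (rule integral_nonneg_AE) simp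
          ultimately show ?thesis using C[of t] True by simp
        qed (simp add: F_slice)
      qed
    qed
  qed
  have GF: "(\<lambda>z. indicator ({0..\<tau>} \<times> {0<..}) z *\<^sub>R ?G z) = F"
    by (rule ext) (auto simp: F_def indicator_def hh_def)
  show "set_integrable lborel ({0..\<tau>} \<times> {0<..}) ?G"
    unfolding set_integrable_def GF using F_int by (simp add: lborel_prod)
  \<comment> \<open>The same integrand over labels. For a fixed label the admissible times form an
    interval, so after Fubini a one-dimensional integral along each trajectory remains.\<close>
  define Kn where "Kn t l = indicator {0..\<tau>} t * (indicator {- t<..} l * (hh t (Q v t l) * wt v l))" for t l
  have Kn_int: "integrable (lborel \<Otimes>\<^sub>M lborel) (\<lambda>(t, l). Kn t l)"
  proof (rule Bochner_Integration.integrable_bound)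
    have domm [measurable]: "dom \<tau> \<in> borel_measurable borel"
      using dom_integrable[of \<tau>] by (simp add: borel_measurable_integrable)
    show "integrable (lborel \<Otimes>\<^sub>M lborel) (\<lambda>(t, l). indicator {0..\<tau>} t * (H * (exp (rate * \<tau>) * dom \<tau> l)))"
    proof (rule lborel_pair.Fubini_integrable)
      show "(\<lambda>(t, l). indicator {0..\<tau>} t * (H * (exp (rate * \<tau>) * dom \<tau> l))) \<in> borel_measurable (lborel \<Otimes>\<^sub>M lborel)"
        by measurable
      have "integrable lborel (\<lambda>t. indicator {0..\<tau>} t *\<^sub>R (LINT l|lborel. \<bar>H * (exp (rate * \<tau>) * dom \<tau> l)\<bar>))"
        using tau by (intro integrable_scaleR_left integrable_real_indicator) auto
      then show "integrable lborel (\<lambda>t. LINT l|lborel. norm (case (t, l) of (t, l) \<Rightarrow> indicator {0..\<tau>} t * (H * (exp (rate * \<tau>) * dom \<tau> l))))"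
        by (simp add: abs_mult)
      show "AE t in lborel. integrable lborel (\<lambda>l. case (t, l) of (t, l) \<Rightarrow> indicator {0..\<tau>} t * (H * (exp (rate * \<tau>) * dom \<tau> l)))"
        by (simp add: dom_integrable)
    qed
    have "(\<lambda>p. indicator {0..\<tau>} (fst p) * (indicator {p. - fst p < snd p} p * (hh (fst p) (Q v (max 0 (fst p)) (snd p)) * wt v (snd p))))
        \<in> borel_measurable (borel :: (real \<times> real) measure)"
    proof -
      have f [measurable]: "fst \<in> borel_measurable (borel :: (real \<times> real) measure)" "snd \<in> borel_measurable (borel :: (real \<times> real) measure)"
        by (auto intro!: borel_measurable_continuous_onI continuous_intros)
      have [measurable]: "(\<lambda>p. hh (fst p) (Q v (max 0 (fst p)) (snd p))) \<in> borel_measurable (borel :: (real \<times> real) measure)"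
        using continuous_on_compose2[OF hh_cont continuous_on_Pair[OF continuous_on_fst[OF continuous_on_id] Q_jointly_continuous[OF v]]]
        by (intro borel_measurable_continuous_onI) simp
      have [measurable]: "(\<lambda>p. wt v (snd p)) \<in> borel_measurable (borel :: (real \<times> real) measure)"
        by (rule measurable_compose[OF f(2) wt_meas[OF v]])
      have "{p. - fst p < snd p} = {p \<in> space (borel :: (real \<times> real) measure). - fst p < snd p}" by simp
      also have "\<dots> \<in> sets borel" by measurable
      finally have [measurable]: "{p. - fst p < snd p} \<in> sets (borel :: (real \<times> real) measure)" .
      show ?thesis by measurable
    qed
    also have "(\<lambda>p. indicator {0..\<tau>} (fst p) * (indicator {p. - fst p < snd p} p * (hh (fst p) (Q v (max 0 (fst p)) (snd p)) * wt v (snd p))))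
        = (\<lambda>(t, l). Kn t l)"
      by (rule ext) (auto simp: Kn_def indicator_def)
    finally show "(\<lambda>(t, l). Kn t l) \<in> borel_measurable (lborel \<Otimes>\<^sub>M lborel)" by (simp add: lborel_prod)
    have bound: "norm (Kn t l) \<le> norm (indicator {0..\<tau>} t * (H * (exp (rate * \<tau>) * dom \<tau> l)))" for t l
      proof (cases "t \<in> {0..\<tau>} \<and> - t < l")
        case True
        then have "\<bar>hh t (Q v t l) * wt v l\<bar> \<le> H * ((1 + Q v t l) * wt v l)"
          using Q_nonneg[of v t l] wt_nonneg[OF v, of l] H_nn H[of t "Q v t l"]
          unfolding abs_mult by (intro mult_mono) (auto simp: distrib_right)
        also have "\<dots> \<le> H * (exp (rate * \<tau>) * dom \<tau> l)"
          using True H_nn by (intro mult_left_mono weighted_bound v) auto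
        also have "\<dots> \<le> \<bar>H * (exp (rate * \<tau>) * dom \<tau> l)\<bar>" by simp
        finally show ?thesis using True by (simp add: Kn_def)
      qed (auto simp: Kn_def)
    show "AE p in lborel \<Otimes>\<^sub>M lborel. norm (case p of (t, l) \<Rightarrow> Kn t l)
        \<le> norm (case p of (t, l) \<Rightarrow> indicator {0..\<tau>} t * (H * (exp (rate * \<tau>) * dom \<tau> l)))"
    proof (rule AE_I2)
      fix p :: "real \<times> real"
      show "norm (case p of (t, l) \<Rightarrow> Kn t l)
        \<le> norm (case p of (t, l) \<Rightarrow> indicator {0..\<tau>} t * (H * (exp (rate * \<tau>) * dom \<tau> l)))"
        using bound[of "fst p" "snd p"] by (simp only: case_prod_beta)
    qed
  qed
  \<comment> \<open>The value at the upper end \<open>\<tau>\<close> vanishes because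
    \<open>\<tau> > T'\<close>. The lower end is time 0 at position \<open>l\<close> if
    \<open>l > 0\<close>, and time \<open>- l\<close> at position 0 if
    \<open>l \<le> 0\<close>.\<close>
  have inner: "(LINT t|lborel. Kn t l) = indicator {- \<tau><..} l * (wt v l * (- \<phi> (max 0 (- l)) (max l 0)))" for l
  proof (cases "- \<tau> < l")
    case False
    then have "Kn t l = 0" for t by (auto simp: Kn_def indicator_def)
    then show ?thesis using False by simp
  next
    case True
    define s0 where "s0 = max 0 (- l)"
    have s0: "0 \<le> s0" "s0 < \<tau>" using True tau by (auto simp: s0_def)
    have Qc: "continuous_on {s0..\<tau>} (\<lambda>t. Q v t l)"
      by (rule continuous_on_subset[OF Q_time_continuous[OF v]]) (use s0 in auto)
    have hc: "continuous_on {s0..\<tau>} (\<lambda>t. hh t (Q v t l))"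
      using continuous_on_compose2[OF hh_cont continuous_on_Pair[OF continuous_on_id Qc]] by simp
    have phic: "continuous_on {s0..\<tau>} (\<lambda>t. \<phi> t (Q v t l))"
    proof -
      have "continuous_on UNIV (\<lambda>z. \<phi> (fst z) (snd z))"
      proof -
        have "isCont (\<lambda>z. \<phi> (fst z) (snd z)) (s, y)" for s y
          using has_derivative_continuous[OF has_derivative_of_partials[OF dt dx cx], of s y] by (simp add: case_prod_beta')
        then show ?thesis by (simp add: continuous_on_eq_continuous_at split_paired_all)
      qed
      from continuous_on_compose2[OF this continuous_on_Pair[OF continuous_on_id Qc]] show ?thesis by simp
    qed
    have "((\<lambda>t. hh t (Q v t l)) has_integral \<phi> \<tau> (Q v \<tau> l) - \<phi> s0 (Q v s0 l)) {s0..\<tau>}"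
    proof (rule fundamental_theorem_of_calculus_interior[OF _ phic])
      fix t assume t: "t \<in> {s0<..<\<tau>}"
      have "((\<lambda>t. \<phi> t (Q v t l)) has_real_derivative \<phi>t t (Q v t l) + \<phi>x t (Q v t l) * (a (Q v t l) * v t - b (Q v t l))) (at t)"
        using t by (intro has_real_derivative_along_curve[OF dt dx cx] Q_time_deriv[OF v]) (auto simp: s0_def)
      also have "\<phi>t t (Q v t l) + \<phi>x t (Q v t l) * (a (Q v t l) * v t - b (Q v t l)) = hh t (Q v t l)"
        using Q_nonneg[of v t l] by (simp add: hh_def max_def)
      finally show "((\<lambda>t. \<phi> t (Q v t l)) has_vector_derivative hh t (Q v t l)) (at t)"
        by (simp add: has_real_derivative_iff_has_vector_derivative)
    qed (use s0 in simp)
    then have "integral {s0..\<tau>} (\<lambda>t. hh t (Q v t l)) = - \<phi> s0 (max l 0)"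
      using supp[of \<tau> "Q v \<tau> l"] tau Q_nonneg[of v \<tau> l] Q_start[OF v, of l] by (simp add: integral_unique s0_def)
    moreover have "(LINT t:{s0..\<tau>}|lborel. hh t (Q v t l)) = integral {s0..\<tau>} (\<lambda>t. hh t (Q v t l))"
      by (intro set_borel_integral_eq_integral(2) borel_integrable_atLeastAtMost' hc)
    \<comment> \<open>The integrands differ at most at the entrance time
      \<open>t = - l\<close>.\<close>
    moreover have "(LINT t|lborel. Kn t l) = (LINT t|lborel. (indicator {s0..\<tau>} t *\<^sub>R hh t (Q v t l)) * wt v l)"
    proof (rule integral_cong_AE)
      have hcm: "(\<lambda>t. indicator {s0..\<tau>} t *\<^sub>R hh t (Q v t l)) \<in> borel_measurable lborel"
        using borel_integrable_atLeastAtMost'[OF hc] unfolding set_integrable_def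
        by (rule borel_measurable_integrable)
      then show m1: "(\<lambda>t. (indicator {s0..\<tau>} t *\<^sub>R hh t (Q v t l)) * wt v l) \<in> borel_measurable lborel"
        by measurable
      have "(\<lambda>t. indicator {- l<..} t * ((indicator {s0..\<tau>} t *\<^sub>R hh t (Q v t l)) * wt v l)) \<in> borel_measurable lborel"
        using m1 by measurable
      also have "(\<lambda>t. indicator {- l<..} t * ((indicator {s0..\<tau>} t *\<^sub>R hh t (Q v t l)) * wt v l)) = (\<lambda>t. Kn t l)"
        by (rule ext) (auto simp: Kn_def indicator_def s0_def)
      finally show "(\<lambda>t. Kn t l) \<in> borel_measurable lborel" .
      show "AE t in lborel. Kn t l = (indicator {s0..\<tau>} t *\<^sub>R hh t (Q v t l)) * wt v l"
        using AE_lborel_singleton[of "- l"]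
        by eventually_elim (auto simp: Kn_def indicator_def s0_def)
    qed
    moreover have "(LINT t|lborel. (indicator {s0..\<tau>} t *\<^sub>R hh t (Q v t l)) * wt v l) = (LINT t:{s0..\<tau>}|lborel. hh t (Q v t l)) * wt v l"
      unfolding set_lebesgue_integral_def by (rule Bochner_Integration.integral_mult_left_zero)
    ultimately show ?thesis using True by (simp add: s0_def)
  qed
  have "compact (\<phi> 0 ` {0..R'})" by (intro compact_continuous_image continuous_on_subset[OF phi_cont_x]) auto
  then obtain B0 where B0: "\<forall>x\<in>{0..R'}. \<bar>\<phi> 0 x\<bar> \<le> B0" by (auto dest!: compact_imp_bounded simp: bounded_iff)
  have phi0: "\<bar>\<phi> 0 x\<bar> \<le> max B0 0" if "0 < x" for x
  proof (cases "x \<le> R'")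
    case True
    then show ?thesis using B0[rule_format, of x] that by simp
  next
    case False
    then have "\<phi> 0 x = 0" using that by (intro supp) (auto simp: R'_def)
    then show ?thesis by simp
  qed
  show int_fin: "set_integrable lborel {0<..} (\<lambda>x. \<phi> 0 x * fin x)"
    unfolding set_integrable_def
  proof (rule Bochner_Integration.integrable_bound)
    show "integrable lborel (\<lambda>x. max B0 0 * (indicator {0<..} x *\<^sub>R fin x))"
      using fin_integrable unfolding set_integrable_def by (rule integrable_mult_right)
    have [measurable]: "\<phi> 0 \<in> borel_measurable borel" by (rule borel_measurable_continuous_onI[OF phi_cont_x])
    have "(\<lambda>x. \<phi> 0 x * (indicator {0<..} x * fin x)) \<in> borel_measurable borel" by measurable
    then show "(\<lambda>x. indicator {0<..} x *\<^sub>R (\<phi> 0 x * fin x)) \<in> borel_measurable lborel" by (simp add: mult_ac)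
    show "AE x in lborel. norm (indicator {0<..} x *\<^sub>R (\<phi> 0 x * fin x)) \<le> norm (max B0 0 * (indicator {0<..} x *\<^sub>R fin x))"
    proof (rule AE_I2)
      fix x :: real
      show "norm (indicator {0<..} x *\<^sub>R (\<phi> 0 x * fin x)) \<le> norm (max B0 0 * (indicator {0<..} x *\<^sub>R fin x))"
        using phi0[of x] by (cases "0 < x") (auto simp: abs_mult intro!: mult_right_mono)
    qed
  qed
  have n_cont': "continuous_on UNIV (\<lambda>t. n (v t))"
    by (rule continuous_on_compose2[OF n_cont admD(1)[OF v]]) (use admD(2)[OF v] in \<open>auto intro: less_imp_le\<close>)
  show int_bd: "set_integrable lborel {0..<\<tau>} (\<lambda>t. \<phi> t 0 * n (v t))"
    by (rule set_integrable_bounded_interval[where a = 0 and b = \<tau>])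
       (auto intro!: continuous_on_mult continuous_on_subset[OF n_cont'] continuous_on_subset[OF phi_cont_t])
  have "(LINT z:({0..\<tau>} \<times> {0<..})|lborel. ?G z) = (LINT p|(lborel \<Otimes>\<^sub>M lborel). F p)"
    unfolding set_lebesgue_integral_def GF by (simp add: lborel_prod)
  also have "\<dots> = (LINT t|lborel. LINT x|lborel. F (t, x))"
    by (rule lborel_pair.integral_fst'[OF F_int, symmetric])
  also have "\<dots> = (LINT t|lborel. LINT l|lborel. Kn t l)"
  proof (rule Bochner_Integration.integral_cong[OF refl])
    fix t :: real
    show "(LINT x|lborel. F (t, x)) = (LINT l|lborel. Kn t l)"
    proof (cases "t \<in> {0..\<tau>}")
      case True
      then have "(LINT x:{0<..}|lborel. hh t x * dens v t x) = (LINT l:{- t<..}|lborel. hh t (Q v t l) * wt v l)"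
        by (intro pushforward(2)[OF v _ hm]) auto
      then show ?thesis using True by (simp add: F_slice Kn_def set_lebesgue_integral_def)
    qed (simp add: F_slice Kn_def)
  qed
  also have "\<dots> = (LINT l|lborel. LINT t|lborel. Kn t l)"
    by (rule lborel_pair.Fubini_integral[OF Kn_int, symmetric])
  also have "\<dots> = (LINT l|lborel. - (indicator {0<..} l *\<^sub>R (\<phi> 0 l * fin l)) - indicator {- \<tau><..0} l *\<^sub>R (\<phi> (- l) 0 * n (v (- l))))"
    using tau by (intro Bochner_Integration.integral_cong refl) (auto simp: inner indicator_def wt_def max_def)
  also have "\<dots> = - (LINT x:{0<..}|lborel. \<phi> 0 x * fin x) - (LINT l:{- \<tau><..0}|lborel. \<phi> (- l) 0 * n (v (- l)))"
  proof -
    have "set_integrable lborel {- \<tau><..0} (\<lambda>l. \<phi> (- l) 0 * n (v (- l)))"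
    proof (rule set_integrable_bounded_interval[where a = "- \<tau>" and b = 0])
      have "continuous_on UNIV (\<lambda>t. \<phi> t 0 * n (v t))" by (intro continuous_on_mult n_cont' phi_cont_t)
      from continuous_on_compose2[OF this continuous_on_minus[OF continuous_on_id]]
      show "continuous_on {- \<tau>..0} (\<lambda>l. \<phi> (- l) 0 * n (v (- l)))" by simp
    qed auto
    then show ?thesis using int_fin unfolding set_lebesgue_integral_def set_integrable_def by simp
  qed
  \<comment> \<open>Reflection turns labels back into entrance times; this is where the half-open
    interval \<open>{0..<\<tau>}\<close> of the boundary term comes from.\<close>
  also have "(LINT l:{- \<tau><..0}|lborel. \<phi> (- l) 0 * n (v (- l))) = (LINT t:{0..<\<tau>}|lborel. \<phi> t 0 * n (v t))"
  proof -
    have "{x. - x \<in> {0..<\<tau>}} = {- \<tau><..0}" by auto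
    then show ?thesis by (subst set_integral_reflect[of "{0..<\<tau>}"]) simp
  qed
  finally show "(LINT z:({0..\<tau>} \<times> {0<..})|lborel. ?G z) + (LINT t:{0..<\<tau>}|lborel. \<phi> t 0 * n (v t))
      + (LINT x:{0<..}|lborel. \<phi> 0 x * fin x) = 0" by simp
qed

section \<open>The boundary value of the flux\<close>

text \<open>With \<open>l\<close> the label found at \<open>x\<close>, the flux is
  \<open>(v t - Psi (A x)) * n (v (- l)) / (J * (v (- l) - p0))\<close>, in which \<open>a x\<close>
  has cancelled. As \<open>x\<close> tends to 0, \<open>l\<close> tends to \<open>- t\<close>,
  \<open>J\<close> to 1 and \<open>Psi (A x)\<close> to \<open>p0\<close>, so the two speeds cancel
  and \<open>n (v t)\<close> remains.\<close>

lemma boundary_flux: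
  assumes v: "adm v" and t: "0 < t"
  shows "((\<lambda>x. (a x * v t - b x) * dens v t x) \<longlongrightarrow> n (v t)) (at_right 0)"
proof -
  have t0: "0 \<le> t" using t by simp
  obtain d eta where st: "strip v d eta" using strip_exists[OF v zero_less_one] by blast
  have d: "0 < d" "0 < eta" using st by (auto simp: strip_def)
  have pos: "\<forall>\<^sub>F x in at_right (0::real). 0 < x" by (rule eventually_at_right_less)
  have below: "\<forall>\<^sub>F x in at_right 0. lab v t x < c" if "- t < c" for c
  proof -
    have "\<forall>\<^sub>F x in at_right 0. x < Q v t c"
      using order_tendstoD(2)[OF tendsto_ident_at Q_pos[OF v t0 that]] .
    with pos show ?thesis by eventually_elim (simp add: lab_less_iff[OF v t0])
  qed
  have lab_lim: "((\<lambda>x. lab v t x) \<longlongrightarrow> - t) (at_right 0)"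
  proof (rule order_tendstoI)
    show "\<forall>\<^sub>F x in at_right 0. c < lab v t x" if "c < - t" for c
      using pos by eventually_elim (use lab(1)[OF v t0] that in force)
  qed (rule below)
  have A_lim: "(A \<longlongrightarrow> 0) (at_right 0)"
  proof -
    have "(A \<longlongrightarrow> A 0) (at 0 within {0..})"
      using A_continuous[unfolded continuous_on_def, rule_format, of 0] by simp
    then show ?thesis by (auto intro: tendsto_within_subset)
  qed
  \<comment> \<open>For negative labels this recovers the derivative of the flow in its starting
    point, whose logarithm is bounded by \<open>flow_diff_strip\<close>.\<close>
  define J where "J x = Qd v t (lab v t x) / (a x * (v (- lab v t x) - p0))" for x
  have "\<forall>\<^sub>F x in at_right 0. A x < eta" by (rule order_tendstoD(2)[OF A_lim d(2)])
  with pos below[of 0] t have ev: "\<forall>\<^sub>F x in at_right 0. 0 < x \<and> lab v t x < 0 \<and> A x < eta"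
    by (auto intro: eventually_conj)
  have J: "0 < J x \<and> \<bar>ln (J x)\<bar> \<le> Var (A x) / (2 * d) \<and>
      (a x * v t - b x) * dens v t x = (v t - Psi (A x)) * n (v (- lab v t x)) / (J x * (v (- lab v t x) - p0))"
    if x: "0 < x" "lab v t x < 0" "A x < eta" for x
  proof -
    let ?l = "lab v t x"
    have l: "- t < ?l" "Q v t ?l = x" by (rule lab[OF v t0 x(1)])+
    obtain J' where J': "0 < J'" "((\<lambda>z. flow v z t) has_real_derivative J') (at (zeta v ?l))"
      "Qd v t ?l = a (Q v t ?l) * (J' * (v (- ?l) - p0))"
      using Q_label_deriv[OF v t0 l(1) zeta_deriv_neg[OF v x(2)]] by metis
    have ax: "0 < a x" by (rule a_pos[OF x(1)])
    have vl: "0 < v (- ?l) - p0" using admD(2)[OF v, of "- ?l"] by simp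
    have JJ: "J x = J'" using J'(3) l(2) ax vl by (simp add: J_def)
    have fl: "flow v (zeta v ?l) t = A x" using A_Q[OF v t0 l(1)] l(2) by simp
    have "\<bar>ln J'\<bar> \<le> Var (A x) / (2 * d)"
      using flow_diff_strip[OF v st t0 _ J'(2,1)] x(3) unfolding fl by simp
    moreover have "dens v t x = n (v (- ?l)) / (a x * (J' * (v (- ?l) - p0)))"
      using x J'(3) l(2) by (simp add: push_def wt_def)
    moreover have "a x * v t - b x = a x * (v t - Psi (A x))"
      using ax x(1) A_pos[OF x(1)] by (simp add: Psi_def Phi_def right_diff_distrib)
    ultimately show ?thesis using J'(1) ax by (simp add: JJ)
  qed
  have isC: "isCont Psi 0" "isCont Var 0"
    using Psi_cont V_cont by (auto simp: continuous_on_eq_continuous_at)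
  have Var_lim: "((\<lambda>x. Var (A x) / (2 * d)) \<longlongrightarrow> 0 / (2 * d)) (at_right 0)"
    using isCont_tendsto_compose[OF isC(2) A_lim] d V_le0[of 0] by (intro tendsto_intros) auto
  have "((\<lambda>x. ln (J x)) \<longlongrightarrow> 0) (at_right 0)"
  proof (rule Lim_null_comparison)
    show "\<forall>\<^sub>F x in at_right 0. norm (ln (J x)) \<le> Var (A x) / (2 * d)"
      using ev by eventually_elim (use J in auto)
    show "((\<lambda>x. Var (A x) / (2 * d)) \<longlongrightarrow> 0) (at_right 0)" using Var_lim by simp
  qed
  then have "((\<lambda>x. exp (ln (J x))) \<longlongrightarrow> exp 0) (at_right 0)" by (intro tendsto_intros)
  moreover have "\<forall>\<^sub>F x in at_right 0. exp (ln (J x)) = J x"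
    using ev by eventually_elim (use J in auto)
  ultimately have J_lim: "(J \<longlongrightarrow> 1) (at_right 0)" using Lim_transform_eventually by fastforce
  have v_lim: "((\<lambda>x. v (- lab v t x)) \<longlongrightarrow> v t) (at_right 0)"
    using continuous_on_tendsto_compose[OF admD(1)[OF v, of UNIV] tendsto_minus[OF lab_lim]] by simp
  have n_lim: "((\<lambda>x. n (v (- lab v t x))) \<longlongrightarrow> n (v t)) (at_right 0)"
    using admD(2)[OF v]
    by (intro continuous_on_tendsto_compose[OF n_cont v_lim]) (auto intro!: always_eventually less_imp_le)
  have Psi_lim: "((\<lambda>x. Psi (A x)) \<longlongrightarrow> p0) (at_right 0)"
    using isCont_tendsto_compose[OF isC(1) A_lim] by (simp add: Psi_le0)
  have vp: "v t - p0 \<noteq> 0" using admD(2)[OF v, of t] by simp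
  have "((\<lambda>x. (v t - Psi (A x)) * n (v (- lab v t x)) / (J x * (v (- lab v t x) - p0)))
      \<longlongrightarrow> (v t - p0) * n (v t) / (1 * (v t - p0))) (at_right 0)"
    using vp by (intro tendsto_intros Psi_lim n_lim J_lim v_lim) auto
  moreover have "\<forall>\<^sub>F x in at_right 0. (v t - Psi (A x)) * n (v (- lab v t x)) / (J x * (v (- lab v t x) - p0))
      = (a x * v t - b x) * dens v t x"
    using ev by eventually_elim (use J in auto)
  ultimately show ?thesis using vp Lim_transform_eventually by fastforce
qed

section \<open>The monomer concentration\<close>

lemma uin_bounds: "p0 < uin" "uin \<le> rho"
proof -
  show "p0 < uin" using uin by (simp add: uin_def)
  have "0 \<le> (LINT x:{0<..}|lborel. x * fin x)"
    unfolding set_lebesgue_integral_def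
    by (intro Bochner_Integration.integral_nonneg) (simp add: fin_nonneg indicator_def)
  then show "uin \<le> rho" by (simp add: uin_def)
qed

definition lipc :: "real \<Rightarrow> real" where
  "lipc N = rate * exp (rate * N) * (LINT l|lborel. dom N l)"

text \<open>Before \<open>T\<close> the concentration has a margin above \<open>p0\<close> only on
  compact time intervals; freezing it outside such an interval gives an admissible velocity.\<close>

definition stop :: "(real \<Rightarrow> real) \<Rightarrow> real \<Rightarrow> real \<Rightarrow> real" where
  "stop u \<tau> r = u (max 0 (min r \<tau>))"

lemma stop_eq: "0 \<le> r \<Longrightarrow> r \<le> \<tau> \<Longrightarrow> stop u \<tau> r = u r"
  by (simp add: stop_def)

text \<open>The uniform margin is the minimum of \<open>u - p0\<close> over the compact interval
  \<open>{0..\<tau>}\<close>.\<close>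

lemma stop_adm:
  assumes c: "continuous_on {0..} u" and tau: "0 \<le> \<tau>"
    and lo: "\<And>r. 0 \<le> r \<Longrightarrow> r \<le> \<tau> \<Longrightarrow> p0 < u r" and hi: "\<And>r. 0 \<le> r \<Longrightarrow> u r \<le> rho"
  shows "adm (stop u \<tau>)"
proof -
  have cont: "continuous_on UNIV (stop u \<tau>)"
    unfolding stop_def by (rule continuous_on_compose2[OF c]) (auto intro!: continuous_intros)
  have "\<exists>x\<in>{0..\<tau>}. \<forall>y\<in>{0..\<tau>}. u x \<le> u y"
    using tau by (intro continuous_attains_inf continuous_on_subset[OF c]) auto
  then obtain x where x: "0 \<le> x" "x \<le> \<tau>" "\<And>y. 0 \<le> y \<Longrightarrow> y \<le> \<tau> \<Longrightarrow> u x \<le> u y" by auto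
  have "p0 + (u x - p0) \<le> stop u \<tau> t" for t
    using x(3)[of "max 0 (min t \<tau>)"] tau by (simp add: stop_def)
  moreover have "0 < u x - p0" using lo[OF x(1,2)] by simp
  ultimately have "\<exists>d>0. \<forall>t. p0 + d \<le> stop u \<tau> t" by blast
  moreover have "stop u \<tau> t \<le> rho" for t unfolding stop_def by (rule hi) simp
  ultimately show ?thesis unfolding adm_def using cont by blast
qed

text \<open>The delayed velocity is truncated at \<open>p0 + h\<close>, so it is admissible whatever
  \<open>g\<close> does and the steps never stop. Compactness comes from
  \<open>Gam_lipschitz\<close>, and \<open>Gam_stability\<close> identifies the limit. A fixed point
  results only on intervals where \<open>u > p0\<close>, hence the conclusion in terms of
  \<open>stop u \<tau>\<close>.\<close>

lemma concentration_exists: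
  obtains u where "u 0 = uin" "\<And>t. 0 \<le> t \<Longrightarrow> u t \<le> rho" "continuous_on {0..} u"
    "\<And>\<tau> t. 0 \<le> \<tau> \<Longrightarrow> (\<And>r. 0 \<le> r \<Longrightarrow> r \<le> \<tau> \<Longrightarrow> p0 < u r) \<Longrightarrow> 0 \<le> t \<Longrightarrow> t \<le> \<tau> \<Longrightarrow> u t = Gam (stop u \<tau>) t"
proof -
  define V where "V h g r = max (g (r - h)) (p0 + h)" for h :: real and g and r :: real
  define P where "P g \<longleftrightarrow> continuous_on UNIV g \<and> (\<forall>t. g t \<le> rho)" for g :: "real \<Rightarrow> real"
  \<comment> \<open>The first delay is \<open>uin - p0\<close>, so the truncation level
    \<open>p0 + ?h k\<close> never exceeds \<open>uin\<close> and thus \<open>rho\<close>, as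
    admissibility requires.\<close>
  let ?h = "\<lambda>k :: nat. (uin - p0) / (real k + 1)"
  have h: "0 < ?h k" "p0 + ?h k \<le> rho" for k
  proof -
    show "0 < ?h k" using uin_bounds by simp
    have "?h k \<le> uin - p0" using uin_bounds(1) by (simp add: divide_le_eq)
    then show "p0 + ?h k \<le> rho" using uin_bounds by simp
  qed
  have V_adm: "adm (V h g)" if "P g" "0 < h" "p0 + h \<le> rho" for h g
  proof -
    have gc: "continuous_on UNIV g" using that by (simp add: P_def)
    have "continuous_on UNIV (\<lambda>r. g (r - h))"
      by (rule continuous_on_compose2[OF gc]) (auto intro!: continuous_intros)
    then show ?thesis
      using that by (auto simp: adm_def V_def P_def intro!: continuous_on_max exI[of _ h])
  qed
  have Gam_cont: "continuous_on UNIV (\<lambda>t. Gam v (max 0 t))" if v: "adm v" for v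
  proof -
    have "isCont (\<lambda>t. Gam v (max 0 t)) t" for t
    proof -
      let ?N = "max 0 t + 1"
      have "((\<lambda>s. Gam v (max 0 s) - Gam v (max 0 t)) \<longlongrightarrow> 0) (at t)"
      proof (rule Lim_null_comparison)
        have "\<forall>\<^sub>F s in at t. s \<in> {..<t + 1}" by (rule eventually_at_in_open') auto
        then show "\<forall>\<^sub>F s in at t. norm (Gam v (max 0 s) - Gam v (max 0 t)) \<le> lipc ?N * \<bar>max 0 s - max 0 t\<bar>"
          by eventually_elim (unfold lipc_def real_norm_def, intro Gam_lipschitz v, auto)
        show "((\<lambda>s. lipc ?N * \<bar>max 0 s - max 0 t\<bar>) \<longlongrightarrow> 0) (at t)"
          by (rule tendsto_eq_intros refl | simp)+
      qed
      then show ?thesis unfolding isCont_def by (simp add: LIM_zero_iff)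
    qed
    then show ?thesis by (simp add: continuous_on_eq_continuous_at)
  qed
  have "\<exists>g. P g \<and> (\<forall>t<0. g t = uin) \<and> (\<forall>t\<ge>0. g t = Gam (V h g) (max 0 t))" if h: "0 < h" "p0 + h \<le> rho" for h
  proof -
    have causal: "Gam (V h g) (max 0 t) = Gam (V h g') (max 0 t)"
      if "P g" "P g'" "\<And>r. r \<le> t - h \<Longrightarrow> g r = g' r" for g g' t
    proof (cases "0 \<le> t")
      case True
      then show ?thesis using that by (intro causal_Gam V_adm h) (auto simp: V_def)
    next
      case False
      then show ?thesis using that h by (simp add: max_def Gam_0 V_adm)
    qed
    have P0: "P (\<lambda>_. uin)" using uin_bounds by (simp add: P_def)
    have Pstep: "P (\<lambda>t. if t < 0 then uin else Gam (V h g) (max 0 t))" if "P g" for g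
    proof -
      have adm: "adm (V h g)" by (rule V_adm[OF that h])
      have "(\<lambda>t. if t < 0 then uin else Gam (V h g) (max 0 t)) = (\<lambda>t. Gam (V h g) (max 0 t))"
        using Gam_0[OF adm] by (auto simp: max_def)
      then show ?thesis using Gam_cont[OF adm] Gam_le[OF adm] by (simp add: P_def)
    qed
    have Ploc: "P g" if loc: "\<And>N. \<exists>g'. P g' \<and> (\<forall>t\<le>N. g t = g' t)" for g
    proof -
      have "continuous_on UNIV g"
        using loc unfolding P_def by (intro continuous_on_UNIV_if_agrees) blast
      moreover have "g t \<le> rho" for t using loc[of t] by (auto simp: P_def)
      ultimately show ?thesis by (simp add: P_def)
    qed
    obtain g where g: "P g" "\<And>t. t < 0 \<Longrightarrow> g t = uin" "\<And>t. 0 \<le> t \<Longrightarrow> g t = Gam (V h g) (max 0 t)"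
      using delay_fixpoint[where P = P and \<Delta> = "\<lambda>g t. Gam (V h g) (max 0 t)" and c = uin, OF h(1) causal P0 Pstep Ploc]
      by blast
    then show ?thesis by blast
  qed
  then have "\<forall>k. \<exists>g. P g \<and> (\<forall>t<0. g t = uin) \<and> (\<forall>t\<ge>0. g t = Gam (V (?h k) g) (max 0 t))" using h by blast
  from choice[OF this] obtain g where g: "\<And>k. P (g k)" "\<And>k t. t < 0 \<Longrightarrow> g k t = uin"
    "\<And>k t. 0 \<le> t \<Longrightarrow> g k t = Gam (V (?h k) (g k)) (max 0 t)" by blast
  have adm: "adm (V (?h k) (g k))" for k by (rule V_adm[OF g(1) h])
  have g': "g k t = Gam (V (?h k) (g k)) t" if "0 \<le> t" for k t using g(3)[OF that] that by (simp add: max_def)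
  have g0: "g k 0 = uin" for k using g'[of 0 k] Gam_0[OF adm] by simp
  have lip: "\<bar>g k s - g k t\<bar> \<le> lipc N * \<bar>s - t\<bar>" if "0 \<le> s" "0 \<le> t" "s \<le> N" "t \<le> N" for k s t N
    using Gam_lipschitz[OF adm, of t s N k] that by (simp add: g' lipc_def)
  have "\<bar>g k t\<bar> \<le> \<bar>uin\<bar> + lipc t * t" if "0 \<le> t" for k t
  proof -
    have "\<bar>g k t - uin\<bar> \<le> lipc t * t" using lip[of t 0 t k] that by (simp add: g0)
    then show ?thesis by linarith
  qed
  moreover have "\<exists>L. \<forall>k. \<forall>s\<in>{0..N}. \<forall>t\<in>{0..N}. \<bar>g k s - g k t\<bar> \<le> L * \<bar>s - t\<bar>" for N
    using lip by (intro exI[of _ "lipc N"]) auto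
  ultimately obtain r u where r: "strict_mono (r :: nat \<Rightarrow> nat)"
    and u: "\<And>t. 0 \<le> t \<Longrightarrow> (\<lambda>k. g (r k) t) \<longlonglongrightarrow> u t"
    using locally_lipschitz_subsequence[of g "\<lambda>t. \<bar>uin\<bar> + lipc t * t"] by blast
  have u_lip: "\<bar>u s - u t\<bar> \<le> lipc N * \<bar>s - t\<bar>" if "0 \<le> s" "0 \<le> t" "s \<le> N" "t \<le> N" for s t N
  proof (rule tendsto_upperbound)
    show "(\<lambda>k. \<bar>g (r k) s - g (r k) t\<bar>) \<longlonglongrightarrow> \<bar>u s - u t\<bar>" by (intro tendsto_intros u that)
    show "\<forall>\<^sub>F k in sequentially. \<bar>g (r k) s - g (r k) t\<bar> \<le> lipc N * \<bar>s - t\<bar>"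
      using lip[OF that] by simp
  qed simp
  have u0: "u 0 = uin" using LIMSEQ_unique[OF u[of 0]] g0 by simp
  have u_le: "u t \<le> rho" if "0 \<le> t" for t
    by (rule tendsto_upperbound[OF u[OF that]]) (use g(1) in \<open>auto simp: P_def\<close>)
  have u_cont: "continuous_on {0..} u"
  proof -
    have "continuous (at t within {0..}) u" if t: "0 \<le> t" for t
    proof -
      have "((\<lambda>s. u s - u t) \<longlongrightarrow> 0) (at t within {0..})"
      proof (rule Lim_null_comparison)
        have "\<forall>\<^sub>F s in at t within {0..}. s \<in> {..<t + 1}"
          by (rule filter_leD[OF at_le[OF subset_UNIV] eventually_at_in_open']) auto
        moreover have "\<forall>\<^sub>F s in at t within {0..}. s \<in> {0..}" by (simp add: eventually_at_filter)
        ultimately show "\<forall>\<^sub>F s in at t within {0..}. norm (u s - u t) \<le> lipc (t + 1) * \<bar>s - t\<bar>"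
          by eventually_elim (use t in \<open>unfold real_norm_def, intro u_lip, auto\<close>)
        show "((\<lambda>s. lipc (t + 1) * \<bar>s - t\<bar>) \<longlongrightarrow> 0) (at t within {0..})"
          by (rule tendsto_eq_intros refl | simp)+
      qed
      then show ?thesis unfolding continuous_within by (simp add: LIM_zero_iff)
    qed
    then show ?thesis by (simp add: continuous_on_eq_continuous_within)
  qed
  have h0: "(\<lambda>k. ?h (r k)) \<longlonglongrightarrow> 0"
  proof -
    have "(\<lambda>k. (uin - p0) * inverse (real (Suc k))) \<longlonglongrightarrow> (uin - p0) * 0"
      by (intro tendsto_intros LIMSEQ_inverse_real_of_nat)
    then have "?h \<longlonglongrightarrow> 0" by (simp add: divide_inverse add.commute)
    from LIMSEQ_subseq_LIMSEQ[OF this r] show ?thesis by (simp add: o_def)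
  qed
  \<comment> \<open>Delay and truncation disappear together and leave \<open>max (u s) p0\<close>,
    which is \<open>u s\<close> as long as \<open>u\<close> exceeds \<open>p0\<close>.\<close>
  have V_lim: "(\<lambda>k. V (?h (r k)) (g (r k)) s) \<longlonglongrightarrow> max (u s) p0" if s: "0 \<le> s" for s
  proof -
    have "(\<lambda>k. g (r k) (s - ?h (r k)) - g (r k) s) \<longlonglongrightarrow> 0"
    proof (rule Lim_null_comparison[OF _ tendsto_mult_right_zero[OF h0, of "\<bar>lipc s\<bar>"]], rule always_eventually, rule allI)
      fix k
      let ?s = "s - ?h (r k)"
      have hp: "0 < ?h (r k)" by (rule h)
      have "\<bar>g (r k) (max ?s 0) - g (r k) s\<bar> \<le> lipc s * \<bar>max ?s 0 - s\<bar>"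
        using s hp by (intro lip) auto
      also have "\<dots> \<le> \<bar>lipc s\<bar> * ?h (r k)"
        using s hp by (intro mult_mono) auto
      also have "g (r k) (max ?s 0) = g (r k) ?s"
      proof (cases "?s < 0")
        case True
        then have "max ?s 0 = 0" by linarith
        then show ?thesis using g(2)[OF True] g0 by metis
      next
        case False
        then have "max ?s 0 = ?s" by linarith
        then show ?thesis by metis
      qed
      finally show "norm (g (r k) ?s - g (r k) s) \<le> \<bar>lipc s\<bar> * ?h (r k)" by simp
    qed
    from tendsto_add[OF this u[OF s]] have "(\<lambda>k. g (r k) (s - ?h (r k))) \<longlonglongrightarrow> u s" by simp
    then have "(\<lambda>k. V (?h (r k)) (g (r k)) s) \<longlonglongrightarrow> max (u s) (p0 + 0)"
      unfolding V_def by (intro tendsto_intros h0)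
    then show ?thesis by simp
  qed
  have "u t = Gam (stop u \<tau>) t"
    if tau: "0 \<le> \<tau>" and lo: "\<And>r. 0 \<le> r \<Longrightarrow> r \<le> \<tau> \<Longrightarrow> p0 < u r" and t: "0 \<le> t" "t \<le> \<tau>" for \<tau> t
  proof (rule LIMSEQ_unique[OF u[OF t(1)]])
    have "(\<lambda>k. Gam (V (?h (r k)) (g (r k))) t) \<longlonglongrightarrow> Gam (stop u \<tau>) t"
    proof (rule Gam_stability[OF _ adm _ t])
      show "adm (stop u \<tau>)" by (rule stop_adm[OF u_cont tau lo u_le])
      show "(\<lambda>k. V (?h (r k)) (g (r k)) s) \<longlonglongrightarrow> stop u \<tau> s" if "0 \<le> s" "s \<le> \<tau>" for s
        using V_lim[OF that(1)] lo[OF that] that by (simp add: stop_eq max_def)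
    qed
    then show "(\<lambda>k. g (r k) t) \<longlonglongrightarrow> Gam (stop u \<tau>) t" using g'[OF t(1)] by simp
  qed
  with u0 u_le u_cont that show thesis by blast
qed

end

lemma continuous_on_tint:
  assumes "\<And>\<tau>. \<tau> \<in> tint T \<Longrightarrow> continuous_on {0..\<tau>} F"
  shows "continuous_on (tint T) F"
proof -
  have "continuous (at t within tint T) F" if t: "t \<in> tint T" for t
  proof -
    obtain \<tau> where tau: "t < \<tau>" "ereal \<tau> < T"
      using t ereal_dense2[of "ereal t" T] by (auto simp: tint_def)
    then have "\<tau> \<in> tint T" using t by (auto simp: tint_def)
    then have "continuous (at t within {0..\<tau>}) F"
      using assms t tau by (auto simp: continuous_on_eq_continuous_within tint_def)
    moreover have "at t within tint T = at t within {0..\<tau>}"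
    proof (rule at_within_nhd[of _ "{..<\<tau>}"])
      show "tint T \<inter> {..<\<tau>} - {t} = {0..\<tau>} \<inter> {..<\<tau>} - {t}"
        using tau(2) by (auto simp: tint_def) (metis ereal_less_eq(3) less_imp_le order_le_less_trans)
    qed (use tau in auto)
    ultimately show ?thesis by (simp add: continuous_within)
  qed
  then show ?thesis by (simp add: continuous_on_eq_continuous_within)
qed

section \<open>Assembling the solution and its final time\<close>

context ls_data
begin

lemma dens_L1_bound:
  assumes v: "adm v" and t: "0 \<le> t" "t \<le> N"
  shows "set_integrable lborel {0<..} (dens v t)"
    and "(LINT x:{0<..}|lborel. \<bar>dens v t x\<bar>) \<le> exp (rate * N) * (LINT l|lborel. dom N l)"
proof -
  have i: "set_integrable lborel {- t<..} (\<lambda>l. 1 * wt v l)"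
    using particle_integrable[OF v t(1) order_refl, of "\<lambda>_. 1" 1] by simp
  then have "set_integrable lborel {0<..} (\<lambda>x. 1 * dens v t x)"
    by (subst pushforward(1)[OF v t(1)]) auto
  then show "set_integrable lborel {0<..} (dens v t)" by simp
  have "(LINT x:{0<..}|lborel. \<bar>dens v t x\<bar>) = (LINT x:{0<..}|lborel. 1 * dens v t x)"
    using dens_nonneg[OF v t(1)] by (intro set_lebesgue_integral_cong) auto
  also have "\<dots> = (LINT l:{- t<..}|lborel. 1 * wt v l)"
    by (rule pushforward(2)[OF v t(1)]) simp
  also have "\<dots> \<le> (LINT l|lborel. exp (rate * N) * dom N l)"
    unfolding set_lebesgue_integral_def
  proof (rule integral_mono)
    show "integrable lborel (\<lambda>l. indicator {- t<..} l *\<^sub>R (1 * wt v l))"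
      using i by (simp add: set_integrable_def)
    show "integrable lborel (\<lambda>l. exp (rate * N) * dom N l)"
      by (intro integrable_mult_right dom_integrable)
    fix l :: real
    show "indicator {- t<..} l *\<^sub>R (1 * wt v l) \<le> exp (rate * N) * dom N l"
    proof (cases "- t < l")
      case True
      have "wt v l \<le> (1 + Q v t l) * wt v l"
        using Q_nonneg[of v t l] wt_nonneg[OF v, of l] by (simp add: distrib_right)
      also have "\<dots> \<le> exp (rate * N) * dom N l"
        using True t by (intro weighted_bound v) auto
      finally show ?thesis using True by simp
    next
      case False
      then show ?thesis using dom_nonneg[OF v, of N l] t by simp
    qed
  qed
  also have "\<dots> = exp (rate * N) * (LINT l|lborel. dom N l)" by simp
  finally show "(LINT x:{0<..}|lborel. \<bar>dens v t x\<bar>) \<le> exp (rate * N) * (LINT l|lborel. dom N l)" .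
qed

lemma dens_weighted_integrable:
  assumes v: "adm v" and t: "0 \<le> t"
  shows "set_integrable lborel {0<..} (\<lambda>x. (1 + x) * dens v t x)"
    and "set_integrable lborel {0<..} (\<lambda>x. x * dens v t x)"
proof -
  show "set_integrable lborel {0<..} (\<lambda>x. (1 + x) * dens v t x)"
    using particle_integrable[OF v t order_refl, of "\<lambda>x. 1 + x" 1]
    by (subst pushforward(1)[OF v t]) auto
  show "set_integrable lborel {0<..} (\<lambda>x. x * dens v t x)"
    using particle_integrable[OF v t order_refl, of "\<lambda>x. x" 1]
    by (subst pushforward(1)[OF v t]) auto
qed

theorem solution_exists:
  "\<exists>(T::ereal) (f::real \<Rightarrow> real \<Rightarrow> real). 0 < T \<and>
           wL1_cont (\<lambda>x. 1 + x) T f \<and>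
           LS_solution T rho a b n (ereal p0) fin f \<and>
           (AE x in lborel. 0 < x \<longrightarrow> f 0 x = fin x) \<and>
           (\<forall>t. 0 < t \<and> ereal t < T \<longrightarrow>
              ((\<lambda>x. (a x * LS_u rho f t - b x) * f t x) \<longlongrightarrow> n (LS_u rho f t)) (at_right 0)) \<and>
           (T = \<infinity> \<or> (T < \<infinity> \<and>
              ((\<lambda>t. ereal (LS_u rho f t)) \<longlongrightarrow> ereal p0) (at_left (real_of_ereal T))))"
proof -
  obtain u where u0: "u 0 = uin" and u_le: "\<And>t. 0 \<le> t \<Longrightarrow> u t \<le> rho" and u_cont: "continuous_on {0..} u"
    and u_fix: "\<And>\<tau> t. 0 \<le> \<tau> \<Longrightarrow> (\<And>r. 0 \<le> r \<Longrightarrow> r \<le> \<tau> \<Longrightarrow> p0 < u r) \<Longrightarrow> 0 \<le> t \<Longrightarrow> t \<le> \<tau> \<Longrightarrow>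
      u t = Gam (stop u \<tau>) t"
    by (rule concentration_exists) blast
  define S where "S = {t. 0 \<le> t \<and> u t \<le> p0}"
  \<comment> \<open>The limit \<open>u\<close> is defined for all times, but describes the system
    only until it first meets \<open>p0\<close>. As \<open>S\<close> is closed, \<open>Inf S\<close>
    itself belongs to it.\<close>
  define T where "T = (if S = {} then \<infinity> else ereal (Inf S))"
  have S_bdd: "bdd_below S" by (auto simp: S_def bdd_below_def)
  have above: "p0 < u t" if "0 \<le> t" "ereal t < T" for t
  proof (rule ccontr)
    assume "\<not> p0 < u t"
    then have "t \<in> S" using that by (simp add: S_def)
    then have "Inf S \<le> t" "S \<noteq> {}" using S_bdd by (auto intro: cInf_lower)
    then show False using that by (simp add: T_def)
  qed
  have Inf_S: "Inf S \<in> S" if "S \<noteq> {}"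
  proof (rule closed_contains_Inf[OF that S_bdd])
    have "closed {t \<in> {0..}. u t \<le> p0}" by (intro continuous_on_closed_Collect_le u_cont) auto
    then show "closed S" by (simp add: S_def)
  qed
  have T_pos: "0 < T"
  proof (cases "S = {}")
    case False
    then have "0 \<le> Inf S" "u (Inf S) \<le> p0" using Inf_S by (auto simp: S_def)
    moreover have "Inf S \<noteq> 0" using \<open>u (Inf S) \<le> p0\<close> u0 uin_bounds by auto
    ultimately show ?thesis using False by (simp add: T_def)
  qed (simp add: T_def)
  have before: "p0 < u r" if "\<tau> \<in> tint T" "0 \<le> r" "r \<le> \<tau>" for r \<tau>
    using above[of r] that by (auto simp: tint_def) (metis ereal_less_eq(3) order_le_less_trans)
  have adm: "adm (stop u \<tau>)" if "\<tau> \<in> tint T" for \<tau>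
    using that before by (intro stop_adm u_cont u_le) (auto simp: tint_def)
  \<comment> \<open>The velocity is frozen at the time of observation, so no final time enters the
    definition; by causality any later freezing time gives the same density, as \<open>f_eq\<close>
    records.\<close>
  define f where "f t = dens (stop u t) t" for t
  have tint_down: "t \<in> tint T" if "\<tau> \<in> tint T" "0 \<le> t" "t \<le> \<tau>" for t \<tau>
    using that by (auto simp: tint_def) (metis ereal_less_eq(3) order_le_less_trans)
  have f_eq: "f t x = dens (stop u \<tau>) t x" if "\<tau> \<in> tint T" "0 \<le> t" "t \<le> \<tau>" "0 < x" for t x \<tau>
    unfolding f_def using that
    by (intro causal_dens adm tint_down[OF that(1-3)]) (auto simp: stop_eq)
  have LSu: "LS_u rho f t = u t" if t: "t \<in> tint T" for t
  proof -
    have t0: "0 \<le> t" using t by (simp add: tint_def)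
    have "LS_u rho f t = Gam (stop u t) t"
      using Gam_dens[OF adm[OF t] t0] by (simp add: LS_u_def f_def)
    also have "\<dots> = u t" using before[OF t] t0 by (intro u_fix[symmetric]) auto
    finally show ?thesis .
  qed
  have weak: "continuous_on (tint T) (\<lambda>t. LINT x:{0<..}|lborel. \<psi> x * ((1 + x) * f t x))"
    if \<psi>: "\<psi> \<in> borel_measurable lborel" "bounded (range \<psi>)" for \<psi> :: "real \<Rightarrow> real"
  proof (rule continuous_on_tint)
    fix \<tau> assume tau: "\<tau> \<in> tint T"
    then have tau0: "0 \<le> \<tau>" by (simp add: tint_def)
    obtain B where B: "\<And>x. \<bar>\<psi> x\<bar> \<le> B" using \<psi>(2) by (auto simp: bounded_iff)
    have \<psi>m [measurable]: "\<psi> \<in> borel_measurable borel" using \<psi>(1) by simp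
    let ?v = "stop u \<tau>"
    have eq: "(LINT x:{0<..}|lborel. \<psi> x * ((1 + x) * f t x)) =
        (LINT l:{- t<..}|lborel. (\<psi> (Q ?v t l) * (1 + Q ?v t l)) * wt ?v l)" if t: "t \<in> {0..\<tau>}" for t
    proof -
      have "(LINT x:{0<..}|lborel. \<psi> x * ((1 + x) * f t x)) = (LINT x:{0<..}|lborel. (\<psi> x * (1 + x)) * dens ?v t x)"
        using f_eq[OF tau] t by (intro set_lebesgue_integral_cong) auto
      also have "\<dots> = (LINT l:{- t<..}|lborel. (\<psi> (Q ?v t l) * (1 + Q ?v t l)) * wt ?v l)"
        using t by (intro pushforward(2)[OF adm[OF tau]]) auto
      finally show ?thesis .
    qed
    show "continuous_on {0..\<tau>} (\<lambda>t. LINT x:{0<..}|lborel. \<psi> x * ((1 + x) * f t x))"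
      using weakly_continuous[OF adm[OF tau] tau0 \<psi>m B] by (subst continuous_on_cong[OF refl eq]) auto
  qed
  have wL1: "wL1_cont (\<lambda>x. 1 + x) T f"
    unfolding wL1_cont_def
    using weak dens_weighted_integrable(1)[OF adm] by (auto simp: f_def tint_def)
  have wL1x: "wL1_cont (\<lambda>x. x) T f"
    unfolding wL1_cont_def
  proof (intro conjI ballI allI impI)
    fix t assume "t \<in> tint T"
    then show "set_integrable lborel {0<..} (\<lambda>x. x * f t x)"
      unfolding f_def by (intro dens_weighted_integrable(2) adm) (auto simp: tint_def)
  next
    fix \<psi> :: "real \<Rightarrow> real" assume \<psi>: "\<psi> \<in> borel_measurable lborel \<and> bounded (range \<psi>)"
    \<comment> \<open>Weight \<open>x\<close> is reduced to weight \<open>1 + x\<close> by moving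
      the bounded factor \<open>x / (1 + x)\<close> into the test function; the indicator keeps it
      bounded where \<open>x \<le> 0\<close>.\<close>
    let ?\<psi> = "\<lambda>x. \<psi> x * (indicator {0<..} x * (x / (1 + x)))"
    have m [measurable]: "\<psi> \<in> borel_measurable borel" using \<psi> by simp
    obtain B where B: "\<And>x. \<bar>\<psi> x\<bar> \<le> B" using \<psi> by (auto simp: bounded_iff)
    have B': "\<bar>?\<psi> x\<bar> \<le> B * 1" for x
      unfolding abs_mult using order_trans[OF abs_ge_zero B]
      by (intro mult_mono B) (auto simp: indicator_def abs_mult divide_le_eq)
    have "continuous_on (tint T) (\<lambda>t. LINT x:{0<..}|lborel. ?\<psi> x * ((1 + x) * f t x))"
    proof (rule weak)
      show "?\<psi> \<in> borel_measurable lborel" by measurable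
      show "bounded (range ?\<psi>)" using B' unfolding bounded_iff real_norm_def by blast
    qed
    moreover have "(LINT x:{0<..}|lborel. ?\<psi> x * ((1 + x) * f t x)) = (LINT x:{0<..}|lborel. \<psi> x * (x * f t x))" for t
      by (intro set_lebesgue_integral_cong) auto
    ultimately show "continuous_on (tint T) (\<lambda>t. LINT x:{0<..}|lborel. \<psi> x * (x * f t x))" by simp
  qed
  have L1: "\<exists>C. AE t in lborel. t \<in> {0<..<T'} \<longrightarrow> set_integrable lborel {0<..} (f t) \<and>
      (LINT x:{0<..}|lborel. \<bar>f t x\<bar>) \<le> C" if T': "0 < T'" "ereal T' < T" for T'
  proof (intro exI AE_I2 impI)
    fix t assume t: "t \<in> {0<..<T'}"
    have "T' \<in> tint T" using T' by (simp add: tint_def)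
    then have tT: "t \<in> tint T" by (rule tint_down) (use t in auto)
    show "set_integrable lborel {0<..} (f t) \<and>
      (LINT x:{0<..}|lborel. \<bar>f t x\<bar>) \<le> exp (rate * T') * (LINT l|lborel. dom T' l)"
      unfolding f_def using dens_L1_bound[OF adm[OF tT], of t T'] t by auto
  qed
  have weak_form: "let S = {z::real\<times>real. fst z \<in> tint T \<and> 0 < snd z};
             G = (\<lambda>z. (\<phi>t (fst z) (snd z) + (a (snd z) * LS_u rho f (fst z) - b (snd z)) * \<phi>x (fst z) (snd z))
                        * f (fst z) (snd z));
             H = (\<lambda>t. \<phi> t 0 * n (LS_u rho f t))
         in set_integrable lborel S G \<and> set_integrable lborel (tint T) H \<and>
            set_integrable lborel {0<..} (\<lambda>x. \<phi> 0 x * fin x) \<and>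
            (LINT z:S|lborel. G z) + (LINT t:tint T|lborel. H t)
              + (LINT x:{0<..}|lborel. \<phi> 0 x * fin x) = 0"
    if test: "test_fun T \<phi> \<phi>t \<phi>x" for \<phi> \<phi>t \<phi>x
  proof -
    have dt: "\<And>t x. ((\<lambda>s. \<phi> s x) has_real_derivative \<phi>t t x) (at t)"
      and dx: "\<And>t x. ((\<lambda>y. \<phi> t y) has_real_derivative \<phi>x t x) (at x)"
      and ct: "continuous_on UNIV (\<lambda>z. \<phi>t (fst z) (snd z))"
      and cx: "continuous_on UNIV (\<lambda>z. \<phi>x (fst z) (snd z))"
      using test unfolding test_fun_def by auto
    obtain T' R where T': "ereal T' < T"
      and supp0: "\<forall>t x. 0 \<le> t \<longrightarrow> 0 \<le> x \<longrightarrow> (T' < t \<or> R < x) \<longrightarrow> \<phi> t x = 0"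
      using test unfolding test_fun_def by blast
    have supp: "\<phi> t x = 0" if "0 \<le> t" "0 \<le> x" "T' < t \<or> R < x" for t x
      using supp0 that by blast
    have "ereal (max 0 T') < T" using T' T_pos by (simp add: max_def zero_ereal_def)
    from ereal_dense2[OF this] obtain \<tau> where tau': "ereal (max 0 T') < ereal \<tau>" "ereal \<tau> < T" by blast
    then have tau: "max 0 T' < \<tau>" "ereal \<tau> < T" by (simp_all only: less_ereal.simps)
    then have tauT: "\<tau> \<in> tint T" by (simp add: tint_def)
    let ?v = "stop u \<tau>"
    have v: "adm ?v" by (rule adm[OF tauT])
    have pt: "0 < \<tau>" "T' < \<tau>" using tau by auto
    note wf = weak_formulation[OF v pt dt dx ct cx supp]
    let ?G = "\<lambda>z. (\<phi>t (fst z) (snd z) + (a (snd z) * LS_u rho f (fst z) - b (snd z)) * \<phi>x (fst z) (snd z))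
                        * f (fst z) (snd z)"
    let ?S = "{z::real\<times>real. fst z \<in> tint T \<and> 0 < snd z}"
    \<comment> \<open>Only the derivatives of the test function occur in \<open>?G\<close>; they
      vanish after \<open>\<tau>\<close> because the function vanishes on a neighbourhood
      there.\<close>
    have late: "\<phi>t t x = 0" "\<phi>x t x = 0" if "\<tau> < t" "0 < x" for t x
    proof -
      have "\<forall>\<^sub>F s in nhds t. s \<in> {\<tau><..}" using that by (intro eventually_nhds_in_open) auto
      then have "\<forall>\<^sub>F s in nhds t. \<phi> s x = 0"
        by eventually_elim (use supp that pt in auto)
      then have "((\<lambda>s. \<phi> s x) has_real_derivative \<phi>t t x) (at t) = ((\<lambda>_. 0) has_real_derivative \<phi>t t x) (at t)"
        by (intro DERIV_cong_ev) auto
      then show "\<phi>t t x = 0" using dt[of x t] DERIV_unique[OF _ DERIV_const] by blast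
      have "\<forall>\<^sub>F y in nhds x. y \<in> {0<..}" using that by (intro eventually_nhds_in_open) auto
      then have "\<forall>\<^sub>F y in nhds x. \<phi> t y = 0"
        by eventually_elim (use supp that pt in auto)
      then have "(\<phi> t has_real_derivative \<phi>x t x) (at x) = ((\<lambda>_. 0) has_real_derivative \<phi>x t x) (at x)"
        by (intro DERIV_cong_ev) auto
      then show "\<phi>x t x = 0" using dx[of t x] DERIV_unique[OF _ DERIV_const] by blast
    qed
    have G_eq: "indicator ?S z *\<^sub>R ?G z = indicator ({0..\<tau>} \<times> {0<..}) z *\<^sub>R
        ((\<phi>t (fst z) (snd z) + (a (snd z) * ?v (fst z) - b (snd z)) * \<phi>x (fst z) (snd z)) * dens ?v (fst z) (snd z))" for z
    proof -
      obtain t x where z: "z = (t, x)" by fastforce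
      consider "0 \<le> t" "t \<le> \<tau>" "0 < x" | "\<tau> < t" "0 < x" | "t < 0 \<or> x \<le> 0" by linarith
      then show ?thesis
      proof cases
        case 1
        have "t \<in> tint T" by (rule tint_down[OF tauT 1(1,2)])
        then show ?thesis using 1 f_eq[OF tauT 1] LSu[of t] by (simp add: z stop_eq)
      next
        case 2
        then show ?thesis using late[OF 2] by (simp add: z)
      next
        case 3
        then show ?thesis by (auto simp: z tint_def indicator_def)
      qed
    qed
    have H_eq: "indicator (tint T) t *\<^sub>R (\<phi> t 0 * n (LS_u rho f t)) = indicator {0..<\<tau>} t *\<^sub>R (\<phi> t 0 * n (?v t))" for t
    proof -
      consider "0 \<le> t" "t < \<tau>" | "\<tau> \<le> t" | "t < 0" by linarith
      then show ?thesis
      proof cases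
        case 1
        then have "t \<in> tint T" by (intro tint_down[OF tauT]) auto
        then show ?thesis using 1 LSu[of t] by (simp add: stop_eq)
      next
        case 2
        then have "\<phi> t 0 = 0" using pt by (intro supp) auto
        then show ?thesis by simp
      next
        case 3
        then show ?thesis by (simp add: tint_def)
      qed
    qed
    show ?thesis
      using wf unfolding Let_def set_integrable_def set_lebesgue_integral_def G_eq H_eq by blast
  qed
  have LS: "LS_solution T rho a b n (ereal p0) fin f"
    unfolding LS_solution_def
  proof (intro conjI allI impI ballI)
    show "wL1_cont (\<lambda>x. x) T f" by (rule wL1x)
    show "0 \<le> f t x" if "t \<in> tint T" "0 < x" for t x
      unfolding f_def using that by (intro dens_nonneg adm) (auto simp: tint_def)
    show "ereal p0 < ereal (LS_u rho f t)" if "t \<in> tint T" for t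
      using LSu[OF that] above[of t] that by (simp add: tint_def)
  qed (use L1 weak_form in auto)
  have T0: "0 \<in> tint T" using T_pos by (simp add: tint_def zero_ereal_def)
  \<comment> \<open>At time 0 label and position coincide, so the Jacobian is 1 and the initial
    value is attained at every \<open>x > 0\<close>.\<close>
  have init: "f 0 x = fin x" if x: "0 < x" for x
  proof -
    have v: "adm (stop u 0)" by (rule adm[OF T0])
    have Q0: "Q (stop u 0) 0 l = l" if "0 < l" for l using Q_start[OF v, of l] that by simp
    have l: "lab (stop u 0) 0 x = x" using lab_Q[OF v order_refl, of x] Q0[OF x] x by simp
    have "\<forall>\<^sub>F l in nhds x. l \<in> {0<..}" using x by (intro eventually_nhds_in_open) auto
    then have "\<forall>\<^sub>F l in nhds x. Q (stop u 0) 0 l = l" by eventually_elim (use Q0 in auto)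
    then have "(Q (stop u 0) 0 has_real_derivative 1) (at x) = ((\<lambda>l. l) has_real_derivative 1) (at x)"
      by (intro DERIV_cong_ev) auto
    then have "Qd (stop u 0) 0 x = 1" by (intro Qd_eq) simp
    then show ?thesis using x by (simp add: f_def push_def l wt_def)
  qed
  have flux: "((\<lambda>x. (a x * LS_u rho f t - b x) * f t x) \<longlongrightarrow> n (LS_u rho f t)) (at_right 0)"
    if t: "0 < t" "ereal t < T" for t
  proof -
    have tT: "t \<in> tint T" using t by (simp add: tint_def)
    show ?thesis using boundary_flux[OF adm[OF tT] t(1)] t(1) LSu[OF tT] by (simp add: f_def stop_eq)
  qed
  have final: "T = \<infinity> \<or> (T < \<infinity> \<and> ((\<lambda>t. ereal (LS_u rho f t)) \<longlongrightarrow> ereal p0) (at_left (real_of_ereal T)))"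
  proof (cases "S = {}")
    case True
    then show ?thesis by (simp add: T_def)
  next
    case False
    let ?s = "Inf S"
    have T: "T = ereal ?s" using False by (simp add: T_def)
    have s: "0 < ?s" using T_pos T by simp
    have us: "u ?s \<le> p0" using Inf_S[OF False] by (simp add: S_def)
    have "(u \<longlongrightarrow> u ?s) (at ?s within {0..})"
      using u_cont s by (simp add: continuous_on_def)
    moreover have "at ?s within {0..} = at ?s" using s by (intro at_within_interior) auto
    ultimately have lim: "(u \<longlongrightarrow> u ?s) (at_left ?s)" by (auto intro: tendsto_within_subset)
    have ev: "\<forall>\<^sub>F t in at_left ?s. 0 < t \<and> t < ?s"
    proof (intro eventually_conj)
      show "\<forall>\<^sub>F t in at_left ?s. 0 < t" using order_tendstoD(1)[OF tendsto_ident_at s] .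
      show "\<forall>\<^sub>F t in at_left ?s. t < ?s" by (simp add: eventually_at_filter)
    qed
    \<comment> \<open>Before \<open>?s\<close> the concentration exceeds \<open>p0\<close>, at
      \<open>?s\<close> it is at most \<open>p0\<close>; by continuity the limit is exactly
      \<open>p0\<close>.\<close>
    have "p0 \<le> u ?s"
    proof (rule tendsto_lowerbound[OF lim])
      show "\<forall>\<^sub>F t in at_left ?s. p0 \<le> u t"
        using ev by eventually_elim (use above T in \<open>auto intro: less_imp_le\<close>)
    qed simp
    with us have "u ?s = p0" by simp
    then have "((\<lambda>t. ereal (u t)) \<longlongrightarrow> ereal p0) (at_left ?s)" using lim by simp
    moreover have "\<forall>\<^sub>F t in at_left ?s. ereal (u t) = ereal (LS_u rho f t)"
      using ev by eventually_elim (use LSu T in \<open>auto simp: tint_def\<close>)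
    ultimately have "((\<lambda>t. ereal (LS_u rho f t)) \<longlongrightarrow> ereal p0) (at_left ?s)"
      by (rule Lim_transform_eventually)
    then show ?thesis by (simp add: T)
  qed
  show ?thesis using T_pos wL1 LS init flux final by (intro exI[of _ T] exI[of _ f]) auto
qed

end

theorem mainTheorem1:
  fixes \<rho> :: real and a b n fin :: "real \<Rightarrow> real" and \<Phi>0 :: ereal
  assumes rho_pos: "0 < \<rho>"
    and a_nonneg: "\<forall>x\<ge>0. 0 \<le> a x" and b_nonneg: "\<forall>x\<ge>0. 0 \<le> b x"
    \<comment> \<open>(i)\<close>
    and a_C0: "continuous_on {0..} a" and b_C0: "continuous_on {0..} b"
    and a_C1: "\<forall>x>0. a differentiable (at x)" "continuous_on {0<..} (deriv a)"
    and b_C1: "\<forall>x>0. b differentiable (at x)" "continuous_on {0<..} (deriv b)"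
    \<comment> \<open>(ii)\<close>
    and a'_bdd: "bounded (deriv a ` {1<..})" and b'_bdd: "bounded (deriv b ` {1<..})"
    \<comment> \<open>(iii)\<close>
    and a_pos: "\<forall>x>0. 0 < a x"
    and inv_a_L1: "set_integrable lborel {0<..<1} (\<lambda>x. 1 / a x)"
    \<comment> \<open>(iv)\<close>
    and Phi_lim: "((\<lambda>x. ereal (b x / a x)) \<longlongrightarrow> \<Phi>0) (at_right 0)"
    and Phi0_nonneg: "0 \<le> \<Phi>0"
    and Phi0_lt: "\<Phi>0 < ereal \<rho>"
    and Phi'_L1: "set_integrable lborel {0<..<1} (deriv (\<lambda>x. b x / a x))"
    \<comment> \<open>(v)\<close>
    and n_nonneg: "\<forall>x. \<Phi>0 \<le> ereal x \<longrightarrow> 0 \<le> n x"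
    and n_cont: "continuous_on {x. \<Phi>0 \<le> ereal x} n"
    \<comment> \<open>initial datum\<close>
    and fin_nonneg: "\<forall>x>0. 0 \<le> fin x"
    and fin_L1: "set_integrable lborel {0<..} (\<lambda>x. (1 + x) * fin x)"
    and uin: "ereal (\<rho> - (LINT x:{0<..}|lborel. x * fin x)) > \<Phi>0"
  shows "\<exists>(T::ereal) (f::real \<Rightarrow> real \<Rightarrow> real). 0 < T \<and>
           wL1_cont (\<lambda>x. 1 + x) T f \<and>
           LS_solution T \<rho> a b n \<Phi>0 fin f \<and>
           (AE x in lborel. 0 < x \<longrightarrow> f 0 x = fin x) \<and>
           (\<forall>t. 0 < t \<and> ereal t < T \<longrightarrow>
              ((\<lambda>x. (a x * LS_u \<rho> f t - b x) * f t x) \<longlongrightarrow> n (LS_u \<rho> f t)) (at_right 0)) \<and>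
           (T = \<infinity> \<or> (T < \<infinity> \<and>
              ((\<lambda>t. ereal (LS_u \<rho> f t)) \<longlongrightarrow> \<Phi>0) (at_left (real_of_ereal T))))"
proof -
  \<comment> \<open>Being nonnegative and below \<open>\<rho>\<close>, the limit of
    \<open>b / a\<close> is a real number.\<close>
  obtain p0 where p0: "\<Phi>0 = ereal p0"
    using Phi0_nonneg Phi0_lt by (cases \<Phi>0) auto
  interpret ls_data a b p0 \<rho> n fin
  proof
    show "((\<lambda>x. b x / a x) \<longlongrightarrow> p0) (at_right 0)" using Phi_lim by (simp add: p0)
    show "continuous_on {p0..} n"
      using n_cont by (simp add: p0 atLeast_def)
    show "p0 < \<rho> - (LINT x:{0<..}|lborel. x * fin x)" using uin by (simp add: p0)
  qed (use assms in \<open>auto simp: p0\<close>)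
  show ?thesis unfolding p0 by (rule solution_exists)
qed

end
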